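(* Let $\Lambda$ be a strongly connected finite $k$-graph, $(G,\Lambda)$ a finite-state self-similar groupoid action, and $x_\Lambda$ the unimodular Perron–Frobenius eigenvector of $\Lambda$. Let $\sigma$ be the preferred dynamics on $\mathcal O(G,\Lambda)$, $\sigma_t(t_\lambda u_gt_\mu^* )=\rho(\Lambda)^{it(d(\lambda)-d(\mu))}t_\lambda u_gt_\mu^*$, and let $V$ be the unitary representation of $\operatorname{Per}(G,\Lambda)$ in $\mathcal O(G,\Lambda)$ given by $V_{p-q}=\sum_{\lambda\in\Lambda^p}t_\lambda u_{h_{p,q}(\lambda)}t_{\theta_{p,q}(\lambda)}^*$. If $\phi$ is a KMS$_1$-state for $(\mathcal O(G,\Lambda),\sigma)$, then for all $\lambda,\mu\in\Lambda$ and $g\in G$ with $s(\lambda)=\operatorname{cod}(g)$ and $s(\mu)=\operatorname{dom}(g)$, the value $\phi(t_\lambda u_gt_\mu^* )$ equals (i) $\rho(\Lambda)^{-d(\mu)}x_\Lambda(s(\mu))\,\phi(V_{d(\lambda)-d(\mu)})$ if $d(\lambda)-d(\mu)\in\operatorname{Per}(G,\Lambda)$, $\mu=\theta_{d(\lambda),d(\mu)}(\lambda)$ and $g=h_{d(\lambda),d(\mu)}(\lambda)$; (ii) $\rho(\Lambda)^{-d(\mu)}c_{d(\lambda),d(\mu),\lambda}(g)\,\phi(V_{d(\lambda)-d(\mu)})$ if $d(\lambda)-d(\mu)\in\operatorname{Per}(G,\Lambda)$, $\mu=\theta_{d(\lambda),d(\mu)}(\lambda)$ and $g\neq h_{d(\lambda),d(\mu)}(\lambda)$;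 (iii) $0$ otherwise.
   Context: Conventions: $\mathbb N=\{0,1,2,\dots\}$ and $e_1,\dots,e_k$ are the standard generators of $\mathbb N^k$ ($k\ge1$). A $k$-graph is a countable small category $\Lambda$ with a degree functor $d:\Lambda\to\mathbb N^k$ such that whenever $d(\lambda)=p+q$ there are unique $\mu,\nu$ with $\lambda=\mu\nu$, $d(\mu)=p$, $d(\nu)=q$. Write $\Lambda^p=d^{-1}(p)$; $\Lambda^0$ is identified with the set of objects (vertices); $r,s:\Lambda\to\Lambda^0$ are the codomain and domain maps, so $\lambda\mu$ is defined iff $s(\lambda)=r(\mu)$. An edge is an element of some $\Lambda^{e_i}$. $v\Lambda=r^{-1}(v)$, $\Lambda v=s^{-1}(v)$, $v\Lambda^p=v\Lambda\cap\Lambda^p$, $v\Lambda^pw=v\Lambda^p\cap\Lambda w$. $\Lambda$ is finite if every $\Lambda^p$ is finite; it is strongly connected if $v\Lambda w\ne\emptyset$ for all $v,w\in\Lambda^0$; as usual $\Lambda^{e_i}\neq\emptyset$ for each $i$. Self-similar actions: For a groupoid $G$, $\operatorname{dom},\operatorname{cod}$ are the source and range maps, and $gh$ is defined iff $\operatorname{dom}(g)=\operatorname{cod}(h)$. A partial isomorphism of $\Lambda$ consists of $v,w\in\Lambda^0$ and a bijection $g:v\Lambda\to w\Lambda$ with $g(v\Lambda^p)=w\Lambda^p$ for all $p$, and $g(\lambda e)\in g(\lambda)\Lambda$ for all $\lambda\in v\Lambda$ and edges $e\in s(\lambda)\Lambda$; put $\operatorname{dom}(g)=v$, $\operatorname{cod}(g)=w$.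 These form a groupoid $\operatorname{PIso}(\Lambda)$ under composition, with unit space $\Lambda^0$ ($v$ identified with $\mathrm{id}_{v\Lambda}$). An action of a groupoid $G$ with unit space $\Lambda^0$ on $\Lambda$ is a (unit-preserving) groupoid homomorphism $G\to\operatorname{PIso}(\Lambda)$, written $g\cdot\mu$; it is faithful if injective. A self-similar groupoid action $(G,\Lambda)$ is a faithful action such that for every $g\in G$ and edge $e\in\operatorname{dom}(g)\Lambda$ there is $h\in G$ with $g\cdot(e\lambda)=(g\cdot e)(h\cdot\lambda)$ for all $\lambda\in s(e)\Lambda$; this $h$ is unique and written $g|_e$. For $\lambda\in\operatorname{dom}(g)\Lambda$, factored into edges as $\lambda_1\cdots\lambda_l$, put $g|_\lambda=(\cdots(g|_{\lambda_1})|_{\lambda_2}\cdots)|_{\lambda_l}$ (independent of the factorisation; $g|_{\operatorname{dom}(g)}=g$), so $g\cdot(\lambda\mu)=(g\cdot\lambda)(g|_\lambda\cdot\mu)$. The action is finite-state if for every $g\in G\setminus\Lambda^0$ the set $\{g|_\lambda:\lambda\in\operatorname{dom}(g)\Lambda\}$ is finite. Algebra: A unitary representation of $G$ in a $C^*$-algebra is a family of partial isometries $\{U_g\}$ such that the $U_v$ ($v\in G^{(0)}$) are mutually orthogonal projections, $U_g^*=U_{g^{-1}}$, and $U_gU_h=U_{gh}$ if $\operatorname{dom}(g)=\operatorname{cod}(h)$, $0$ otherwise. For $\lambda,\mu\in\Lambda$, $\Lambda^{\min}(\lambda,\mu)=\{(\eta,\zeta):\lambda\eta=\mu\zeta,\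 d(\lambda\eta)=d(\lambda)\vee d(\mu)\}$. A Toeplitz–Cuntz–Krieger $\Lambda$-family is a set of partial isometries $\{T_\lambda\}$ with $\{T_v:v\in\Lambda^0\}$ mutually orthogonal projections, $T_\lambda T_\mu=T_{\lambda\mu}$ if $s(\lambda)=r(\mu)$, and $T_\lambda^*T_\mu=\sum_{(\eta,\zeta)\in\Lambda^{\min}(\lambda,\mu)}T_\eta T_\zeta^*$; it is a Cuntz–Krieger family if also $T_v=\sum_{\lambda\in v\Lambda^p}T_\lambda T_\lambda^*$ for all $v\in\Lambda^0$, $p\in\mathbb N^k$. The Cuntz–Pimsner algebra $\mathcal O(G,\Lambda)$ is the universal $C^*$-algebra generated by a unitary representation $u$ of $G$ and a Cuntz–Krieger $\Lambda$-family $t$ such that $u_v=t_v$ ($v\in\Lambda^0$), $\sum_vt_v=1$, and $u_gt_\lambda=t_{g\cdot\lambda}u_{g|_\lambda}$ if $\operatorname{dom}(g)=r(\lambda)$, $0$ otherwise. Perron–Frobenius data: $B_i(v,w)=|v\Lambda^{e_i}w|$, $\rho(B_i)$ is the spectral radius (it is positive), $\rho(\Lambda)^n=\prod_i\rho(B_i)^{n_i}$ for $n\in\mathbb Z^k$ (and $\rho(\Lambda)^{itn}=\prod_i\rho(B_i)^{itn_i}$). The unimodular Perron–Frobenius eigenvector $x_\Lambda\in(0,\infty)^{\Lambda^0}$ is the unique vector with unit $1$-norm and $B_ix_\Lambda=\rho(B_i)x_\Lambda$ for all $i$. Periodicity: $\Lambda^\infty$ is the set of degree-preserving functors $x:\Omega_k\to\Lambda$,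 where $\Omega_k=\{(p,q)\in\mathbb N^k\times\mathbb N^k:p\le q\}$ with $(p,q)(q,n)=(p,n)$, $d(p,q)=q-p$; $r(x)=x(0,0)$, $v\Lambda^\infty=\{x:r(x)=v\}$, $\sigma^n(x)(p,q)=x(p+n,q+n)$; for $\lambda\in\Lambda$, $y\in s(\lambda)\Lambda^\infty$, $\lambda y$ is the concatenation. $G$ acts on $\Lambda^\infty$ by $(g\cdot x)(p,q)=g|_{x(0,p)}\cdot x(p,q)$ for $x\in\operatorname{dom}(g)\Lambda^\infty$. $\operatorname{Per}(G,\Lambda)$ is the set of $p-q$ ($p,q\in\mathbb N^k$) for which there is $g\in G$ with $\sigma^p(x)=\sigma^q(g\cdot x)$ for all $x\in\operatorname{dom}(g)\Lambda^\infty$; it is a subgroup of $\mathbb Z^k$. For $p,q\in\mathbb N^k$ with $p-q\in\operatorname{Per}(G,\Lambda)$ and $\lambda\in\Lambda^p$, $(\theta_{p,q}(\lambda),h_{p,q}(\lambda))$ denotes the unique pair in $\Lambda^q\times G$ with $\operatorname{cod}(h_{p,q}(\lambda))=s(\lambda)$, $\operatorname{dom}(h_{p,q}(\lambda))=s(\theta_{p,q}(\lambda))$ and $\lambda(h_{p,q}(\lambda)\cdot x)=\theta_{p,q}(\lambda)x$ for all $x\in\operatorname{dom}(h_{p,q}(\lambda))\Lambda^\infty$. The element $V_{p-q}$ depends only on $p-q$. With $N=(1,\dots,1)\in\mathbb N^k$, for $g\in G$ with $g\neq h_{p,q}(\lambda)$, $\operatorname{cod}(g)=\operatorname{cod}(h_{p,q}(\lambda))$,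 $\operatorname{dom}(g)=\operatorname{dom}(h_{p,q}(\lambda))$, put $$c_{p,q,\lambda}(g)=\lim_{l\to\infty}\rho(\Lambda)^{-lN}\sum_{v\in\Lambda^0}\big|\{\mu\in\operatorname{dom}(g)\Lambda^{lN}v:g\cdot\mu=h_{p,q}(\lambda)\cdot\mu,\ g|_\mu=h_{p,q}(\lambda)|_\mu\}\big|\,x_\Lambda(v)$$ (the limit exists). KMS states: $a$ is analytic for $\sigma:\mathbb R\to\operatorname{Aut}(A)$ if $t\mapsto\sigma_t(a)$ extends to an analytic function on $\mathbb C$; a state $\phi$ is KMS$_\beta$ if $\phi(ab)=\phi(b\,\sigma_{i\beta}(a))$ for all analytic $a,b$. *)

theory Defs
  imports "HOL-Analysis.Analysis" "HOL-Algebra.Module"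
begin

section \<open>Higher-rank graphs\<close>

text \<open>
  The degree monoid is \<open>nat ^ 'k\<close>, whose order is componentwise and whose generators are
  \<open>axis i 1\<close>. Subtraction on \<open>nat ^ 'k\<close> truncates, so differences are taken in \<open>int ^ 'k\<close>.
\<close>

definition vec_int :: "nat ^ 'k \<Rightarrow> int ^ 'k" where
  "vec_int p = (\<chi> i. int (p $ i))"

definition vec_join :: "nat ^ 'k \<Rightarrow> nat ^ 'k \<Rightarrow> nat ^ 'k" where
  "vec_join p q = (\<chi> i. max (p $ i) (q $ i))"

text \<open>
  A category is given by its morphisms alone: an object is identified with its identity morphism.
  The composite \<open>cat \<Lambda> \<kappa> \<mu>\<close> is meaningful only if \<open>src \<Lambda> \<kappa> = rng \<Lambda> \<mu>\<close>.
  Paths are named \<open>\<kappa>\<close>, \<open>\<mu>\<close>, \<open>\<nu>\<close>, because the usual \<open>\<lambda>\<close> is reserved in HOL.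
\<close>

record ('m, 'k) kgraph =
  paths :: "'m set"
  rng :: "'m \<Rightarrow> 'm"
  src :: "'m \<Rightarrow> 'm"
  cat :: "'m \<Rightarrow> 'm \<Rightarrow> 'm"
  deg :: "'m \<Rightarrow> nat ^ 'k"

definition paths_of_degree :: "('m, 'k::finite) kgraph \<Rightarrow> nat ^ 'k \<Rightarrow> 'm set" where
  "paths_of_degree \<Lambda> p = {\<kappa> \<in> paths \<Lambda>. deg \<Lambda> \<kappa> = p}"

definition verts :: "('m, 'k::finite) kgraph \<Rightarrow> 'm set" where
  "verts \<Lambda> = paths_of_degree \<Lambda> 0"

definition edges :: "('m, 'k::finite) kgraph \<Rightarrow> 'm set" where
  "edges \<Lambda> = (\<Union>i. paths_of_degree \<Lambda> (axis i 1))"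

definition paths_from :: "('m, 'k::finite) kgraph \<Rightarrow> 'm \<Rightarrow> 'm set" where
  "paths_from \<Lambda> v = {\<kappa> \<in> paths \<Lambda>. rng \<Lambda> \<kappa> = v}"

locale k_graph =
  fixes \<Lambda> :: "('m, 'k::finite) kgraph"
  assumes countable_paths: "countable (paths \<Lambda>)"
    and rng_closed: "\<kappa> \<in> paths \<Lambda> \<Longrightarrow> rng \<Lambda> \<kappa> \<in> paths \<Lambda>"
    and src_closed: "\<kappa> \<in> paths \<Lambda> \<Longrightarrow> src \<Lambda> \<kappa> \<in> paths \<Lambda>"
    and rng_rng: "\<kappa> \<in> paths \<Lambda> \<Longrightarrow> rng \<Lambda> (rng \<Lambda> \<kappa>) = rng \<Lambda> \<kappa>"
    and src_rng: "\<kappa> \<in> paths \<Lambda> \<Longrightarrow> src \<Lambda> (rng \<Lambda> \<kappa>) = rng \<Lambda> \<kappa>"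
    and rng_src: "\<kappa> \<in> paths \<Lambda> \<Longrightarrow> rng \<Lambda> (src \<Lambda> \<kappa>) = src \<Lambda> \<kappa>"
    and src_src: "\<kappa> \<in> paths \<Lambda> \<Longrightarrow> src \<Lambda> (src \<Lambda> \<kappa>) = src \<Lambda> \<kappa>"
    and cat_closed: "\<lbrakk>\<kappa> \<in> paths \<Lambda>; \<mu> \<in> paths \<Lambda>; src \<Lambda> \<kappa> = rng \<Lambda> \<mu>\<rbrakk> \<Longrightarrow> cat \<Lambda> \<kappa> \<mu> \<in> paths \<Lambda>"
    and rng_cat: "\<lbrakk>\<kappa> \<in> paths \<Lambda>; \<mu> \<in> paths \<Lambda>; src \<Lambda> \<kappa> = rng \<Lambda> \<mu>\<rbrakk> \<Longrightarrow> rng \<Lambda> (cat \<Lambda> \<kappa> \<mu>) = rng \<Lambda> \<kappa>"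
    and src_cat: "\<lbrakk>\<kappa> \<in> paths \<Lambda>; \<mu> \<in> paths \<Lambda>; src \<Lambda> \<kappa> = rng \<Lambda> \<mu>\<rbrakk> \<Longrightarrow> src \<Lambda> (cat \<Lambda> \<kappa> \<mu>) = src \<Lambda> \<mu>"
    and cat_rng: "\<kappa> \<in> paths \<Lambda> \<Longrightarrow> cat \<Lambda> (rng \<Lambda> \<kappa>) \<kappa> = \<kappa>"
    and cat_src: "\<kappa> \<in> paths \<Lambda> \<Longrightarrow> cat \<Lambda> \<kappa> (src \<Lambda> \<kappa>) = \<kappa>"
    and cat_assoc: "\<lbrakk>\<kappa> \<in> paths \<Lambda>; \<mu> \<in> paths \<Lambda>; \<nu> \<in> paths \<Lambda>; src \<Lambda> \<kappa> = rng \<Lambda> \<mu>; src \<Lambda> \<mu> = rng \<Lambda> \<nu>\<rbrakk>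
          \<Longrightarrow> cat \<Lambda> (cat \<Lambda> \<kappa> \<mu>) \<nu> = cat \<Lambda> \<kappa> (cat \<Lambda> \<mu> \<nu>)"
    and deg_cat: "\<lbrakk>\<kappa> \<in> paths \<Lambda>; \<mu> \<in> paths \<Lambda>; src \<Lambda> \<kappa> = rng \<Lambda> \<mu>\<rbrakk>
          \<Longrightarrow> deg \<Lambda> (cat \<Lambda> \<kappa> \<mu>) = deg \<Lambda> \<kappa> + deg \<Lambda> \<mu>"
    and unique_factorisation: "\<lbrakk>\<kappa> \<in> paths \<Lambda>; deg \<Lambda> \<kappa> = p + q\<rbrakk>
          \<Longrightarrow> \<exists>!f. fst f \<in> paths_of_degree \<Lambda> p \<and> snd f \<in> paths_of_degree \<Lambda> q \<and>
                   src \<Lambda> (fst f) = rng \<Lambda> (snd f) \<and> \<kappa> = cat \<Lambda> (fst f) (snd f)"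
    and edges_nonempty: "paths_of_degree \<Lambda> (axis i 1) \<noteq> {}"
begin

lemma deg_identity:
  assumes "v \<in> paths \<Lambda>" "rng \<Lambda> v = v"
  shows "deg \<Lambda> v = 0"
proof -
  have "src \<Lambda> v = v" using src_rng assms by metis
  then have "deg \<Lambda> v = deg \<Lambda> v + deg \<Lambda> v"
    using deg_cat[of v v] cat_rng[of v] assms by simp
  then show ?thesis by simp
qed

text \<open>The paths of degree zero are exactly the identity morphisms.\<close>

lemma verts_eq_identities: "verts \<Lambda> = {v \<in> paths \<Lambda>. rng \<Lambda> v = v}"
proof (intro equalityI subsetI)
  fix v assume v: "v \<in> verts \<Lambda>"
  then have p: "v \<in> paths \<Lambda>" and d: "deg \<Lambda> v = 0 + 0"
    by (auto simp: verts_def paths_of_degree_def)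
  have r: "deg \<Lambda> (rng \<Lambda> v) = 0" "deg \<Lambda> (src \<Lambda> v) = 0"
    using p rng_closed src_closed rng_rng rng_src deg_identity by auto
  have 1: "fst (v, src \<Lambda> v) \<in> paths_of_degree \<Lambda> 0 \<and> snd (v, src \<Lambda> v) \<in> paths_of_degree \<Lambda> 0 \<and>
      src \<Lambda> (fst (v, src \<Lambda> v)) = rng \<Lambda> (snd (v, src \<Lambda> v)) \<and>
      v = cat \<Lambda> (fst (v, src \<Lambda> v)) (snd (v, src \<Lambda> v))"
    using p d r src_closed rng_src cat_src by (auto simp: paths_of_degree_def)
  have 2: "fst (rng \<Lambda> v, v) \<in> paths_of_degree \<Lambda> 0 \<and> snd (rng \<Lambda> v, v) \<in> paths_of_degree \<Lambda> 0 \<and>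
      src \<Lambda> (fst (rng \<Lambda> v, v)) = rng \<Lambda> (snd (rng \<Lambda> v, v)) \<and>
      v = cat \<Lambda> (fst (rng \<Lambda> v, v)) (snd (rng \<Lambda> v, v))"
    using p d r rng_closed src_rng cat_rng by (auto simp: paths_of_degree_def)
  from unique_factorisation[OF p d] 1 2 have "(v, src \<Lambda> v) = (rng \<Lambda> v, v)"
    by blast
  then show "v \<in> {v \<in> paths \<Lambda>. rng \<Lambda> v = v}" using p by simp
next
  fix v assume "v \<in> {v \<in> paths \<Lambda>. rng \<Lambda> v = v}"
  then show "v \<in> verts \<Lambda>" using deg_identity by (auto simp: verts_def paths_of_degree_def)
qed

end

definition finite_kgraph :: "('m, 'k::finite) kgraph \<Rightarrow> bool" where
  "finite_kgraph \<Lambda> \<longleftrightarrow> (\<forall>p. finite (paths_of_degree \<Lambda> p))"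

definition strongly_connected :: "('m, 'k::finite) kgraph \<Rightarrow> bool" where
  "strongly_connected \<Lambda> \<longleftrightarrow>
     (\<forall>v \<in> verts \<Lambda>. \<forall>w \<in> verts \<Lambda>. \<exists>\<kappa> \<in> paths \<Lambda>. rng \<Lambda> \<kappa> = v \<and> src \<Lambda> \<kappa> = w)"

fun edge_factorisation :: "('m, 'k::finite) kgraph \<Rightarrow> 'm \<Rightarrow> 'm list \<Rightarrow> bool" where
  "edge_factorisation \<Lambda> \<kappa> [] \<longleftrightarrow> \<kappa> \<in> verts \<Lambda>"
| "edge_factorisation \<Lambda> \<kappa> (e # es) \<longleftrightarrow> e \<in> edges \<Lambda> \<and>
     (\<exists>\<mu>. edge_factorisation \<Lambda> \<mu> es \<and> src \<Lambda> e = rng \<Lambda> \<mu> \<and> \<kappa> = cat \<Lambda> e \<mu>)"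

definition min_extensions :: "('m, 'k::finite) kgraph \<Rightarrow> 'm \<Rightarrow> 'm \<Rightarrow> ('m \<times> 'm) set" where
  "min_extensions \<Lambda> \<kappa> \<mu> = {(\<eta>, \<zeta>). \<eta> \<in> paths_from \<Lambda> (src \<Lambda> \<kappa>) \<and> \<zeta> \<in> paths_from \<Lambda> (src \<Lambda> \<mu>) \<and>
     cat \<Lambda> \<kappa> \<eta> = cat \<Lambda> \<mu> \<zeta> \<and> deg \<Lambda> (cat \<Lambda> \<kappa> \<eta>) = vec_join (deg \<Lambda> \<kappa>) (deg \<Lambda> \<mu>)}"


subsection \<open>Perron--Frobenius data\<close>

definition vertex_matrix :: "('m, 'k::finite) kgraph \<Rightarrow> 'k \<Rightarrow> 'm \<Rightarrow> 'm \<Rightarrow> nat" where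
  "vertex_matrix \<Lambda> i v w =
     card {\<kappa> \<in> paths_of_degree \<Lambda> (axis i 1). rng \<Lambda> \<kappa> = v \<and> src \<Lambda> \<kappa> = w}"

definition eigenvalues_on :: "'v set \<Rightarrow> ('v \<Rightarrow> 'v \<Rightarrow> complex) \<Rightarrow> complex set" where
  "eigenvalues_on S M =
     {z. \<exists>f. (\<exists>v\<in>S. f v \<noteq> 0) \<and> (\<forall>v\<in>S. (\<Sum>w\<in>S. M v w * f w) = z * f v)}"

definition spectral_radius_on :: "'v set \<Rightarrow> ('v \<Rightarrow> 'v \<Rightarrow> complex) \<Rightarrow> real" where
  "spectral_radius_on S M = Max (cmod ` eigenvalues_on S M)"

definition rho :: "('m, 'k::finite) kgraph \<Rightarrow> 'k \<Rightarrow> real" where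
  "rho \<Lambda> i = spectral_radius_on (verts \<Lambda>) (\<lambda>v w. of_nat (vertex_matrix \<Lambda> i v w))"

definition rho_pow :: "('m, 'k::finite) kgraph \<Rightarrow> int ^ 'k \<Rightarrow> real" where
  "rho_pow \<Lambda> n = (\<Prod>i\<in>UNIV. rho \<Lambda> i powi (n $ i))"

definition rho_imag_pow :: "('m, 'k::finite) kgraph \<Rightarrow> real \<Rightarrow> int ^ 'k \<Rightarrow> complex" where
  "rho_imag_pow \<Lambda> t n =
     (\<Prod>i\<in>UNIV. complex_of_real (rho \<Lambda> i) powr (\<i> * of_real t * of_int (n $ i)))"

definition unimodular_PF_eigenvector :: "('m, 'k::finite) kgraph \<Rightarrow> ('m \<Rightarrow> real) \<Rightarrow> bool" where
  "unimodular_PF_eigenvector \<Lambda> x \<longleftrightarrow>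
     (\<forall>v \<in> verts \<Lambda>. x v > 0) \<and> (\<Sum>v \<in> verts \<Lambda>. x v) = 1 \<and>
     (\<forall>i. \<forall>v \<in> verts \<Lambda>. (\<Sum>w \<in> verts \<Lambda>. of_nat (vertex_matrix \<Lambda> i v w) * x w) = rho \<Lambda> i * x v)"


subsection \<open>Infinite paths\<close>

text \<open>
  Infinite paths are required to be extensional on \<open>Omega\<close>, so that equality of
  infinite paths is equality of HOL functions.
\<close>

type_synonym ('m, 'k) inf_path = "(nat ^ 'k) \<times> (nat ^ 'k) \<Rightarrow> 'm"

definition Omega :: "((nat ^ 'k) \<times> (nat ^ 'k)) set" where
  "Omega = {(p, q). p \<le> q}"

definition inf_paths :: "('m, 'k::finite) kgraph \<Rightarrow> ('m, 'k) inf_path set" where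
  "inf_paths \<Lambda> = {x \<in> extensional Omega.
     (\<forall>p q. p \<le> q \<longrightarrow> x (p, q) \<in> paths \<Lambda> \<and> deg \<Lambda> (x (p, q)) = q - p) \<and>
     (\<forall>p q n. p \<le> q \<and> q \<le> n \<longrightarrow> src \<Lambda> (x (p, q)) = rng \<Lambda> (x (q, n)) \<and>
                                cat \<Lambda> (x (p, q)) (x (q, n)) = x (p, n))}"

definition inf_paths_from ::
    "('m, 'k::finite) kgraph \<Rightarrow> 'm \<Rightarrow> ('m, 'k) inf_path set" where
  "inf_paths_from \<Lambda> v = {x \<in> inf_paths \<Lambda>. x (0, 0) = v}"

definition shift ::
    "nat ^ 'k::finite \<Rightarrow> ('m, 'k) inf_path \<Rightarrow> ('m, 'k) inf_path" where
  "shift n x = restrict (\<lambda>(p, q). x (p + n, q + n)) Omega"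

definition inf_cat :: "('m, 'k::finite) kgraph \<Rightarrow> 'm \<Rightarrow>
    ('m, 'k) inf_path \<Rightarrow> ('m, 'k) inf_path" where
  "inf_cat \<Lambda> \<kappa> y = (THE x. x \<in> inf_paths \<Lambda> \<and> x (0, deg \<Lambda> \<kappa>) = \<kappa> \<and> shift (deg \<Lambda> \<kappa>) x = y)"


section \<open>Self-similar groupoid actions\<close>

text \<open>
  A groupoid with unit space \<open>\<Lambda>\<^sup>0\<close>; the unit at the vertex \<open>v\<close> is \<open>gunit G v\<close>. The product
  \<open>gmult G g h\<close> is meaningful only if \<open>gdom G g = gcod G h\<close>, and \<open>act G g \<kappa>\<close> only for paths
  \<open>\<kappa>\<close> with range \<open>gdom G g\<close>.
\<close>

record ('g, 'm) acting_groupoid =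
  elems :: "'g set"
  gdom :: "'g \<Rightarrow> 'm"
  gcod :: "'g \<Rightarrow> 'm"
  gmult :: "'g \<Rightarrow> 'g \<Rightarrow> 'g"
  ginv :: "'g \<Rightarrow> 'g"
  gunit :: "'m \<Rightarrow> 'g"
  act :: "'g \<Rightarrow> 'm \<Rightarrow> 'm"

definition partial_iso :: "('m, 'k::finite) kgraph \<Rightarrow> 'm \<Rightarrow> 'm \<Rightarrow> ('m \<Rightarrow> 'm) \<Rightarrow> bool" where
  "partial_iso \<Lambda> v w f \<longleftrightarrow> v \<in> verts \<Lambda> \<and> w \<in> verts \<Lambda> \<and>
     bij_betw f (paths_from \<Lambda> v) (paths_from \<Lambda> w) \<and>
     (\<forall>p. f ` (paths_from \<Lambda> v \<inter> paths_of_degree \<Lambda> p) = paths_from \<Lambda> w \<inter> paths_of_degree \<Lambda> p) \<and>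
     (\<forall>\<kappa> \<in> paths_from \<Lambda> v. \<forall>e \<in> edges \<Lambda> \<inter> paths_from \<Lambda> (src \<Lambda> \<kappa>).
        \<exists>\<nu> \<in> paths_from \<Lambda> (src \<Lambda> (f \<kappa>)). f (cat \<Lambda> \<kappa> e) = cat \<Lambda> (f \<kappa>) \<nu>)"

locale groupoid_over =
  fixes V :: "'m set" and G :: "('g, 'm) acting_groupoid"
  assumes gdom_closed: "g \<in> elems G \<Longrightarrow> gdom G g \<in> V"
    and gcod_closed: "g \<in> elems G \<Longrightarrow> gcod G g \<in> V"
    and gmult_closed: "\<lbrakk>g \<in> elems G; h \<in> elems G; gdom G g = gcod G h\<rbrakk> \<Longrightarrow> gmult G g h \<in> elems G"
    and gdom_gmult: "\<lbrakk>g \<in> elems G; h \<in> elems G; gdom G g = gcod G h\<rbrakk> \<Longrightarrow> gdom G (gmult G g h) = gdom G h"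
    and gcod_gmult: "\<lbrakk>g \<in> elems G; h \<in> elems G; gdom G g = gcod G h\<rbrakk> \<Longrightarrow> gcod G (gmult G g h) = gcod G g"
    and gmult_assoc: "\<lbrakk>g \<in> elems G; h \<in> elems G; k \<in> elems G; gdom G g = gcod G h; gdom G h = gcod G k\<rbrakk>
          \<Longrightarrow> gmult G (gmult G g h) k = gmult G g (gmult G h k)"
    and gunit_closed: "v \<in> V \<Longrightarrow> gunit G v \<in> elems G"
    and gdom_gunit: "v \<in> V \<Longrightarrow> gdom G (gunit G v) = v"
    and gcod_gunit: "v \<in> V \<Longrightarrow> gcod G (gunit G v) = v"
    and gmult_gunit_left: "g \<in> elems G \<Longrightarrow> gmult G (gunit G (gcod G g)) g = g"
    and gmult_gunit_right: "g \<in> elems G \<Longrightarrow> gmult G g (gunit G (gdom G g)) = g"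
    and ginv_closed: "g \<in> elems G \<Longrightarrow> ginv G g \<in> elems G"
    and gdom_ginv: "g \<in> elems G \<Longrightarrow> gdom G (ginv G g) = gcod G g"
    and gcod_ginv: "g \<in> elems G \<Longrightarrow> gcod G (ginv G g) = gdom G g"
    and gmult_ginv_left: "g \<in> elems G \<Longrightarrow> gmult G (ginv G g) g = gunit G (gdom G g)"
    and gmult_ginv_right: "g \<in> elems G \<Longrightarrow> gmult G g (ginv G g) = gunit G (gcod G g)"

text \<open>
  The axioms \<open>act_partial_iso\<close>, \<open>act_gmult\<close> and \<open>act_gunit\<close> say that
  \<open>g \<mapsto> (gdom G g, gcod G g, act G g)\<close> is a unit-preserving groupoid homomorphism into the partial
  isomorphisms of \<open>\<Lambda>\<close>, and \<open>faithful\<close> says that it is injective. In \<open>self_similar\<close>, the conditions on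
  \<open>gdom G h\<close> and \<open>gcod G h\<close> express that \<open>h \<cdot> \<kappa>\<close> and \<open>(g \<cdot> e)(h \<cdot> \<kappa>)\<close> are defined.
\<close>

definition is_edge_restriction ::
    "('g, 'm) acting_groupoid \<Rightarrow> ('m, 'k::finite) kgraph \<Rightarrow> 'g \<Rightarrow> 'm \<Rightarrow> 'g \<Rightarrow> bool" where
  "is_edge_restriction G \<Lambda> g e h \<longleftrightarrow> h \<in> elems G \<and> gdom G h = src \<Lambda> e \<and> gcod G h = src \<Lambda> (act G g e) \<and>
     (\<forall>\<kappa> \<in> paths_from \<Lambda> (src \<Lambda> e). act G g (cat \<Lambda> e \<kappa>) = cat \<Lambda> (act G g e) (act G h \<kappa>))"

locale self_similar_action = k_graph \<Lambda> + groupoid_over "verts \<Lambda>" G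
  for G :: "('g, 'm) acting_groupoid" and \<Lambda> :: "('m, 'k::finite) kgraph" +
  assumes act_partial_iso: "g \<in> elems G \<Longrightarrow> partial_iso \<Lambda> (gdom G g) (gcod G g) (act G g)"
    and act_gmult: "\<lbrakk>g \<in> elems G; h \<in> elems G; gdom G g = gcod G h; \<kappa> \<in> paths_from \<Lambda> (gdom G h)\<rbrakk>
          \<Longrightarrow> act G (gmult G g h) \<kappa> = act G g (act G h \<kappa>)"
    and act_gunit: "\<lbrakk>v \<in> verts \<Lambda>; \<kappa> \<in> paths_from \<Lambda> v\<rbrakk> \<Longrightarrow> act G (gunit G v) \<kappa> = \<kappa>"
    and faithful: "\<lbrakk>g \<in> elems G; h \<in> elems G; gdom G g = gdom G h; gcod G g = gcod G h;
            \<And>\<kappa>. \<kappa> \<in> paths_from \<Lambda> (gdom G g) \<Longrightarrow> act G g \<kappa> = act G h \<kappa>\<rbrakk> \<Longrightarrow> g = h"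
    and self_similar: "\<lbrakk>g \<in> elems G; e \<in> edges \<Lambda>; rng \<Lambda> e = gdom G g\<rbrakk>
          \<Longrightarrow> \<exists>h. is_edge_restriction G \<Lambda> g e h"

definition edge_restriction :: "('g, 'm) acting_groupoid \<Rightarrow> ('m, 'k::finite) kgraph \<Rightarrow> 'g \<Rightarrow> 'm \<Rightarrow> 'g" where
  "edge_restriction G \<Lambda> g e = (THE h. is_edge_restriction G \<Lambda> g e h)"

text \<open>The restriction does not depend on the factorisation of the path into edges.\<close>

definition restriction :: "('g, 'm) acting_groupoid \<Rightarrow> ('m, 'k::finite) kgraph \<Rightarrow> 'g \<Rightarrow> 'm \<Rightarrow> 'g" where
  "restriction G \<Lambda> g \<kappa> =
     (THE h. \<exists>es. edge_factorisation \<Lambda> \<kappa> es \<and> h = foldl (edge_restriction G \<Lambda>) g es)"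

definition finite_state :: "('g, 'm) acting_groupoid \<Rightarrow> ('m, 'k::finite) kgraph \<Rightarrow> bool" where
  "finite_state G \<Lambda> \<longleftrightarrow>
     (\<forall>g \<in> elems G - gunit G ` verts \<Lambda>. finite (restriction G \<Lambda> g ` paths_from \<Lambda> (gdom G g)))"

definition inf_act :: "('g, 'm) acting_groupoid \<Rightarrow> ('m, 'k::finite) kgraph \<Rightarrow> 'g \<Rightarrow>
    ('m, 'k) inf_path \<Rightarrow> ('m, 'k) inf_path" where
  "inf_act G \<Lambda> g x = restrict (\<lambda>(p, q). act G (restriction G \<Lambda> g (x (0, p))) (x (p, q))) Omega"


subsection \<open>Periodicity\<close>

definition Per :: "('g, 'm) acting_groupoid \<Rightarrow> ('m, 'k::finite) kgraph \<Rightarrow> (int ^ 'k) set" where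
  "Per G \<Lambda> = {vec_int p - vec_int q | p q. \<exists>g \<in> elems G.
     \<forall>x \<in> inf_paths_from \<Lambda> (gdom G g). shift p x = shift q (inf_act G \<Lambda> g x)}"

definition theta_h :: "('g, 'm) acting_groupoid \<Rightarrow> ('m, 'k::finite) kgraph \<Rightarrow>
    nat ^ 'k \<Rightarrow> nat ^ 'k \<Rightarrow> 'm \<Rightarrow> 'm \<times> 'g" where
  "theta_h G \<Lambda> p q \<kappa> = (THE (\<mu>, h). \<mu> \<in> paths_of_degree \<Lambda> q \<and> h \<in> elems G \<and>
     gcod G h = src \<Lambda> \<kappa> \<and> gdom G h = src \<Lambda> \<mu> \<and>
     (\<forall>x \<in> inf_paths_from \<Lambda> (gdom G h). inf_cat \<Lambda> \<kappa> (inf_act G \<Lambda> h x) = inf_cat \<Lambda> \<mu> x))"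

definition theta :: "('g, 'm) acting_groupoid \<Rightarrow> ('m, 'k::finite) kgraph \<Rightarrow>
    nat ^ 'k \<Rightarrow> nat ^ 'k \<Rightarrow> 'm \<Rightarrow> 'm" where
  "theta G \<Lambda> p q \<kappa> = fst (theta_h G \<Lambda> p q \<kappa>)"

definition h_elem :: "('g, 'm) acting_groupoid \<Rightarrow> ('m, 'k::finite) kgraph \<Rightarrow>
    nat ^ 'k \<Rightarrow> nat ^ 'k \<Rightarrow> 'm \<Rightarrow> 'g" where
  "h_elem G \<Lambda> p q \<kappa> = snd (theta_h G \<Lambda> p q \<kappa>)"

text \<open>The argument \<open>x\<close> is the unimodular Perron--Frobenius eigenvector.\<close>

definition c_coeff :: "('g, 'm) acting_groupoid \<Rightarrow> ('m, 'k::finite) kgraph \<Rightarrow> ('m \<Rightarrow> real) \<Rightarrow>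
    nat ^ 'k \<Rightarrow> nat ^ 'k \<Rightarrow> 'm \<Rightarrow> 'g \<Rightarrow> real" where
  "c_coeff G \<Lambda> x p q \<kappa> g = (let h = h_elem G \<Lambda> p q \<kappa> in
     lim (\<lambda>l::nat. rho_pow \<Lambda> (\<chi> i. - int l) *
       (\<Sum>v \<in> verts \<Lambda>. real (card {\<mu> \<in> paths_of_degree \<Lambda> (\<chi> i. l).
           rng \<Lambda> \<mu> = gdom G g \<and> src \<Lambda> \<mu> = v \<and>
           act G g \<mu> = act G h \<mu> \<and> restriction G \<Lambda> g \<mu> = restriction G \<Lambda> h \<mu>}) * x v)))"


section \<open>C*-algebras\<close>

text \<open>
  Only unital C*-algebras are needed: the relation \<open>\<Sum>\<^sub>v t\<^sub>v = 1\<close> forces a unit. They have explicit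
  carriers because the universal property below quantifies over C*-algebras.
\<close>

record 'a cstar = "(complex, 'a) module" +
  adj :: "'a \<Rightarrow> 'a"
  nrm :: "'a \<Rightarrow> real"

locale cstar_algebra = ring A for A :: "'a cstar" (structure) +
  assumes smult_closed: "a \<in> carrier A \<Longrightarrow> z \<odot> a \<in> carrier A"
    and smult_add_left: "a \<in> carrier A \<Longrightarrow> (z + w) \<odot> a = z \<odot> a \<oplus> w \<odot> a"
    and smult_add_right: "\<lbrakk>a \<in> carrier A; b \<in> carrier A\<rbrakk> \<Longrightarrow> z \<odot> (a \<oplus> b) = z \<odot> a \<oplus> z \<odot> b"
    and smult_assoc: "a \<in> carrier A \<Longrightarrow> (z * w) \<odot> a = z \<odot> (w \<odot> a)"
    and smult_one: "a \<in> carrier A \<Longrightarrow> 1 \<odot> a = a"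
    and smult_mult_left: "\<lbrakk>a \<in> carrier A; b \<in> carrier A\<rbrakk> \<Longrightarrow> (z \<odot> a) \<otimes> b = z \<odot> (a \<otimes> b)"
    and smult_mult_right: "\<lbrakk>a \<in> carrier A; b \<in> carrier A\<rbrakk> \<Longrightarrow> a \<otimes> (z \<odot> b) = z \<odot> (a \<otimes> b)"
    and adj_closed: "a \<in> carrier A \<Longrightarrow> adj A a \<in> carrier A"
    and adj_adj: "a \<in> carrier A \<Longrightarrow> adj A (adj A a) = a"
    and adj_add: "\<lbrakk>a \<in> carrier A; b \<in> carrier A\<rbrakk> \<Longrightarrow> adj A (a \<oplus> b) = adj A a \<oplus> adj A b"
    and adj_smult: "a \<in> carrier A \<Longrightarrow> adj A (z \<odot> a) = cnj z \<odot> adj A a"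
    and adj_mult: "\<lbrakk>a \<in> carrier A; b \<in> carrier A\<rbrakk> \<Longrightarrow> adj A (a \<otimes> b) = adj A b \<otimes> adj A a"
    and nrm_nonneg: "a \<in> carrier A \<Longrightarrow> nrm A a \<ge> 0"
    and nrm_eq_0: "a \<in> carrier A \<Longrightarrow> nrm A a = 0 \<longleftrightarrow> a = \<zero>"
    and nrm_smult: "a \<in> carrier A \<Longrightarrow> nrm A (z \<odot> a) = cmod z * nrm A a"
    and nrm_triangle: "\<lbrakk>a \<in> carrier A; b \<in> carrier A\<rbrakk> \<Longrightarrow> nrm A (a \<oplus> b) \<le> nrm A a + nrm A b"
    and nrm_mult: "\<lbrakk>a \<in> carrier A; b \<in> carrier A\<rbrakk> \<Longrightarrow> nrm A (a \<otimes> b) \<le> nrm A a * nrm A b"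
    and nrm_cstar: "a \<in> carrier A \<Longrightarrow> nrm A (adj A a \<otimes> a) = (nrm A a)\<^sup>2"
    and complete: "\<lbrakk>\<And>n::nat. s n \<in> carrier A;
            \<And>\<epsilon>. \<epsilon> > 0 \<Longrightarrow> \<exists>N. \<forall>m\<ge>N. \<forall>n\<ge>N. nrm A (s m \<ominus> s n) < \<epsilon>\<rbrakk>
          \<Longrightarrow> \<exists>a \<in> carrier A. (\<lambda>n. nrm A (s n \<ominus> a)) \<longlonglongrightarrow> 0"

definition star_hom :: "'a cstar \<Rightarrow> 'b cstar \<Rightarrow> ('a \<Rightarrow> 'b) \<Rightarrow> bool" where
  "star_hom A B \<pi> \<longleftrightarrow> \<pi> \<in> ring_hom A B \<and>
     (\<forall>a \<in> carrier A. (\<forall>z. \<pi> (z \<odot>\<^bsub>A\<^esub> a) = z \<odot>\<^bsub>B\<^esub> \<pi> a) \<and> \<pi> (adj A a) = adj B (\<pi> a))"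

definition closed_star_subalgebra :: "'a cstar \<Rightarrow> 'a set \<Rightarrow> bool" where
  "closed_star_subalgebra A S \<longleftrightarrow> S \<subseteq> carrier A \<and> \<zero>\<^bsub>A\<^esub> \<in> S \<and>
     (\<forall>a \<in> S. \<forall>b \<in> S. a \<oplus>\<^bsub>A\<^esub> b \<in> S \<and> a \<otimes>\<^bsub>A\<^esub> b \<in> S) \<and>
     (\<forall>a \<in> S. adj A a \<in> S \<and> (\<forall>z. z \<odot>\<^bsub>A\<^esub> a \<in> S)) \<and>
     (\<forall>s. \<forall>a \<in> carrier A. (\<forall>n::nat. s n \<in> S) \<and> (\<lambda>n. nrm A (s n \<ominus>\<^bsub>A\<^esub> a)) \<longlonglongrightarrow> 0 \<longrightarrow> a \<in> S)"

definition generates :: "'a cstar \<Rightarrow> 'a set \<Rightarrow> bool" where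
  "generates A X \<longleftrightarrow> X \<subseteq> carrier A \<and>
     (\<forall>S. closed_star_subalgebra A S \<and> X \<subseteq> S \<longrightarrow> S = carrier A)"

definition partial_isometry :: "'a cstar \<Rightarrow> 'a \<Rightarrow> bool" where
  "partial_isometry A a \<longleftrightarrow> a \<in> carrier A \<and> a \<otimes>\<^bsub>A\<^esub> adj A a \<otimes>\<^bsub>A\<^esub> a = a"

definition mutually_orthogonal_projections :: "'a cstar \<Rightarrow> 'i set \<Rightarrow> ('i \<Rightarrow> 'a) \<Rightarrow> bool" where
  "mutually_orthogonal_projections A I P \<longleftrightarrow>
     (\<forall>i \<in> I. P i \<in> carrier A \<and> adj A (P i) = P i \<and> P i \<otimes>\<^bsub>A\<^esub> P i = P i) \<and>
     (\<forall>i \<in> I. \<forall>j \<in> I. i \<noteq> j \<longrightarrow> P i \<otimes>\<^bsub>A\<^esub> P j = \<zero>\<^bsub>A\<^esub>)"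


subsection \<open>Dynamics and KMS states\<close>

definition dynamics :: "'a cstar \<Rightarrow> (real \<Rightarrow> 'a \<Rightarrow> 'a) \<Rightarrow> bool" where
  "dynamics A \<sigma> \<longleftrightarrow>
     (\<forall>t. star_hom A A (\<sigma> t) \<and> bij_betw (\<sigma> t) (carrier A) (carrier A)) \<and>
     (\<forall>s t. \<forall>a \<in> carrier A. \<sigma> (s + t) a = \<sigma> s (\<sigma> t a)) \<and>
     (\<forall>a \<in> carrier A. \<forall>s. ((\<lambda>t. nrm A (\<sigma> t a \<ominus>\<^bsub>A\<^esub> \<sigma> s a)) \<longlongrightarrow> 0) (at s))"

text \<open>An entire function with values in \<open>A\<close>: complex differentiable in norm at every point.\<close>

definition entire :: "'a cstar \<Rightarrow> (complex \<Rightarrow> 'a) \<Rightarrow> bool" where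
  "entire A F \<longleftrightarrow> (\<forall>z. F z \<in> carrier A) \<and>
     (\<forall>z. \<exists>D \<in> carrier A.
        ((\<lambda>w. nrm A (inverse (w - z) \<odot>\<^bsub>A\<^esub> (F w \<ominus>\<^bsub>A\<^esub> F z) \<ominus>\<^bsub>A\<^esub> D)) \<longlongrightarrow> 0) (at z))"

definition analytic_extension :: "'a cstar \<Rightarrow> (real \<Rightarrow> 'a \<Rightarrow> 'a) \<Rightarrow> 'a \<Rightarrow> (complex \<Rightarrow> 'a) \<Rightarrow> bool" where
  "analytic_extension A \<sigma> a F \<longleftrightarrow> entire A F \<and> (\<forall>t. F (complex_of_real t) = \<sigma> t a)"

definition analytic_element :: "'a cstar \<Rightarrow> (real \<Rightarrow> 'a \<Rightarrow> 'a) \<Rightarrow> 'a \<Rightarrow> bool" where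
  "analytic_element A \<sigma> a \<longleftrightarrow> a \<in> carrier A \<and> (\<exists>F. analytic_extension A \<sigma> a F)"

definition state :: "'a cstar \<Rightarrow> ('a \<Rightarrow> complex) \<Rightarrow> bool" where
  "state A \<phi> \<longleftrightarrow>
     (\<forall>a \<in> carrier A. \<forall>b \<in> carrier A. \<phi> (a \<oplus>\<^bsub>A\<^esub> b) = \<phi> a + \<phi> b) \<and>
     (\<forall>a \<in> carrier A. \<forall>z. \<phi> (z \<odot>\<^bsub>A\<^esub> a) = z * \<phi> a) \<and>
     (\<forall>a \<in> carrier A. Im (\<phi> (adj A a \<otimes>\<^bsub>A\<^esub> a)) = 0 \<and> Re (\<phi> (adj A a \<otimes>\<^bsub>A\<^esub> a)) \<ge> 0) \<and>
     \<phi> \<one>\<^bsub>A\<^esub> = 1"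

text \<open>\<open>\<sigma>\<^bsub>i\<beta>\<^esub>(a)\<close> is the value at \<open>i\<beta>\<close> of the (unique) analytic extension of \<open>t \<mapsto> \<sigma>\<^sub>t(a)\<close>.\<close>

definition KMS_state :: "'a cstar \<Rightarrow> (real \<Rightarrow> 'a \<Rightarrow> 'a) \<Rightarrow> real \<Rightarrow> ('a \<Rightarrow> complex) \<Rightarrow> bool" where
  "KMS_state A \<sigma> \<beta> \<phi> \<longleftrightarrow> state A \<phi> \<and>
     (\<forall>a b F. analytic_element A \<sigma> a \<and> analytic_element A \<sigma> b \<and> analytic_extension A \<sigma> a F
        \<longrightarrow> \<phi> (a \<otimes>\<^bsub>A\<^esub> b) = \<phi> (b \<otimes>\<^bsub>A\<^esub> F (\<i> * of_real \<beta>)))"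


section \<open>The Cuntz--Pimsner algebra\<close>

definition unitary_representation ::
    "('g, 'm) acting_groupoid \<Rightarrow> ('m, 'k::finite) kgraph \<Rightarrow> 'a cstar \<Rightarrow> ('g \<Rightarrow> 'a) \<Rightarrow> bool" where
  "unitary_representation G \<Lambda> A u \<longleftrightarrow>
     (\<forall>g \<in> elems G. partial_isometry A (u g) \<and> adj A (u g) = u (ginv G g)) \<and>
     mutually_orthogonal_projections A (verts \<Lambda>) (\<lambda>v. u (gunit G v)) \<and>
     (\<forall>g \<in> elems G. \<forall>h \<in> elems G.
        u g \<otimes>\<^bsub>A\<^esub> u h = (if gdom G g = gcod G h then u (gmult G g h) else \<zero>\<^bsub>A\<^esub>))"

definition TCK_family :: "('m, 'k::finite) kgraph \<Rightarrow> 'a cstar \<Rightarrow> ('m \<Rightarrow> 'a) \<Rightarrow> bool" where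
  "TCK_family \<Lambda> A t \<longleftrightarrow>
     (\<forall>\<kappa> \<in> paths \<Lambda>. partial_isometry A (t \<kappa>)) \<and>
     mutually_orthogonal_projections A (verts \<Lambda>) t \<and>
     (\<forall>\<kappa> \<in> paths \<Lambda>. \<forall>\<mu> \<in> paths \<Lambda>. src \<Lambda> \<kappa> = rng \<Lambda> \<mu> \<longrightarrow> t \<kappa> \<otimes>\<^bsub>A\<^esub> t \<mu> = t (cat \<Lambda> \<kappa> \<mu>)) \<and>
     (\<forall>\<kappa> \<in> paths \<Lambda>. \<forall>\<mu> \<in> paths \<Lambda>. adj A (t \<kappa>) \<otimes>\<^bsub>A\<^esub> t \<mu> =
        (\<Oplus>\<^bsub>A\<^esub>\<eta>\<zeta> \<in> min_extensions \<Lambda> \<kappa> \<mu>. t (fst \<eta>\<zeta>) \<otimes>\<^bsub>A\<^esub> adj A (t (snd \<eta>\<zeta>))))"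

definition CK_family :: "('m, 'k::finite) kgraph \<Rightarrow> 'a cstar \<Rightarrow> ('m \<Rightarrow> 'a) \<Rightarrow> bool" where
  "CK_family \<Lambda> A t \<longleftrightarrow> TCK_family \<Lambda> A t \<and>
     (\<forall>v \<in> verts \<Lambda>. \<forall>p. t v =
        (\<Oplus>\<^bsub>A\<^esub>\<kappa> \<in> paths_from \<Lambda> v \<inter> paths_of_degree \<Lambda> p. t \<kappa> \<otimes>\<^bsub>A\<^esub> adj A (t \<kappa>)))"

definition CP_relations :: "('g, 'm) acting_groupoid \<Rightarrow> ('m, 'k::finite) kgraph \<Rightarrow> 'a cstar \<Rightarrow>
    ('g \<Rightarrow> 'a) \<Rightarrow> ('m \<Rightarrow> 'a) \<Rightarrow> bool" where
  "CP_relations G \<Lambda> A u t \<longleftrightarrow> unitary_representation G \<Lambda> A u \<and> CK_family \<Lambda> A t \<and>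
     (\<forall>v \<in> verts \<Lambda>. u (gunit G v) = t v) \<and>
     (\<Oplus>\<^bsub>A\<^esub>v \<in> verts \<Lambda>. t v) = \<one>\<^bsub>A\<^esub> \<and>
     (\<forall>g \<in> elems G. \<forall>\<kappa> \<in> paths \<Lambda>. u g \<otimes>\<^bsub>A\<^esub> t \<kappa> =
        (if gdom G g = rng \<Lambda> \<kappa> then t (act G g \<kappa>) \<otimes>\<^bsub>A\<^esub> u (restriction G \<Lambda> g \<kappa>) else \<zero>\<^bsub>A\<^esub>))"

text \<open>
  The universal property quantifies over C*-algebras carried by subsets of
  \<open>nat \<Rightarrow> 'g + 'm + nat\<close>, which loses nothing. A C*-algebra generated by families indexed by \<open>'g\<close> and
  \<open>'m\<close> consists of the limits of sequences of *-polynomials in the generators with coefficients in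
  \<open>\<rat> + i\<rat>\<close>. Hence it has at most as many elements as this type, and is isomorphic to a C*-algebra of
  the kind considered. A solution of the relations in an arbitrary C*-algebra lies in the C*-subalgebra
  it generates.
\<close>

definition Cuntz_Pimsner_algebra :: "('g, 'm) acting_groupoid \<Rightarrow> ('m, 'k::finite) kgraph \<Rightarrow> 'a cstar \<Rightarrow>
    ('g \<Rightarrow> 'a) \<Rightarrow> ('m \<Rightarrow> 'a) \<Rightarrow> bool" where
  "Cuntz_Pimsner_algebra G \<Lambda> A u t \<longleftrightarrow> cstar_algebra A \<and> CP_relations G \<Lambda> A u t \<and>
     generates A (u ` elems G \<union> t ` paths \<Lambda>) \<and>
     (\<forall>(B :: (nat \<Rightarrow> 'g + 'm + nat) cstar) U T. cstar_algebra B \<and> CP_relations G \<Lambda> B U T \<longrightarrow>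
        (\<exists>\<pi>. star_hom A B \<pi> \<and> (\<forall>g \<in> elems G. \<pi> (u g) = U g) \<and> (\<forall>\<kappa> \<in> paths \<Lambda>. \<pi> (t \<kappa>) = T \<kappa>)))"

definition preferred_dynamics :: "('g, 'm) acting_groupoid \<Rightarrow> ('m, 'k::finite) kgraph \<Rightarrow> 'a cstar \<Rightarrow>
    ('g \<Rightarrow> 'a) \<Rightarrow> ('m \<Rightarrow> 'a) \<Rightarrow> (real \<Rightarrow> 'a \<Rightarrow> 'a) \<Rightarrow> bool" where
  "preferred_dynamics G \<Lambda> A u t \<sigma> \<longleftrightarrow> dynamics A \<sigma> \<and>
     (\<forall>s. \<forall>\<kappa> \<in> paths \<Lambda>. \<forall>g \<in> elems G. \<forall>\<mu> \<in> paths \<Lambda>.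
        \<sigma> s (t \<kappa> \<otimes>\<^bsub>A\<^esub> u g \<otimes>\<^bsub>A\<^esub> adj A (t \<mu>)) =
        rho_imag_pow \<Lambda> s (vec_int (deg \<Lambda> \<kappa>) - vec_int (deg \<Lambda> \<mu>)) \<odot>\<^bsub>A\<^esub>
          (t \<kappa> \<otimes>\<^bsub>A\<^esub> u g \<otimes>\<^bsub>A\<^esub> adj A (t \<mu>)))"

text \<open>
  For \<open>n\<close> in \<open>Per G \<Lambda>\<close>, the sum below is the same for all \<open>p\<close>, \<open>q\<close> with \<open>p - q = n\<close>.
\<close>

definition V_elem :: "('g, 'm) acting_groupoid \<Rightarrow> ('m, 'k::finite) kgraph \<Rightarrow> 'a cstar \<Rightarrow>
    ('g \<Rightarrow> 'a) \<Rightarrow> ('m \<Rightarrow> 'a) \<Rightarrow> int ^ 'k \<Rightarrow> 'a" where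
  "V_elem G \<Lambda> A u t n = (THE a. \<forall>p q. vec_int p - vec_int q = n \<longrightarrow>
     a = (\<Oplus>\<^bsub>A\<^esub>\<kappa> \<in> paths_of_degree \<Lambda> p.
            t \<kappa> \<otimes>\<^bsub>A\<^esub> u (h_elem G \<Lambda> p q \<kappa>) \<otimes>\<^bsub>A\<^esub> adj A (t (theta G \<Lambda> p q \<kappa>))))"

end

theory Submission
  imports Defs
begin

text \<open>
  Write \<open>F(\<kappa>, g, \<mu>) = \<phi>(t\<^sub>\<kappa> u\<^sub>g t\<^sub>\<mu>\<^sup>*)\<close>. The Cuntz--Krieger relation expands \<open>F(\<kappa>, g, \<mu>)\<close> as a sum of
  \<open>F(\<kappa>(g\<cdot>\<nu>), g|\<nu>, \<mu>\<nu>)\<close> over the paths \<open>\<nu>\<close> of a given degree; the KMS condition makes a common initial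
  segment \<open>\<tau>\<close> of \<open>\<kappa>\<close> and \<open>\<mu>\<close> contribute the factor \<open>\<rho>(\<Lambda>)\<close> to the power \<open>-d(\<tau>)\<close>, and it makes \<open>F(\<kappa>, g, \<mu>)\<close>
  vanish if \<open>\<kappa>\<close> and \<open>\<mu>\<close> have no common extension. These three properties determine \<open>F\<close> up to \<open>\<phi>(V)\<close>.

  If \<open>\<kappa>(h\<cdot>x) = \<mu>x\<close> for all infinite paths \<open>x\<close>, then expanding along \<open>\<nu> = \<theta>(\<eta>)\<close> and using
  \<open>\<kappa>(h\<cdot>\<theta>(\<eta>)) = \<mu>\<eta>\<close>, \<open>h|\<theta>(\<eta>) = h(\<eta>)\<close> gives that \<open>F(\<kappa>, h, \<mu>)\<close> is \<open>y(s(\<mu>))\<close> times \<open>\<rho>(\<Lambda>)\<close> to the power \<open>-d(\<mu>)\<close>, where \<open>y(v)\<close> is the sum of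
  \<open>F(\<eta>, h(\<eta>), \<theta>(\<eta>))\<close> over \<open>\<eta> \<in> v\<Lambda>\<^sup>p\<close>. The vector \<open>y\<close> does not depend on \<open>p\<close>, so it is a joint eigenvector of the
  vertex matrices, hence \<open>y = \<phi>(V) x\<close>.

  In the other cases the expansion has, besides terms of the first kind and zero terms, only terms for
  those \<open>\<nu>\<close> that have not yet told \<open>\<kappa>(g\<cdot>\<nu>)\<close> from \<open>\<mu>\<nu>\<close>, or \<open>g\<close> from \<open>h\<close>. By finiteness of the state space
  the total weight of these \<open>\<nu>\<close> tends to \<open>0\<close> as the degree grows.
\<close>

section \<open>Higher-rank graphs\<close>

subsection \<open>Multidegrees\<close>

text \<open>The equation to be detected concerns infinite paths, while the expansion produces finite
  ones. It is replaced by agreement of initial segments of common degree: a common extension implies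
  agreement, so terms without agreement vanish, and agreement along every \<nu> is equivalent to the
  equation for infinite paths. Finiteness of the action bounds the elements \<open>g|\<nu>\<close>,
  but the pairs \<open>(\<kappa>(g\<cdot>\<nu>), \<mu>\<nu>)\<close> may be infinitely many. Once
  both paths agree, their common initial segment is cancelled up to the meet of their degrees, which
  grows with \<nu>; the leftovers have bounded degree. This yields a finite state space and bounds
  |F| by a constant times \<open>\<rho>(\<Lambda>)\<close> to the power \<open>-d(\<nu>)\<close>,
  without positivity or boundedness of F. The powers of \<open>\<rho>(\<Lambda>)\<close> in the KMS
  relation come from continuing the dynamics from real t to t = i.\<close>

definition vec_meet :: "nat ^ 'k \<Rightarrow> nat ^ 'k \<Rightarrow> nat ^ 'k" where
  "vec_meet p q = (\<chi> i. min (p $ i) (q $ i))"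

lemma vec_meet_le [simp]: "vec_meet p q \<le> p" "vec_meet p q \<le> q"
  by (auto simp: vec_meet_def less_eq_vec_def)

lemma vec_meet_greatest: "m \<le> p \<Longrightarrow> m \<le> q \<Longrightarrow> m \<le> vec_meet p q"
  by (auto simp: vec_meet_def less_eq_vec_def)

lemma vec_meet_add: "vec_meet (m + p) (m + q) = m + vec_meet p q"
  by (simp add: vec_meet_def vec_eq_iff min_add_distrib_right)

lemma vec_nat_le_add [simp]: "(p :: nat ^ 'k) \<le> p + q" "(p :: nat ^ 'k) \<le> q + p"
  by (auto simp: less_eq_vec_def)

lemma vec_nat_add_le_cancel [simp]: "(p :: nat ^ 'k) + q \<le> p + r \<longleftrightarrow> q \<le> r"
  by (auto simp: less_eq_vec_def)

lemma vec_nat_zero_le [simp]: "0 \<le> (p :: nat ^ 'k)"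
  by (auto simp: less_eq_vec_def)

lemma vec_nat_add_diff: "(p :: nat ^ 'k) \<le> q \<Longrightarrow> p + (q - p) = q"
  by (simp add: less_eq_vec_def vec_eq_iff)

lemma vec_nat_le_trans_add: "(p :: nat ^ 'k) \<le> q \<Longrightarrow> p \<le> q + r" "(p :: nat ^ 'k) \<le> q \<Longrightarrow> p \<le> r + q"
  by (auto simp: less_eq_vec_def intro: trans_le_add1 trans_le_add2)

lemma vec_int_add: "vec_int (p + q) = vec_int p + vec_int q"
  by (simp add: vec_int_def vec_eq_iff)

lemma vec_int_inject: "vec_int p = vec_int q \<longleftrightarrow> p = q"
  by (simp add: vec_int_def vec_eq_iff)

lemma vec_int_diff_eq_iff: "vec_int p - vec_int q = vec_int p' - vec_int q' \<longleftrightarrow> p + q' = p' + q"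
proof -
  have "vec_int p - vec_int q = vec_int p' - vec_int q' \<longleftrightarrow> vec_int (p + q') = vec_int (p' + q)"
    unfolding vec_int_add by (auto simp: algebra_simps)
  then show ?thesis by (simp add: vec_int_inject)
qed

text \<open>Induction on the coordinate sum. A step adds one generator, which corresponds to one
  more edge at the front of a path.\<close>

lemma vec_nat_induct [case_names zero add]:
  fixes p :: "nat ^ 'k::finite"
  assumes "P 0" and step: "\<And>p i. P p \<Longrightarrow> P (axis i 1 + p)"
  shows "P p"
proof (induction "\<Sum>i\<in>UNIV. p $ i" arbitrary: p)
  case 0
  then have "p = 0" by (simp add: vec_eq_iff)
  then show ?case using \<open>P 0\<close> by simp
next
  case (Suc n)
  have "\<exists>i. p $ i \<noteq> 0"
  proof (rule ccontr)
    assume "\<nexists>i. p $ i \<noteq> 0"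
    then have "(\<Sum>i\<in>UNIV. p $ i) = 0" by simp
    then show False using Suc(2) by linarith
  qed
  then obtain i where i: "p $ i \<noteq> 0" by blast
  define q where "q = (\<chi> j. if j = i then p $ i - 1 else p $ j)"
  have p: "p = axis i 1 + q" using i by (auto simp: q_def vec_eq_iff axis_def)
  have "(\<Sum>j\<in>UNIV. p $ j) = (\<Sum>j\<in>UNIV. axis i 1 $ j) + (\<Sum>j\<in>UNIV. q $ j)"
    unfolding p by (simp add: sum.distrib)
  also have "(\<Sum>j\<in>UNIV. (axis i 1 :: nat ^ 'k) $ j) = 1"
    by (simp add: axis_def)
  finally have "n = (\<Sum>j\<in>UNIV. q $ j)" using Suc(2) by simp
  from Suc(1)[OF this] show ?case unfolding p by (rule step)
qed


subsection \<open>Initial and final segments\<close>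

definition from_deg :: "('m, 'k::finite) kgraph \<Rightarrow> 'm \<Rightarrow> nat ^ 'k \<Rightarrow> 'm set" where
  "from_deg \<Lambda> v p = paths_from \<Lambda> v \<inter> paths_of_degree \<Lambda> p"

lemma from_deg_iff: "\<kappa> \<in> from_deg \<Lambda> v p \<longleftrightarrow> \<kappa> \<in> paths \<Lambda> \<and> rng \<Lambda> \<kappa> = v \<and> deg \<Lambda> \<kappa> = p"
  by (auto simp: from_deg_def paths_from_def paths_of_degree_def)

lemma paths_from_iff: "\<kappa> \<in> paths_from \<Lambda> v \<longleftrightarrow> \<kappa> \<in> paths \<Lambda> \<and> rng \<Lambda> \<kappa> = v"
  by (auto simp: paths_from_def)

lemma paths_of_degree_iff: "\<kappa> \<in> paths_of_degree \<Lambda> p \<longleftrightarrow> \<kappa> \<in> paths \<Lambda> \<and> deg \<Lambda> \<kappa> = p"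
  by (auto simp: paths_of_degree_def)

definition pre :: "('m, 'k::finite) kgraph \<Rightarrow> nat ^ 'k \<Rightarrow> 'm \<Rightarrow> 'm" where
  "pre \<Lambda> m \<kappa> = (THE \<alpha>. \<exists>\<beta>. \<alpha> \<in> paths \<Lambda> \<and> \<beta> \<in> paths \<Lambda> \<and> src \<Lambda> \<alpha> = rng \<Lambda> \<beta> \<and>
     \<kappa> = cat \<Lambda> \<alpha> \<beta> \<and> deg \<Lambda> \<alpha> = m)"

definition suf :: "('m, 'k::finite) kgraph \<Rightarrow> nat ^ 'k \<Rightarrow> 'm \<Rightarrow> 'm" where
  "suf \<Lambda> m \<kappa> = (THE \<beta>. \<exists>\<alpha>. \<alpha> \<in> paths \<Lambda> \<and> \<beta> \<in> paths \<Lambda> \<and> src \<Lambda> \<alpha> = rng \<Lambda> \<beta> \<and>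
     \<kappa> = cat \<Lambda> \<alpha> \<beta> \<and> deg \<Lambda> \<alpha> = m)"

text \<open>Finite substitute for being initial segments of one infinite path. It is weaker than
  having a common extension: two edges of different degrees with the same range always agree,
  because only degree 0 is tested.\<close>

definition agree :: "('m, 'k::finite) kgraph \<Rightarrow> 'm \<Rightarrow> 'm \<Rightarrow> bool" where
  "agree \<Lambda> \<kappa> \<mu> \<longleftrightarrow> (\<forall>m. m \<le> deg \<Lambda> \<kappa> \<and> m \<le> deg \<Lambda> \<mu> \<longrightarrow> pre \<Lambda> m \<kappa> = pre \<Lambda> m \<mu>)"

lemma agree_sym: "agree \<Lambda> \<kappa> \<mu> \<Longrightarrow> agree \<Lambda> \<mu> \<kappa>"
  by (auto simp: agree_def)

lemma agree_refl: "agree \<Lambda> \<kappa> \<kappa>"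
  by (auto simp: agree_def)

lemma agreeD: "agree \<Lambda> \<kappa> \<mu> \<Longrightarrow> m \<le> deg \<Lambda> \<kappa> \<Longrightarrow> m \<le> deg \<Lambda> \<mu> \<Longrightarrow> pre \<Lambda> m \<kappa> = pre \<Lambda> m \<mu>"
  by (auto simp: agree_def)

context k_graph
begin

abbreviation comp_path (infixr "\<cdot>" 70) where "\<kappa> \<cdot> \<mu> \<equiv> cat \<Lambda> \<kappa> \<mu>"

lemma cat_cancel:
  assumes "\<kappa> \<in> paths \<Lambda>" "\<mu> \<in> paths \<Lambda>" "src \<Lambda> \<kappa> = rng \<Lambda> \<mu>"
    and "\<kappa>' \<in> paths \<Lambda>" "\<mu>' \<in> paths \<Lambda>" "src \<Lambda> \<kappa>' = rng \<Lambda> \<mu>'"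
    and "\<kappa> \<cdot> \<mu> = \<kappa>' \<cdot> \<mu>'" "deg \<Lambda> \<kappa> = deg \<Lambda> \<kappa>'"
  shows "\<kappa> = \<kappa>'" "\<mu> = \<mu>'"
proof -
  have d: "deg \<Lambda> (\<kappa> \<cdot> \<mu>) = deg \<Lambda> \<kappa> + deg \<Lambda> \<mu>" "deg \<Lambda> (\<kappa> \<cdot> \<mu>) = deg \<Lambda> \<kappa> + deg \<Lambda> \<mu>'"
    using deg_cat[of \<kappa> \<mu>] deg_cat[of \<kappa>' \<mu>'] assms by auto
  then have "deg \<Lambda> \<mu> = deg \<Lambda> \<mu>'" by simp
  then have "fst (\<kappa>, \<mu>) \<in> paths_of_degree \<Lambda> (deg \<Lambda> \<kappa>) \<and> snd (\<kappa>, \<mu>) \<in> paths_of_degree \<Lambda> (deg \<Lambda> \<mu>) \<and>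
                   src \<Lambda> (fst (\<kappa>, \<mu>)) = rng \<Lambda> (snd (\<kappa>, \<mu>)) \<and> \<kappa> \<cdot> \<mu> = cat \<Lambda> (fst (\<kappa>, \<mu>)) (snd (\<kappa>, \<mu>))"
    "fst (\<kappa>', \<mu>') \<in> paths_of_degree \<Lambda> (deg \<Lambda> \<kappa>) \<and> snd (\<kappa>', \<mu>') \<in> paths_of_degree \<Lambda> (deg \<Lambda> \<mu>) \<and>
                   src \<Lambda> (fst (\<kappa>', \<mu>')) = rng \<Lambda> (snd (\<kappa>', \<mu>')) \<and> \<kappa> \<cdot> \<mu> = cat \<Lambda> (fst (\<kappa>', \<mu>')) (snd (\<kappa>', \<mu>'))"
    using assms by (auto simp: paths_of_degree_def)
  with unique_factorisation[OF cat_closed[OF assms(1-3)] d(1)] have "(\<kappa>, \<mu>) = (\<kappa>', \<mu>')" by blast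
  then show "\<kappa> = \<kappa>'" "\<mu> = \<mu>'" by auto
qed

lemma factorE:
  assumes "\<kappa> \<in> paths \<Lambda>" "m \<le> deg \<Lambda> \<kappa>"
  obtains \<alpha> \<beta> where "\<alpha> \<in> paths \<Lambda>" "\<beta> \<in> paths \<Lambda>" "src \<Lambda> \<alpha> = rng \<Lambda> \<beta>" "\<kappa> = \<alpha> \<cdot> \<beta>"
    "deg \<Lambda> \<alpha> = m" "deg \<Lambda> \<beta> = deg \<Lambda> \<kappa> - m"
proof -
  have "deg \<Lambda> \<kappa> = m + (deg \<Lambda> \<kappa> - m)" using vec_nat_add_diff assms(2) by metis
  from unique_factorisation[OF assms(1) this] that show thesis
    by (auto simp: paths_of_degree_def)
qed

lemma pre_cat_deg:
  assumes "\<alpha> \<in> paths \<Lambda>" "\<beta> \<in> paths \<Lambda>" "src \<Lambda> \<alpha> = rng \<Lambda> \<beta>" "deg \<Lambda> \<alpha> = m"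
  shows "pre \<Lambda> m (\<alpha> \<cdot> \<beta>) = \<alpha>"
  unfolding pre_def by (rule the_equality) (use assms cat_cancel in blast)+

lemma suf_cat_deg:
  assumes "\<alpha> \<in> paths \<Lambda>" "\<beta> \<in> paths \<Lambda>" "src \<Lambda> \<alpha> = rng \<Lambda> \<beta>" "deg \<Lambda> \<alpha> = m"
  shows "suf \<Lambda> m (\<alpha> \<cdot> \<beta>) = \<beta>"
  unfolding suf_def by (rule the_equality) (use assms cat_cancel in blast)+

lemma pre_suf:
  assumes "\<kappa> \<in> paths \<Lambda>" "m \<le> deg \<Lambda> \<kappa>"
  shows "pre \<Lambda> m \<kappa> \<in> paths \<Lambda>" "suf \<Lambda> m \<kappa> \<in> paths \<Lambda>" "src \<Lambda> (pre \<Lambda> m \<kappa>) = rng \<Lambda> (suf \<Lambda> m \<kappa>)"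
    "pre \<Lambda> m \<kappa> \<cdot> suf \<Lambda> m \<kappa> = \<kappa>" "deg \<Lambda> (pre \<Lambda> m \<kappa>) = m" "deg \<Lambda> (suf \<Lambda> m \<kappa>) = deg \<Lambda> \<kappa> - m"
    "rng \<Lambda> (pre \<Lambda> m \<kappa>) = rng \<Lambda> \<kappa>" "src \<Lambda> (suf \<Lambda> m \<kappa>) = src \<Lambda> \<kappa>"
proof -
  obtain \<alpha> \<beta> where *: "\<alpha> \<in> paths \<Lambda>" "\<beta> \<in> paths \<Lambda>" "src \<Lambda> \<alpha> = rng \<Lambda> \<beta>" "\<kappa> = \<alpha> \<cdot> \<beta>"
    "deg \<Lambda> \<alpha> = m" "deg \<Lambda> \<beta> = deg \<Lambda> \<kappa> - m" using factorE[OF assms] by blast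
  have **: "pre \<Lambda> m \<kappa> = \<alpha>" "suf \<Lambda> m \<kappa> = \<beta>" using * pre_cat_deg suf_cat_deg by auto
  show "pre \<Lambda> m \<kappa> \<in> paths \<Lambda>" "suf \<Lambda> m \<kappa> \<in> paths \<Lambda>" "src \<Lambda> (pre \<Lambda> m \<kappa>) = rng \<Lambda> (suf \<Lambda> m \<kappa>)"
    "pre \<Lambda> m \<kappa> \<cdot> suf \<Lambda> m \<kappa> = \<kappa>" "deg \<Lambda> (pre \<Lambda> m \<kappa>) = m" "deg \<Lambda> (suf \<Lambda> m \<kappa>) = deg \<Lambda> \<kappa> - m"
    "rng \<Lambda> (pre \<Lambda> m \<kappa>) = rng \<Lambda> \<kappa>" "src \<Lambda> (suf \<Lambda> m \<kappa>) = src \<Lambda> \<kappa>"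
    unfolding ** using * rng_cat src_cat by auto
qed

lemma pre_suf_cat_le:
  assumes "\<alpha> \<in> paths \<Lambda>" "\<beta> \<in> paths \<Lambda>" "src \<Lambda> \<alpha> = rng \<Lambda> \<beta>" "m \<le> deg \<Lambda> \<alpha>"
  shows "pre \<Lambda> m (\<alpha> \<cdot> \<beta>) = pre \<Lambda> m \<alpha>" "suf \<Lambda> m (\<alpha> \<cdot> \<beta>) = suf \<Lambda> m \<alpha> \<cdot> \<beta>"
proof -
  note ps = pre_suf[OF assms(1,4)]
  have eq: "\<alpha> \<cdot> \<beta> = pre \<Lambda> m \<alpha> \<cdot> (suf \<Lambda> m \<alpha> \<cdot> \<beta>)"
    using cat_assoc[of "pre \<Lambda> m \<alpha>" "suf \<Lambda> m \<alpha>" \<beta>] ps assms by simp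
  have c: "suf \<Lambda> m \<alpha> \<cdot> \<beta> \<in> paths \<Lambda>" "src \<Lambda> (pre \<Lambda> m \<alpha>) = rng \<Lambda> (suf \<Lambda> m \<alpha> \<cdot> \<beta>)"
    using cat_closed rng_cat ps assms by auto
  show "pre \<Lambda> m (\<alpha> \<cdot> \<beta>) = pre \<Lambda> m \<alpha>" "suf \<Lambda> m (\<alpha> \<cdot> \<beta>) = suf \<Lambda> m \<alpha> \<cdot> \<beta>"
    unfolding eq using pre_cat_deg suf_cat_deg c ps by auto
qed

lemma pre_suf_cat_ge:
  assumes "\<alpha> \<in> paths \<Lambda>" "\<beta> \<in> paths \<Lambda>" "src \<Lambda> \<alpha> = rng \<Lambda> \<beta>" "m \<le> deg \<Lambda> \<beta>"
  shows "pre \<Lambda> (deg \<Lambda> \<alpha> + m) (\<alpha> \<cdot> \<beta>) = \<alpha> \<cdot> pre \<Lambda> m \<beta>"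
    and "suf \<Lambda> (deg \<Lambda> \<alpha> + m) (\<alpha> \<cdot> \<beta>) = suf \<Lambda> m \<beta>"
proof -
  note ps = pre_suf[OF assms(2,4)]
  have eq: "\<alpha> \<cdot> \<beta> = (\<alpha> \<cdot> pre \<Lambda> m \<beta>) \<cdot> suf \<Lambda> m \<beta>"
    using cat_assoc[of \<alpha> "pre \<Lambda> m \<beta>" "suf \<Lambda> m \<beta>"] ps assms by simp
  have c: "\<alpha> \<cdot> pre \<Lambda> m \<beta> \<in> paths \<Lambda>" "src \<Lambda> (\<alpha> \<cdot> pre \<Lambda> m \<beta>) = rng \<Lambda> (suf \<Lambda> m \<beta>)"
     "deg \<Lambda> (\<alpha> \<cdot> pre \<Lambda> m \<beta>) = deg \<Lambda> \<alpha> + m"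
    using cat_closed src_cat deg_cat ps assms by auto
  show "pre \<Lambda> (deg \<Lambda> \<alpha> + m) (\<alpha> \<cdot> \<beta>) = \<alpha> \<cdot> pre \<Lambda> m \<beta>"
    "suf \<Lambda> (deg \<Lambda> \<alpha> + m) (\<alpha> \<cdot> \<beta>) = suf \<Lambda> m \<beta>"
    unfolding eq using pre_cat_deg suf_cat_deg c ps by auto
qed

lemma pre_pre:
  assumes "\<kappa> \<in> paths \<Lambda>" "m \<le> n" "n \<le> deg \<Lambda> \<kappa>"
  shows "pre \<Lambda> m (pre \<Lambda> n \<kappa>) = pre \<Lambda> m \<kappa>"
  using pre_suf_cat_le(1)[of "pre \<Lambda> n \<kappa>" "suf \<Lambda> n \<kappa>" m] pre_suf[OF assms(1,3)] assms by simp

lemma deg_verts: "v \<in> verts \<Lambda> \<Longrightarrow> deg \<Lambda> v = 0" "v \<in> verts \<Lambda> \<Longrightarrow> v \<in> paths \<Lambda>"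
  by (auto simp: verts_def paths_of_degree_def)

lemma rng_src_verts: "v \<in> verts \<Lambda> \<Longrightarrow> rng \<Lambda> v = v" "v \<in> verts \<Lambda> \<Longrightarrow> src \<Lambda> v = v"
  using verts_eq_identities src_rng by auto (metis src_rng)

lemma rng_in_verts: "\<kappa> \<in> paths \<Lambda> \<Longrightarrow> rng \<Lambda> \<kappa> \<in> verts \<Lambda>"
  and src_in_verts: "\<kappa> \<in> paths \<Lambda> \<Longrightarrow> src \<Lambda> \<kappa> \<in> verts \<Lambda>"
  using verts_eq_identities rng_closed src_closed rng_rng rng_src by auto

lemma pre_0: "\<kappa> \<in> paths \<Lambda> \<Longrightarrow> pre \<Lambda> 0 \<kappa> = rng \<Lambda> \<kappa>"
  using pre_cat_deg[of "rng \<Lambda> \<kappa>" \<kappa> 0] rng_in_verts deg_verts rng_src_verts cat_rng by simp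

lemma suf_0: "\<kappa> \<in> paths \<Lambda> \<Longrightarrow> suf \<Lambda> 0 \<kappa> = \<kappa>"
  using suf_cat_deg[of "rng \<Lambda> \<kappa>" \<kappa> 0] rng_in_verts deg_verts rng_src_verts cat_rng by simp

lemma pre_deg: "\<kappa> \<in> paths \<Lambda> \<Longrightarrow> pre \<Lambda> (deg \<Lambda> \<kappa>) \<kappa> = \<kappa>"
  using pre_cat_deg[of \<kappa> "src \<Lambda> \<kappa>" "deg \<Lambda> \<kappa>"] src_in_verts deg_verts rng_src_verts cat_src by simp

text \<open>Every degree that \<open>agree\<close> tests lies below the meet, and a longer initial
  segment determines the shorter ones.\<close>

lemma agree_meet:
  assumes "\<kappa> \<in> paths \<Lambda>" "\<mu> \<in> paths \<Lambda>"
    and "pre \<Lambda> (vec_meet (deg \<Lambda> \<kappa>) (deg \<Lambda> \<mu>)) \<kappa> = pre \<Lambda> (vec_meet (deg \<Lambda> \<kappa>) (deg \<Lambda> \<mu>)) \<mu>"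
  shows "agree \<Lambda> \<kappa> \<mu>"
  unfolding agree_def using assms pre_pre vec_meet_greatest vec_meet_le by metis

text \<open>Read contrapositively: a disagreement persists under all extensions. This makes the set
  of paths on which agreement still holds hereditary.\<close>

lemma agree_mono:
  assumes "\<kappa> \<in> paths \<Lambda>" "\<eta> \<in> paths \<Lambda>" "src \<Lambda> \<kappa> = rng \<Lambda> \<eta>"
    and "\<mu> \<in> paths \<Lambda>" "\<zeta> \<in> paths \<Lambda>" "src \<Lambda> \<mu> = rng \<Lambda> \<zeta>" "agree \<Lambda> (\<kappa> \<cdot> \<eta>) (\<mu> \<cdot> \<zeta>)"
  shows "agree \<Lambda> \<kappa> \<mu>"
  unfolding agree_def
proof (intro allI impI)
  fix m assume m: "m \<le> deg \<Lambda> \<kappa> \<and> m \<le> deg \<Lambda> \<mu>"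
  then have "m \<le> deg \<Lambda> (\<kappa> \<cdot> \<eta>)" "m \<le> deg \<Lambda> (\<mu> \<cdot> \<zeta>)"
    using deg_cat assms vec_nat_le_trans_add by auto
  with assms(7) have "pre \<Lambda> m (\<kappa> \<cdot> \<eta>) = pre \<Lambda> m (\<mu> \<cdot> \<zeta>)" by (auto simp: agree_def)
  then show "pre \<Lambda> m \<kappa> = pre \<Lambda> m \<mu>" using pre_suf_cat_le assms m by auto
qed

text \<open>From right to left, a degree \<open>m\<close> below both composites need not lie above
  \<open>deg \<Lambda> \<kappa>\<close>. Agreement is therefore tested at the largest degree only,
  which is \<open>deg \<Lambda> \<kappa>\<close> plus the meet for \<sigma> and \<tau>.\<close>

lemma agree_cat_iff:
  assumes "\<kappa> \<in> paths \<Lambda>" "\<sigma> \<in> paths \<Lambda>" "src \<Lambda> \<kappa> = rng \<Lambda> \<sigma>" "\<tau> \<in> paths \<Lambda>" "src \<Lambda> \<kappa> = rng \<Lambda> \<tau>"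
  shows "agree \<Lambda> (\<kappa> \<cdot> \<sigma>) (\<kappa> \<cdot> \<tau>) \<longleftrightarrow> agree \<Lambda> \<sigma> \<tau>"
proof
  assume a: "agree \<Lambda> (\<kappa> \<cdot> \<sigma>) (\<kappa> \<cdot> \<tau>)"
  show "agree \<Lambda> \<sigma> \<tau>" unfolding agree_def
  proof (intro allI impI, elim conjE)
    fix m assume m: "m \<le> deg \<Lambda> \<sigma>" "m \<le> deg \<Lambda> \<tau>"
    have "pre \<Lambda> (deg \<Lambda> \<kappa> + m) (\<kappa> \<cdot> \<sigma>) = pre \<Lambda> (deg \<Lambda> \<kappa> + m) (\<kappa> \<cdot> \<tau>)"
      by (rule agreeD[OF a]) (use assms deg_cat m in auto)
    then have "\<kappa> \<cdot> pre \<Lambda> m \<sigma> = \<kappa> \<cdot> pre \<Lambda> m \<tau>" using pre_suf_cat_ge(1) assms m by metis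
    then show "pre \<Lambda> m \<sigma> = pre \<Lambda> m \<tau>"
      using cat_cancel(2)[of \<kappa> "pre \<Lambda> m \<sigma>" \<kappa> "pre \<Lambda> m \<tau>"] pre_suf[OF assms(2) m(1)] pre_suf[OF assms(4) m(2)] assms
      by simp
  qed
next
  assume a: "agree \<Lambda> \<sigma> \<tau>"
  let ?m = "vec_meet (deg \<Lambda> \<sigma>) (deg \<Lambda> \<tau>)"
  have "pre \<Lambda> ?m \<sigma> = pre \<Lambda> ?m \<tau>" using a by (auto simp: agree_def)
  then have "pre \<Lambda> (deg \<Lambda> \<kappa> + ?m) (\<kappa> \<cdot> \<sigma>) = pre \<Lambda> (deg \<Lambda> \<kappa> + ?m) (\<kappa> \<cdot> \<tau>)"
    using pre_suf_cat_ge(1)[OF assms(1-3), of ?m] pre_suf_cat_ge(1)[OF assms(1,4,5), of ?m] by simp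
  then show "agree \<Lambda> (\<kappa> \<cdot> \<sigma>) (\<kappa> \<cdot> \<tau>)"
    by (intro agree_meet) (use assms in \<open>auto simp: cat_closed deg_cat vec_meet_add\<close>)
qed

lemma agree_rng: "\<kappa> \<in> paths \<Lambda> \<Longrightarrow> \<mu> \<in> paths \<Lambda> \<Longrightarrow> agree \<Lambda> \<kappa> \<mu> \<Longrightarrow> rng \<Lambda> \<kappa> = rng \<Lambda> \<mu>"
  using agreeD[of \<Lambda> \<kappa> \<mu> 0] pre_0 by simp

lemma agree_common_prefix:
  assumes "\<kappa> \<in> paths \<Lambda>" "\<mu> \<in> paths \<Lambda>" "agree \<Lambda> \<kappa> \<mu>"
  defines "m \<equiv> vec_meet (deg \<Lambda> \<kappa>) (deg \<Lambda> \<mu>)"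
  shows "\<kappa> = pre \<Lambda> m \<kappa> \<cdot> suf \<Lambda> m \<kappa>" "\<mu> = pre \<Lambda> m \<kappa> \<cdot> suf \<Lambda> m \<mu>"
    "src \<Lambda> (pre \<Lambda> m \<kappa>) = rng \<Lambda> (suf \<Lambda> m \<kappa>)" "src \<Lambda> (pre \<Lambda> m \<kappa>) = rng \<Lambda> (suf \<Lambda> m \<mu>)"
proof -
  have "pre \<Lambda> m \<kappa> = pre \<Lambda> m \<mu>" using assms by (auto simp: agree_def)
  then show "\<kappa> = pre \<Lambda> m \<kappa> \<cdot> suf \<Lambda> m \<kappa>" "\<mu> = pre \<Lambda> m \<kappa> \<cdot> suf \<Lambda> m \<mu>"
    "src \<Lambda> (pre \<Lambda> m \<kappa>) = rng \<Lambda> (suf \<Lambda> m \<kappa>)" "src \<Lambda> (pre \<Lambda> m \<kappa>) = rng \<Lambda> (suf \<Lambda> m \<mu>)"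
    using pre_suf[of \<kappa> m] pre_suf[of \<mu> m] assms by (auto simp: m_def)
qed

end

section \<open>Restriction of the action to paths\<close>

context self_similar_action
begin

abbreviation app_path (infixr "\<star>" 75) where "g \<star> \<kappa> \<equiv> act G g \<kappa>"
abbreviation restr_path (infixl "\<restriction>" 76) where "g \<restriction> \<kappa> \<equiv> restriction G \<Lambda> g \<kappa>"

lemma act_simps [simp]:
  assumes "g \<in> elems G" "\<kappa> \<in> paths \<Lambda>" "rng \<Lambda> \<kappa> = gdom G g"
  shows "g \<star> \<kappa> \<in> paths \<Lambda>" "rng \<Lambda> (g \<star> \<kappa>) = gcod G g" "deg \<Lambda> (g \<star> \<kappa>) = deg \<Lambda> \<kappa>"
proof -
  have "g \<star> \<kappa> \<in> act G g ` (paths_from \<Lambda> (gdom G g) \<inter> paths_of_degree \<Lambda> (deg \<Lambda> \<kappa>))"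
    using assms by (auto simp: paths_from_def paths_of_degree_def)
  also have "\<dots> = paths_from \<Lambda> (gcod G g) \<inter> paths_of_degree \<Lambda> (deg \<Lambda> \<kappa>)"
    using act_partial_iso[OF assms(1)] by (simp add: partial_iso_def)
  finally show "g \<star> \<kappa> \<in> paths \<Lambda>" "rng \<Lambda> (g \<star> \<kappa>) = gcod G g" "deg \<Lambda> (g \<star> \<kappa>) = deg \<Lambda> \<kappa>"
    by (auto simp: paths_from_def paths_of_degree_def)
qed

lemma act_vertex:
  assumes "g \<in> elems G"
  shows "g \<star> gdom G g = gcod G g"
proof -
  have v: "gdom G g \<in> verts \<Lambda>" using gdom_closed assms by simp
  have *: "g \<star> gdom G g \<in> paths \<Lambda>" "rng \<Lambda> (g \<star> gdom G g) = gcod G g" "deg \<Lambda> (g \<star> gdom G g) = 0"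
    using act_simps[OF assms] deg_verts[OF v] rng_src_verts[OF v] by auto
  then have "g \<star> gdom G g \<in> verts \<Lambda>" by (simp add: verts_def paths_of_degree_def)
  then show ?thesis using rng_src_verts * by simp
qed

lemma ginv_simps [simp]:
  assumes "g \<in> elems G"
  shows "ginv G g \<in> elems G" "gdom G (ginv G g) = gcod G g" "gcod G (ginv G g) = gdom G g"
  using assms ginv_closed gdom_ginv gcod_ginv by auto

lemma act_ginv:
  assumes "g \<in> elems G" "\<kappa> \<in> paths \<Lambda>" "rng \<Lambda> \<kappa> = gdom G g"
  shows "ginv G g \<star> g \<star> \<kappa> = \<kappa>"
proof -
  have "ginv G g \<star> g \<star> \<kappa> = gmult G (ginv G g) g \<star> \<kappa>"
    using act_gmult[of "ginv G g" g \<kappa>] assms by (simp add: paths_from_iff)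
  then show ?thesis using act_gunit[of "gdom G g" \<kappa>] gmult_ginv_left assms gdom_closed
    by (simp add: paths_from_iff)
qed

lemma act_ginv':
  assumes "g \<in> elems G" "\<kappa> \<in> paths \<Lambda>" "rng \<Lambda> \<kappa> = gcod G g"
  shows "g \<star> ginv G g \<star> \<kappa> = \<kappa>"
proof -
  have "g \<star> ginv G g \<star> \<kappa> = gmult G g (ginv G g) \<star> \<kappa>"
    using act_gmult[of g "ginv G g" \<kappa>] assms by (simp add: paths_from_iff)
  then show ?thesis using act_gunit[of "gcod G g" \<kappa>] gmult_ginv_right assms gcod_closed
    by (simp add: paths_from_iff)
qed

lemma act_inject:
  assumes "g \<in> elems G" "\<kappa> \<in> paths \<Lambda>" "rng \<Lambda> \<kappa> = gdom G g" "\<mu> \<in> paths \<Lambda>" "rng \<Lambda> \<mu> = gdom G g"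
    and "g \<star> \<kappa> = g \<star> \<mu>"
  shows "\<kappa> = \<mu>"
  using act_ginv assms by metis

lemma faithful_paths:
  assumes "g \<in> elems G" "h \<in> elems G" "gdom G g = gdom G h" "gcod G g = gcod G h"
    and "\<And>\<kappa>. \<kappa> \<in> paths \<Lambda> \<Longrightarrow> rng \<Lambda> \<kappa> = gdom G g \<Longrightarrow> g \<star> \<kappa> = h \<star> \<kappa>"
  shows "g = h"
  using faithful assms by (simp add: paths_from_iff)

lemma ginv_ginv: "g \<in> elems G \<Longrightarrow> ginv G (ginv G g) = g"
proof (rule faithful_paths)
  fix \<kappa> assume g: "g \<in> elems G" and \<kappa>: "\<kappa> \<in> paths \<Lambda>" "rng \<Lambda> \<kappa> = gdom G (ginv G (ginv G g))"
  then have "ginv G (ginv G g) \<star> ginv G g \<star> g \<star> \<kappa> = g \<star> \<kappa>"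
    by (intro act_ginv) auto
  then show "ginv G (ginv G g) \<star> \<kappa> = g \<star> \<kappa>" using act_ginv g \<kappa> by simp
qed auto

lemma is_edge_restrictionD:
  assumes "is_edge_restriction G \<Lambda> g \<kappa> h"
  shows "h \<in> elems G" "gdom G h = src \<Lambda> \<kappa>" "gcod G h = src \<Lambda> (g \<star> \<kappa>)"
    "\<And>\<mu>. \<mu> \<in> paths \<Lambda> \<Longrightarrow> rng \<Lambda> \<mu> = src \<Lambda> \<kappa> \<Longrightarrow> g \<star> (\<kappa> \<cdot> \<mu>) = (g \<star> \<kappa>) \<cdot> (h \<star> \<mu>)"
  using assms by (auto simp: is_edge_restriction_def paths_from_iff)

text \<open>The predicate \<open>is_edge_restriction\<close> makes sense along every path \<kappa>,
  not only along edges. Uniqueness in this generality, by cancelling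
  \<open>g \<star> \<kappa>\<close> and using faithfulness, is what makes restrictions independent
  of the factorisation.\<close>

lemma is_edge_restriction_unique:
  assumes "g \<in> elems G" "\<kappa> \<in> paths \<Lambda>" "rng \<Lambda> \<kappa> = gdom G g"
    and h: "is_edge_restriction G \<Lambda> g \<kappa> h" and h': "is_edge_restriction G \<Lambda> g \<kappa> h'"
  shows "h = h'"
proof (rule faithful_paths)
  note d = is_edge_restrictionD[OF h] and d' = is_edge_restrictionD[OF h']
  show "h \<in> elems G" "h' \<in> elems G" "gdom G h = gdom G h'" "gcod G h = gcod G h'"
    using d(1-3) d'(1-3) by auto
  fix \<mu> assume \<mu>: "\<mu> \<in> paths \<Lambda>" "rng \<Lambda> \<mu> = gdom G h"
  then have "(g \<star> \<kappa>) \<cdot> (h \<star> \<mu>) = (g \<star> \<kappa>) \<cdot> (h' \<star> \<mu>)" using d(2) d(4)[of \<mu>] d'(4)[of \<mu>] by simp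
  then show "h \<star> \<mu> = h' \<star> \<mu>"
    by (rule cat_cancel(2)[rotated -2]) (use d(1-3) d'(1-3) \<mu> assms(1-3) in simp_all)
qed

lemma edge_in_paths: "e \<in> edges \<Lambda> \<Longrightarrow> e \<in> paths \<Lambda>"
  by (auto simp: edges_def paths_of_degree_def)

lemma edge_restriction:
  assumes "g \<in> elems G" "e \<in> edges \<Lambda>" "rng \<Lambda> e = gdom G g"
  shows "is_edge_restriction G \<Lambda> g e (edge_restriction G \<Lambda> g e)"
  unfolding edge_restriction_def
  by (rule theI') (use self_similar[OF assms] is_edge_restriction_unique assms edge_in_paths in blast)

lemma is_edge_restriction_vertex:
  assumes "g \<in> elems G"
  shows "is_edge_restriction G \<Lambda> g (gdom G g) g"
proof -
  have v: "gdom G g \<in> verts \<Lambda>" "gcod G g \<in> verts \<Lambda>" using gdom_closed gcod_closed assms by auto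
  show ?thesis unfolding is_edge_restriction_def
    using v assms rng_src_verts act_vertex cat_rng act_simps by (auto simp: paths_from_iff) (metis act_simps(1,2) cat_rng)
qed

lemma is_edge_restriction_cat:
  assumes "g \<in> elems G" "\<kappa> \<in> paths \<Lambda>" "rng \<Lambda> \<kappa> = gdom G g" "\<mu> \<in> paths \<Lambda>" "src \<Lambda> \<kappa> = rng \<Lambda> \<mu>"
    and h: "is_edge_restriction G \<Lambda> g \<kappa> h" and k: "is_edge_restriction G \<Lambda> h \<mu> k"
  shows "is_edge_restriction G \<Lambda> g (\<kappa> \<cdot> \<mu>) k"
  unfolding is_edge_restriction_def
proof (intro conjI ballI)
  note d = is_edge_restrictionD[OF h] and d' = is_edge_restrictionD[OF k]
  have g\<mu>: "g \<star> (\<kappa> \<cdot> \<mu>) = (g \<star> \<kappa>) \<cdot> (h \<star> \<mu>)" using d(4) assms(4,5) by simp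
  show "k \<in> elems G" using d'(1) .
  show "gdom G k = src \<Lambda> (\<kappa> \<cdot> \<mu>)" using d'(2) assms(1-5) src_cat by simp
  show "gcod G k = src \<Lambda> (g \<star> (\<kappa> \<cdot> \<mu>))" unfolding g\<mu> using d(1-3) d'(3) assms(1-5) src_cat by simp
  fix \<nu> assume "\<nu> \<in> paths_from \<Lambda> (src \<Lambda> (\<kappa> \<cdot> \<mu>))"
  then have \<nu>: "\<nu> \<in> paths \<Lambda>" "rng \<Lambda> \<nu> = src \<Lambda> \<mu>" using src_cat assms(2,4,5) by (auto simp: paths_from_iff)
  have "g \<star> ((\<kappa> \<cdot> \<mu>) \<cdot> \<nu>) = g \<star> (\<kappa> \<cdot> \<mu> \<cdot> \<nu>)" using cat_assoc assms(2,4,5) \<nu> by simp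
  also have "\<dots> = (g \<star> \<kappa>) \<cdot> (h \<star> (\<mu> \<cdot> \<nu>))"
    using d(4)[of "\<mu> \<cdot> \<nu>"] assms(4,5) \<nu> cat_closed rng_cat by simp
  also have "\<dots> = (g \<star> \<kappa>) \<cdot> (h \<star> \<mu>) \<cdot> (k \<star> \<nu>)" using d'(4)[of \<nu>] \<nu> by simp
  also have "\<dots> = ((g \<star> \<kappa>) \<cdot> (h \<star> \<mu>)) \<cdot> (k \<star> \<nu>)"
    using d(1-3) d'(1-3) assms(1-5) \<nu> cat_assoc[of "g \<star> \<kappa>" "h \<star> \<mu>" "k \<star> \<nu>"] by simp
  finally show "g \<star> ((\<kappa> \<cdot> \<mu>) \<cdot> \<nu>) = (g \<star> (\<kappa> \<cdot> \<mu>)) \<cdot> (k \<star> \<nu>)" unfolding g\<mu> .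
qed

lemma edge_factorisation_paths: "edge_factorisation \<Lambda> \<kappa> es \<Longrightarrow> \<kappa> \<in> paths \<Lambda>"
  by (induction es arbitrary: \<kappa>) (auto simp: deg_verts cat_closed edge_in_paths)

lemma is_edge_restriction_foldl:
  assumes "edge_factorisation \<Lambda> \<kappa> es" "g \<in> elems G" "rng \<Lambda> \<kappa> = gdom G g"
  shows "is_edge_restriction G \<Lambda> g \<kappa> (foldl (edge_restriction G \<Lambda>) g es)"
  using assms
proof (induction es arbitrary: \<kappa> g)
  case Nil
  then show ?case using is_edge_restriction_vertex[of g] rng_src_verts by simp
next
  case (Cons e es)
  then obtain \<mu> where \<mu>: "e \<in> edges \<Lambda>" "edge_factorisation \<Lambda> \<mu> es" "src \<Lambda> e = rng \<Lambda> \<mu>" "\<kappa> = e \<cdot> \<mu>"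
    by auto
  note p = edge_in_paths[OF \<mu>(1)] edge_factorisation_paths[OF \<mu>(2)]
  have r: "rng \<Lambda> e = gdom G g" using Cons.prems \<mu> p rng_cat by simp
  note e = edge_restriction[OF Cons.prems(2) \<mu>(1) r]
  have "is_edge_restriction G \<Lambda> (edge_restriction G \<Lambda> g e) \<mu> (foldl (edge_restriction G \<Lambda>) (edge_restriction G \<Lambda> g e) es)"
    by (rule Cons.IH) (use \<mu> e in \<open>auto simp: is_edge_restriction_def\<close>)
  then show ?case using is_edge_restriction_cat[OF Cons.prems(2) p(1) r p(2) \<mu>(3) e] \<mu> by simp
qed

lemma edge_factorisation_exists:
  assumes "\<kappa> \<in> paths \<Lambda>"
  shows "\<exists>es. edge_factorisation \<Lambda> \<kappa> es"
  using assms
proof (induction "deg \<Lambda> \<kappa>" arbitrary: \<kappa> rule: vec_nat_induct)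
  case zero
  then have "edge_factorisation \<Lambda> \<kappa> []" by (simp add: verts_def paths_of_degree_def)
  then show ?case by blast
next
  case (add p i)
  have le: "axis i 1 \<le> deg \<Lambda> \<kappa>" using add(2)[symmetric] by simp
  note ps = pre_suf[OF add(3) le]
  have "p = deg \<Lambda> (suf \<Lambda> (axis i 1) \<kappa>)" using ps add(2)[symmetric] by simp
  then obtain es where "edge_factorisation \<Lambda> (suf \<Lambda> (axis i 1) \<kappa>) es" using add(1) ps by blast
  moreover have "pre \<Lambda> (axis i 1) \<kappa> \<in> edges \<Lambda>" using ps by (auto simp: edges_def paths_of_degree_def)
  ultimately have "edge_factorisation \<Lambda> \<kappa> (pre \<Lambda> (axis i 1) \<kappa> # es)" using ps by auto
  then show ?case by blast
qed

text \<open>Folding over any edge factorisation gives an element with the defining property along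
  the whole path. Since only one element has it, the definite description in
  \<open>restriction\<close> denotes.\<close>

lemma restriction_is:
  assumes "g \<in> elems G" "\<kappa> \<in> paths \<Lambda>" "rng \<Lambda> \<kappa> = gdom G g"
  shows "is_edge_restriction G \<Lambda> g \<kappa> (g \<restriction> \<kappa>)"
proof -
  obtain es where es: "edge_factorisation \<Lambda> \<kappa> es" using edge_factorisation_exists assms by blast
  let ?h = "foldl (edge_restriction G \<Lambda>) g es"
  have h: "is_edge_restriction G \<Lambda> g \<kappa> ?h" using is_edge_restriction_foldl es assms by blast
  have "g \<restriction> \<kappa> = ?h" unfolding restriction_def
    by (rule the_equality)
      (use es h is_edge_restriction_foldl is_edge_restriction_unique assms in blast)+
  with h show ?thesis by simp
qed

lemma restriction_eqI:
  assumes "g \<in> elems G" "\<kappa> \<in> paths \<Lambda>" "rng \<Lambda> \<kappa> = gdom G g" "is_edge_restriction G \<Lambda> g \<kappa> h"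
  shows "g \<restriction> \<kappa> = h"
  using is_edge_restriction_unique restriction_is assms by blast

lemma restr_simps [simp]:
  assumes "g \<in> elems G" "\<kappa> \<in> paths \<Lambda>" "rng \<Lambda> \<kappa> = gdom G g"
  shows "g \<restriction> \<kappa> \<in> elems G" "gdom G (g \<restriction> \<kappa>) = src \<Lambda> \<kappa>" "gcod G (g \<restriction> \<kappa>) = src \<Lambda> (g \<star> \<kappa>)"
  using restriction_is[OF assms] by (auto simp: is_edge_restriction_def)

lemma act_cat:
  assumes "g \<in> elems G" "\<kappa> \<in> paths \<Lambda>" "rng \<Lambda> \<kappa> = gdom G g" "\<mu> \<in> paths \<Lambda>" "src \<Lambda> \<kappa> = rng \<Lambda> \<mu>"
  shows "g \<star> (\<kappa> \<cdot> \<mu>) = (g \<star> \<kappa>) \<cdot> (g \<restriction> \<kappa> \<star> \<mu>)"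
  using restriction_is[OF assms(1-3)] assms by (auto simp: is_edge_restriction_def paths_from_iff)

lemma restr_cat:
  assumes "g \<in> elems G" "\<kappa> \<in> paths \<Lambda>" "rng \<Lambda> \<kappa> = gdom G g" "\<mu> \<in> paths \<Lambda>" "src \<Lambda> \<kappa> = rng \<Lambda> \<mu>"
  shows "g \<restriction> (\<kappa> \<cdot> \<mu>) = g \<restriction> \<kappa> \<restriction> \<mu>"
proof (rule restriction_eqI)
  show "is_edge_restriction G \<Lambda> g (\<kappa> \<cdot> \<mu>) (g \<restriction> \<kappa> \<restriction> \<mu>)"
    using is_edge_restriction_cat[OF assms restriction_is[OF assms(1-3)]] restriction_is assms by simp
qed (use assms rng_cat cat_closed in auto)

lemma restr_vertex: "g \<in> elems G \<Longrightarrow> g \<restriction> gdom G g = g"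
  using restriction_eqI[OF _ _ _ is_edge_restriction_vertex] gdom_closed rng_src_verts deg_verts by simp

lemma act_gunit': "v \<in> verts \<Lambda> \<Longrightarrow> \<kappa> \<in> paths \<Lambda> \<Longrightarrow> rng \<Lambda> \<kappa> = v \<Longrightarrow> gunit G v \<star> \<kappa> = \<kappa>"
  by (rule act_gunit) (simp_all add: paths_from_iff)

lemma restr_gunit:
  assumes "v \<in> verts \<Lambda>" "\<kappa> \<in> paths \<Lambda>" "rng \<Lambda> \<kappa> = v"
  shows "gunit G v \<restriction> \<kappa> = gunit G (src \<Lambda> \<kappa>)"
proof (rule restriction_eqI)
  have s: "src \<Lambda> \<kappa> \<in> verts \<Lambda>" using assms src_in_verts by simp
  have "gunit G v \<star> (\<kappa> \<cdot> \<mu>) = \<kappa> \<cdot> (gunit G (src \<Lambda> \<kappa>) \<star> \<mu>)"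
    if "\<mu> \<in> paths \<Lambda>" "rng \<Lambda> \<mu> = src \<Lambda> \<kappa>" for \<mu>
    using act_gunit'[of v "\<kappa> \<cdot> \<mu>"] act_gunit'[OF s that] that assms cat_closed rng_cat by simp
  then show "is_edge_restriction G \<Lambda> (gunit G v) \<kappa> (gunit G (src \<Lambda> \<kappa>))"
    unfolding is_edge_restriction_def
    using act_gunit'[OF assms] assms s gunit_closed gdom_gunit gcod_gunit by (simp add: paths_from_iff)
qed (use assms gunit_closed gdom_gunit in auto)

text \<open>The condition \<open>finite_state\<close> says nothing about units. Their restrictions
  are the units at sources of paths, of which a finite graph has finitely many.\<close>

lemma finite_restrictions:
  assumes "finite_kgraph \<Lambda>" "finite_state G \<Lambda>" "g \<in> elems G"
  shows "finite (restriction G \<Lambda> g ` paths_from \<Lambda> (gdom G g))"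
proof (cases "g \<in> gunit G ` verts \<Lambda>")
  case True
  then obtain v where v: "v \<in> verts \<Lambda>" "g = gunit G v" by blast
  then have "restriction G \<Lambda> g ` paths_from \<Lambda> (gdom G g) \<subseteq> gunit G ` verts \<Lambda>"
    using restr_gunit src_in_verts gdom_gunit by (auto simp: paths_from_iff)
  moreover have "finite (verts \<Lambda>)" using assms(1) by (simp add: finite_kgraph_def verts_def)
  ultimately show ?thesis using finite_subset by blast
next
  case False
  then show ?thesis using assms by (simp add: finite_state_def)
qed

lemma pre_act:
  assumes "g \<in> elems G" "\<kappa> \<in> paths \<Lambda>" "rng \<Lambda> \<kappa> = gdom G g" "m \<le> deg \<Lambda> \<kappa>"
  shows "pre \<Lambda> m (g \<star> \<kappa>) = g \<star> pre \<Lambda> m \<kappa>" "suf \<Lambda> m (g \<star> \<kappa>) = g \<restriction> pre \<Lambda> m \<kappa> \<star> suf \<Lambda> m \<kappa>"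
proof -
  note ps = pre_suf[OF assms(2,4)]
  have eq: "g \<star> \<kappa> = (g \<star> pre \<Lambda> m \<kappa>) \<cdot> (g \<restriction> pre \<Lambda> m \<kappa> \<star> suf \<Lambda> m \<kappa>)"
    using act_cat[of g "pre \<Lambda> m \<kappa>" "suf \<Lambda> m \<kappa>"] ps assms by simp
  show "pre \<Lambda> m (g \<star> \<kappa>) = g \<star> pre \<Lambda> m \<kappa>" "suf \<Lambda> m (g \<star> \<kappa>) = g \<restriction> pre \<Lambda> m \<kappa> \<star> suf \<Lambda> m \<kappa>"
    unfolding eq using pre_cat_deg suf_cat_deg ps assms by auto
qed


subsection \<open>Periodic triples\<close>

text \<open>The finite form of \<open>\<kappa>(g \<cdot> x) = \<mu>x\<close> for all infinite paths \<open>x\<close>.\<close>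

definition periodic :: "'m \<Rightarrow> 'g \<Rightarrow> 'm \<Rightarrow> bool" where
  "periodic \<kappa> g \<mu> \<longleftrightarrow> \<kappa> \<in> paths \<Lambda> \<and> \<mu> \<in> paths \<Lambda> \<and> g \<in> elems G \<and> gcod G g = src \<Lambda> \<kappa> \<and> gdom G g = src \<Lambda> \<mu> \<and>
     (\<forall>\<nu> \<in> paths \<Lambda>. rng \<Lambda> \<nu> = src \<Lambda> \<mu> \<longrightarrow> agree \<Lambda> (\<kappa> \<cdot> (g \<star> \<nu>)) (\<mu> \<cdot> \<nu>))"

lemma periodicD:
  assumes "periodic \<kappa> g \<mu>"
  shows "\<kappa> \<in> paths \<Lambda>" "\<mu> \<in> paths \<Lambda>" "g \<in> elems G" "gcod G g = src \<Lambda> \<kappa>" "gdom G g = src \<Lambda> \<mu>"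
    "\<And>\<nu>. \<nu> \<in> paths \<Lambda> \<Longrightarrow> rng \<Lambda> \<nu> = src \<Lambda> \<mu> \<Longrightarrow> agree \<Lambda> (\<kappa> \<cdot> (g \<star> \<nu>)) (\<mu> \<cdot> \<nu>)"
  using assms by (auto simp: periodic_def)

lemma periodic_agree:
  assumes "periodic \<kappa> g \<mu>"
  shows "agree \<Lambda> \<kappa> \<mu>"
proof -
  note p = periodicD[OF assms]
  have v: "src \<Lambda> \<mu> \<in> verts \<Lambda>" using src_in_verts p by simp
  have "agree \<Lambda> (\<kappa> \<cdot> (g \<star> src \<Lambda> \<mu>)) (\<mu> \<cdot> src \<Lambda> \<mu>)"
    using p(6) v deg_verts rng_src_verts by simp
  then show ?thesis using act_vertex[of g] p cat_src by simp
qed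

lemma periodic_rng: "periodic \<kappa> g \<mu> \<Longrightarrow> rng \<Lambda> \<kappa> = rng \<Lambda> \<mu>"
  using periodic_agree agree_rng periodicD by blast

text \<open>On infinite paths: apply \<open>\<kappa>(g \<cdot> x) = \<mu>x\<close> to those x that
  begin with \<nu>.\<close>

lemma periodic_restrict:
  assumes "periodic \<kappa> g \<mu>" "\<nu> \<in> paths \<Lambda>" "rng \<Lambda> \<nu> = src \<Lambda> \<mu>"
  shows "periodic (\<kappa> \<cdot> (g \<star> \<nu>)) (g \<restriction> \<nu>) (\<mu> \<cdot> \<nu>)"
  unfolding periodic_def
proof (intro conjI ballI impI)
  note p = periodicD[OF assms(1)]
  show "\<kappa> \<cdot> (g \<star> \<nu>) \<in> paths \<Lambda>" "\<mu> \<cdot> \<nu> \<in> paths \<Lambda>" "g \<restriction> \<nu> \<in> elems G"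
    "gcod G (g \<restriction> \<nu>) = src \<Lambda> (\<kappa> \<cdot> (g \<star> \<nu>))" "gdom G (g \<restriction> \<nu>) = src \<Lambda> (\<mu> \<cdot> \<nu>)"
    using p assms cat_closed src_cat by auto
  fix \<nu>' assume \<nu>': "\<nu>' \<in> paths \<Lambda>" "rng \<Lambda> \<nu>' = src \<Lambda> (\<mu> \<cdot> \<nu>)"
  then have r: "rng \<Lambda> \<nu>' = src \<Lambda> \<nu>" using src_cat p assms by simp
  have "agree \<Lambda> (\<kappa> \<cdot> (g \<star> (\<nu> \<cdot> \<nu>'))) (\<mu> \<cdot> (\<nu> \<cdot> \<nu>'))"
    using p(6) cat_closed rng_cat assms r \<nu>' by simp
  then show "agree \<Lambda> ((\<kappa> \<cdot> (g \<star> \<nu>)) \<cdot> (g \<restriction> \<nu> \<star> \<nu>')) ((\<mu> \<cdot> \<nu>) \<cdot> \<nu>')"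
    using act_cat[of g \<nu> \<nu>'] cat_assoc[of \<mu> \<nu> \<nu>'] cat_assoc[of \<kappa> "g \<star> \<nu>" "g \<restriction> \<nu> \<star> \<nu>'"] p assms \<nu>' r
    by simp
qed

text \<open>The substitution of \<open>ginv G g \<star> \<nu>\<close> for \<nu>. It makes the set of
  degree differences closed under negation.\<close>

lemma periodic_inv:
  assumes "periodic \<kappa> g \<mu>"
  shows "periodic \<mu> (ginv G g) \<kappa>"
  unfolding periodic_def
proof (intro conjI ballI impI)
  note p = periodicD[OF assms]
  show "\<mu> \<in> paths \<Lambda>" "\<kappa> \<in> paths \<Lambda>" "ginv G g \<in> elems G" "gcod G (ginv G g) = src \<Lambda> \<mu>"
    "gdom G (ginv G g) = src \<Lambda> \<kappa>" using p by auto
  fix \<nu> assume \<nu>: "\<nu> \<in> paths \<Lambda>" "rng \<Lambda> \<nu> = src \<Lambda> \<kappa>"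
  have "agree \<Lambda> (\<kappa> \<cdot> (g \<star> ginv G g \<star> \<nu>)) (\<mu> \<cdot> (ginv G g \<star> \<nu>))"
    by (rule p(6)) (use p \<nu> in auto)
  then show "agree \<Lambda> (\<mu> \<cdot> (ginv G g \<star> \<nu>)) (\<kappa> \<cdot> \<nu>)"
    using act_ginv'[of g \<nu>] p \<nu> agree_sym by simp
qed

lemma periodic_prefix:
  assumes "\<kappa> \<in> paths \<Lambda>" "\<alpha> \<in> paths \<Lambda>" "\<beta> \<in> paths \<Lambda>" "src \<Lambda> \<kappa> = rng \<Lambda> \<alpha>" "src \<Lambda> \<kappa> = rng \<Lambda> \<beta>"
  shows "periodic (\<kappa> \<cdot> \<alpha>) g (\<kappa> \<cdot> \<beta>) \<longleftrightarrow> periodic \<alpha> g \<beta>"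
proof -
  have "agree \<Lambda> ((\<kappa> \<cdot> \<alpha>) \<cdot> (g \<star> \<nu>)) ((\<kappa> \<cdot> \<beta>) \<cdot> \<nu>) \<longleftrightarrow> agree \<Lambda> (\<alpha> \<cdot> (g \<star> \<nu>)) (\<beta> \<cdot> \<nu>)"
    if "g \<in> elems G" "gcod G g = src \<Lambda> \<alpha>" "gdom G g = src \<Lambda> \<beta>" "\<nu> \<in> paths \<Lambda>" "rng \<Lambda> \<nu> = src \<Lambda> \<beta>" for \<nu>
    using agree_cat_iff[of \<kappa> "\<alpha> \<cdot> (g \<star> \<nu>)" "\<beta> \<cdot> \<nu>"] cat_assoc[of \<kappa> \<beta> \<nu>] cat_assoc[of \<kappa> \<alpha> "g \<star> \<nu>"]
      that assms cat_closed rng_cat by simp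
  then show ?thesis unfolding periodic_def using assms cat_closed src_cat by auto
qed

end

section \<open>Periodic triples under strong connectedness\<close>

locale connected_action = self_similar_action G \<Lambda>
  for G :: "('g, 'm) acting_groupoid" and \<Lambda> :: "('m, 'k::finite) kgraph" +
  assumes connected: "strongly_connected \<Lambda>"
begin

lemma connecting_path:
  assumes "v \<in> verts \<Lambda>" "w \<in> verts \<Lambda>"
  obtains \<kappa> where "\<kappa> \<in> paths \<Lambda>" "rng \<Lambda> \<kappa> = v" "src \<Lambda> \<kappa> = w"
  using connected assms by (auto simp: strongly_connected_def)

text \<open>Some edge of each colour exists somewhere. A path from v to its range, followed by that
  edge, has degree at least \<open>axis i 1\<close>, so its initial segment of that degree is an
  edge of colour i with range v.\<close>

lemma path_of_degree_exists:
  assumes "v \<in> verts \<Lambda>"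
  shows "\<exists>\<nu>. \<nu> \<in> paths \<Lambda> \<and> rng \<Lambda> \<nu> = v \<and> deg \<Lambda> \<nu> = p"
  using assms
proof (induction p arbitrary: v rule: vec_nat_induct)
  case zero
  then show ?case using deg_verts rng_src_verts by auto
next
  case (add p i)
  obtain e where e: "e \<in> paths \<Lambda>" "deg \<Lambda> e = axis i 1"
    using edges_nonempty[of i] by (auto simp: paths_of_degree_def)
  obtain \<kappa> where \<kappa>: "\<kappa> \<in> paths \<Lambda>" "rng \<Lambda> \<kappa> = v" "src \<Lambda> \<kappa> = rng \<Lambda> e"
    using connecting_path add e rng_in_verts by blast
  have "axis i 1 \<le> deg \<Lambda> (\<kappa> \<cdot> e)" "\<kappa> \<cdot> e \<in> paths \<Lambda>" "rng \<Lambda> (\<kappa> \<cdot> e) = v"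
    using deg_cat cat_closed rng_cat \<kappa> e by auto
  note ps = pre_suf[OF this(2,1)] this
  obtain \<nu> where \<nu>: "\<nu> \<in> paths \<Lambda>" "rng \<Lambda> \<nu> = src \<Lambda> (pre \<Lambda> (axis i 1) (\<kappa> \<cdot> e))" "deg \<Lambda> \<nu> = p"
    using add(1) ps src_in_verts by blast
  have "pre \<Lambda> (axis i 1) (\<kappa> \<cdot> e) \<cdot> \<nu> \<in> paths \<Lambda>" "rng \<Lambda> (pre \<Lambda> (axis i 1) (\<kappa> \<cdot> e) \<cdot> \<nu>) = v"
    "deg \<Lambda> (pre \<Lambda> (axis i 1) (\<kappa> \<cdot> e) \<cdot> \<nu>) = axis i 1 + p"
    using ps \<nu> cat_closed rng_cat deg_cat by auto
  then show ?case by blast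
qed

text \<open>Choosing x' with \<open>g' \<cdot> x' = g \<cdot> x\<close> makes the left sides of the
  two equations equal, so \<open>\<mu>x = \<mu>'x'\<close>. As \<mu> and \<mu>' have the same
  degree, this gives \<mu> = \<mu>' and x = x', hence equality of the actions and, by faithfulness,
  of g and g'. The proof does this with finite paths.\<close>

lemma periodic_unique:
  assumes "periodic \<kappa> g \<mu>" "periodic \<kappa> g' \<mu>'" "deg \<Lambda> \<mu> = deg \<Lambda> \<mu>'"
  shows "\<mu> = \<mu>'" "g = g'"
proof -
  note p = periodicD[OF assms(1)] and p' = periodicD[OF assms(2)]
  have *: "\<mu> = \<mu>' \<and> g \<star> \<nu>0 = g' \<star> \<nu>0"
    if \<nu>0: "\<nu>0 \<in> paths \<Lambda>" "rng \<Lambda> \<nu>0 = src \<Lambda> \<mu>" for \<nu>0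
  proof -
    \<comment> \<open>Agreement must be available at degree
      \<open>deg \<Lambda> \<mu> + deg \<Lambda> \<nu>0\<close> although \<kappa> may be shorter
      than \<mu>; this padding makes all four composites long enough.\<close>
    obtain \<nu>1 where \<nu>1: "\<nu>1 \<in> paths \<Lambda>" "rng \<Lambda> \<nu>1 = src \<Lambda> \<nu>0" "deg \<Lambda> \<nu>1 = deg \<Lambda> \<kappa> + deg \<Lambda> \<mu>"
      using path_of_degree_exists src_in_verts \<nu>0 by blast
    define \<nu> where "\<nu> = \<nu>0 \<cdot> \<nu>1"
    define \<nu>' where "\<nu>' = ginv G g' \<star> g \<star> \<nu>"
    have \<nu>: "\<nu> \<in> paths \<Lambda>" "rng \<Lambda> \<nu> = src \<Lambda> \<mu>" "deg \<Lambda> \<nu> = deg \<Lambda> \<nu>0 + (deg \<Lambda> \<kappa> + deg \<Lambda> \<mu>)"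
      using \<nu>0 \<nu>1 by (auto simp: \<nu>_def cat_closed rng_cat deg_cat)
    have \<nu>': "\<nu>' \<in> paths \<Lambda>" "rng \<Lambda> \<nu>' = src \<Lambda> \<mu>'" "deg \<Lambda> \<nu>' = deg \<Lambda> \<nu>" "g' \<star> \<nu>' = g \<star> \<nu>"
      using \<nu> p p' act_ginv'[of g' "g \<star> \<nu>"] by (auto simp: \<nu>'_def)
    let ?m = "deg \<Lambda> \<mu> + deg \<Lambda> \<nu>0"
    have m: "?m \<le> deg \<Lambda> \<mu> + deg \<Lambda> \<nu>" "?m \<le> deg \<Lambda> \<kappa> + deg \<Lambda> \<nu>"
      unfolding \<nu> by (auto simp: less_eq_vec_def)
    have "pre \<Lambda> ?m (\<kappa> \<cdot> (g \<star> \<nu>)) = pre \<Lambda> ?m (\<mu> \<cdot> \<nu>)"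
      by (rule agreeD[OF p(6)]) (use \<nu> p m deg_cat in auto)
    moreover have "pre \<Lambda> ?m (\<kappa> \<cdot> (g' \<star> \<nu>')) = pre \<Lambda> ?m (\<mu>' \<cdot> \<nu>')"
      by (rule agreeD[OF p'(6)]) (use \<nu> \<nu>' p' p m deg_cat assms(3) in auto)
    ultimately have "pre \<Lambda> ?m (\<mu> \<cdot> \<nu>) = pre \<Lambda> ?m (\<mu>' \<cdot> \<nu>')" using \<nu>'(4) by simp
    moreover have "pre \<Lambda> ?m (\<mu> \<cdot> \<nu>) = \<mu> \<cdot> pre \<Lambda> (deg \<Lambda> \<nu>0) \<nu>"
      using pre_suf_cat_ge(1)[of \<mu> \<nu>] \<nu> p by simp
    moreover have "pre \<Lambda> ?m (\<mu>' \<cdot> \<nu>') = \<mu>' \<cdot> pre \<Lambda> (deg \<Lambda> \<nu>0) \<nu>'"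
      using pre_suf_cat_ge(1)[of \<mu>' \<nu>' "deg \<Lambda> \<nu>0"] \<nu>' \<nu> p' assms(3) by simp
    moreover have \<nu>pre: "pre \<Lambda> (deg \<Lambda> \<nu>0) \<nu> = \<nu>0" unfolding \<nu>_def using pre_cat_deg \<nu>0 \<nu>1 by simp
    ultimately have eq: "\<mu> \<cdot> \<nu>0 = \<mu>' \<cdot> pre \<Lambda> (deg \<Lambda> \<nu>0) \<nu>'" by simp
    have l: "deg \<Lambda> \<nu>0 \<le> deg \<Lambda> \<nu>'" "deg \<Lambda> \<nu>0 \<le> deg \<Lambda> \<nu>" using \<nu> \<nu>' by auto
    have \<mu>: "\<mu> = \<mu>'" "\<nu>0 = pre \<Lambda> (deg \<Lambda> \<nu>0) \<nu>'"
      by (rule cat_cancel[OF _ _ _ _ _ _ eq assms(3)];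
          use pre_suf[OF \<nu>'(1) l(1)] \<nu>0 \<nu>' p(1-5) p'(1-5) in simp)+
    have "g' \<star> \<nu>0 = pre \<Lambda> (deg \<Lambda> \<nu>0) (g' \<star> \<nu>')" using pre_act(1)[of g' \<nu>' "deg \<Lambda> \<nu>0"] \<mu> l \<nu>' p' by simp
    also have "\<dots> = g \<star> pre \<Lambda> (deg \<Lambda> \<nu>0) \<nu>" unfolding \<nu>'(4) using pre_act(1) \<nu> p l by simp
    finally show ?thesis using \<mu> \<nu>pre by simp
  qed
  have v: "src \<Lambda> \<mu> \<in> verts \<Lambda>" using p src_in_verts by simp
  show \<mu>: "\<mu> = \<mu>'" using *[of "src \<Lambda> \<mu>"] v deg_verts rng_src_verts by simp
  show "g = g'"
  proof (rule faithful_paths)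
    fix \<nu> assume "\<nu> \<in> paths \<Lambda>" "rng \<Lambda> \<nu> = gdom G g"
    then show "g \<star> \<nu> = g' \<star> \<nu>" using *[of \<nu>] p(5) by simp
  qed (use p(3-5) p'(3-5) \<mu> in auto)
qed

lemma periodic_unique':
  assumes "periodic \<kappa> g \<mu>" "periodic \<kappa>' g' \<mu>" "deg \<Lambda> \<kappa> = deg \<Lambda> \<kappa>'"
  shows "\<kappa> = \<kappa>'" "g = g'"
proof -
  note u = periodic_unique[OF periodic_inv[OF assms(1)] periodic_inv[OF assms(2)] assms(3)]
  show "\<kappa> = \<kappa>'" using u by simp
  show "g = g'" using u(2) ginv_ginv assms periodicD(3) by metis
qed

text \<open>Transport of one periodic triple to an arbitrary \<kappa>. A path \<xi> connects the
  source of \<alpha> to \<kappa>, and the triple is restricted along the \<nu> with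
  \<open>k \<star> \<nu> = \<xi> \<cdot> \<kappa>\<close>. The degrees are such that
  \<open>\<beta> \<cdot> \<nu>\<close> is longer than \<open>\<alpha> \<cdot> \<xi>\<close> by
  exactly q, and agreement shows that it begins with \<open>\<alpha> \<cdot> \<xi>\<close>, which is
  then cancelled on both sides.\<close>

lemma periodic_exists:
  assumes "periodic \<alpha> k \<beta>" "deg \<Lambda> \<alpha> + q = p + deg \<Lambda> \<beta>" "\<kappa> \<in> paths \<Lambda>" "deg \<Lambda> \<kappa> = p"
  obtains \<mu> h where "periodic \<kappa> h \<mu>" "deg \<Lambda> \<mu> = q"
proof -
  note p = periodicD[OF assms(1)]
  obtain \<xi> where \<xi>: "\<xi> \<in> paths \<Lambda>" "rng \<Lambda> \<xi> = src \<Lambda> \<alpha>" "src \<Lambda> \<xi> = rng \<Lambda> \<kappa>"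
    using connecting_path p assms rng_in_verts src_in_verts by metis
  have \<xi>\<kappa>: "\<xi> \<cdot> \<kappa> \<in> paths \<Lambda>" "rng \<Lambda> (\<xi> \<cdot> \<kappa>) = src \<Lambda> \<alpha>" "deg \<Lambda> (\<xi> \<cdot> \<kappa>) = deg \<Lambda> \<xi> + p"
    using \<xi> assms cat_closed rng_cat deg_cat by auto
  define \<nu> where "\<nu> = ginv G k \<star> (\<xi> \<cdot> \<kappa>)"
  have \<nu>: "\<nu> \<in> paths \<Lambda>" "rng \<Lambda> \<nu> = src \<Lambda> \<beta>" "deg \<Lambda> \<nu> = deg \<Lambda> \<xi> + p" "k \<star> \<nu> = \<xi> \<cdot> \<kappa>"
    using \<xi>\<kappa> p act_ginv'[of k "\<xi> \<cdot> \<kappa>"] by (auto simp: \<nu>_def)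
  have as: "\<alpha> \<cdot> (\<xi> \<cdot> \<kappa>) = (\<alpha> \<cdot> \<xi>) \<cdot> \<kappa>" using cat_assoc \<xi> p assms by simp
  have "periodic (\<alpha> \<cdot> (k \<star> \<nu>)) (k \<restriction> \<nu>) (\<beta> \<cdot> \<nu>)" using periodic_restrict assms(1) \<nu> by blast
  then have per: "periodic ((\<alpha> \<cdot> \<xi>) \<cdot> \<kappa>) (k \<restriction> \<nu>) (\<beta> \<cdot> \<nu>)" unfolding \<nu>(4) as .
  let ?a = "deg \<Lambda> (\<alpha> \<cdot> \<xi>)"
  have \<alpha>\<xi>: "\<alpha> \<cdot> \<xi> \<in> paths \<Lambda>" "src \<Lambda> (\<alpha> \<cdot> \<xi>) = rng \<Lambda> \<kappa>" "?a = deg \<Lambda> \<alpha> + deg \<Lambda> \<xi>"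
    using cat_closed src_cat deg_cat \<xi> p by auto
  have \<beta>\<nu>: "\<beta> \<cdot> \<nu> \<in> paths \<Lambda>" "deg \<Lambda> (\<beta> \<cdot> \<nu>) = deg \<Lambda> \<beta> + (deg \<Lambda> \<xi> + p)"
    using cat_closed deg_cat \<nu> p by auto
  have d: "deg \<Lambda> (\<beta> \<cdot> \<nu>) = ?a + q" unfolding \<beta>\<nu> \<alpha>\<xi> using assms(2) by (metis add.assoc add.commute)
  then have le: "?a \<le> deg \<Lambda> (\<beta> \<cdot> \<nu>)" by simp
  have "pre \<Lambda> ?a ((\<alpha> \<cdot> \<xi>) \<cdot> \<kappa>) = pre \<Lambda> ?a (\<beta> \<cdot> \<nu>)"
    by (rule agreeD[OF periodic_agree[OF per]]) (use le \<alpha>\<xi> assms(3) deg_cat in auto)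
  then have pr: "pre \<Lambda> ?a (\<beta> \<cdot> \<nu>) = \<alpha> \<cdot> \<xi>" using pre_cat_deg \<alpha>\<xi> assms(3) by simp
  note ps = pre_suf[OF \<beta>\<nu>(1) le]
  have "periodic \<kappa> (k \<restriction> \<nu>) (suf \<Lambda> ?a (\<beta> \<cdot> \<nu>))"
    using periodic_prefix[of "\<alpha> \<cdot> \<xi>" \<kappa> "suf \<Lambda> ?a (\<beta> \<cdot> \<nu>)" "k \<restriction> \<nu>"] per ps pr \<alpha>\<xi> assms(3) by simp
  moreover have "deg \<Lambda> (suf \<Lambda> ?a (\<beta> \<cdot> \<nu>)) = q" unfolding ps(6) d by simp
  ultimately show thesis using that by blast
qed

text \<open>Every path starting at the source of \<kappa> has the form
  \<open>h \<star> \<nu>\<close>. Thus an extension of \<kappa> and \<mu> can be written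
  \<open>\<kappa> \<cdot> (h \<star> \<nu>)\<close>, which begins with \<mu> by choice and with
  \<mu>' by agreement.\<close>

lemma periodic_common_extension:
  assumes "periodic \<kappa> h \<mu>'" "\<mu> \<in> paths \<Lambda>" "deg \<Lambda> \<mu> = deg \<Lambda> \<mu>'"
    and "\<eta> \<in> paths \<Lambda>" "src \<Lambda> \<kappa> = rng \<Lambda> \<eta>" "\<zeta> \<in> paths \<Lambda>" "src \<Lambda> \<mu> = rng \<Lambda> \<zeta>" "\<kappa> \<cdot> \<eta> = \<mu> \<cdot> \<zeta>"
  shows "\<mu> = \<mu>'"
proof -
  note p = periodicD[OF assms(1)]
  obtain \<tau> where \<tau>: "\<tau> \<in> paths \<Lambda>" "rng \<Lambda> \<tau> = src \<Lambda> \<eta>" "deg \<Lambda> \<tau> = deg \<Lambda> \<mu>"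
    using path_of_degree_exists src_in_verts assms by blast
  have s: "src \<Lambda> \<eta> = src \<Lambda> \<zeta>" using src_cat assms p by metis
  have eq: "\<kappa> \<cdot> (\<eta> \<cdot> \<tau>) = \<mu> \<cdot> (\<zeta> \<cdot> \<tau>)"
    using cat_assoc[of \<kappa> \<eta> \<tau>] cat_assoc[of \<mu> \<zeta> \<tau>] assms p \<tau> s by simp
  have \<eta>\<tau>: "\<eta> \<cdot> \<tau> \<in> paths \<Lambda>" "rng \<Lambda> (\<eta> \<cdot> \<tau>) = src \<Lambda> \<kappa>" "deg \<Lambda> (\<eta> \<cdot> \<tau>) = deg \<Lambda> \<eta> + deg \<Lambda> \<mu>"
    using cat_closed rng_cat deg_cat \<tau> assms by auto
  have \<zeta>\<tau>: "\<zeta> \<cdot> \<tau> \<in> paths \<Lambda>" "rng \<Lambda> (\<zeta> \<cdot> \<tau>) = src \<Lambda> \<mu>"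
    using cat_closed rng_cat \<tau> assms s by auto
  define \<nu> where "\<nu> = ginv G h \<star> (\<eta> \<cdot> \<tau>)"
  have \<nu>: "\<nu> \<in> paths \<Lambda>" "rng \<Lambda> \<nu> = src \<Lambda> \<mu>'" "h \<star> \<nu> = \<eta> \<cdot> \<tau>"
    using \<eta>\<tau> p act_ginv'[of h "\<eta> \<cdot> \<tau>"] by (auto simp: \<nu>_def)
  have "pre \<Lambda> (deg \<Lambda> \<mu>) (\<kappa> \<cdot> (h \<star> \<nu>)) = pre \<Lambda> (deg \<Lambda> \<mu>) (\<mu>' \<cdot> \<nu>)"
    by (rule agreeD[OF p(6)])
      (use \<nu> p \<eta>\<tau> assms in \<open>simp_all add: deg_cat vec_nat_le_trans_add\<close>)
  moreover have "pre \<Lambda> (deg \<Lambda> \<mu>) (\<mu>' \<cdot> \<nu>) = \<mu>'" using pre_cat_deg \<nu> p assms by simp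
  moreover have "pre \<Lambda> (deg \<Lambda> \<mu>) (\<kappa> \<cdot> (h \<star> \<nu>)) = \<mu>" unfolding \<nu>(3) eq using pre_cat_deg \<zeta>\<tau> assms by simp
  ultimately show ?thesis by simp
qed

text \<open>Restricting the first triple along \<theta> and putting \<mu> in front of the second one
  give two periodic triples with the same right path \<open>\<mu> \<cdot> \<theta>\<close> and left
  paths of equal degree. Uniqueness identifies them.\<close>

lemma periodic_cocycle:
  assumes "periodic \<kappa> h \<mu>" "periodic \<eta> k \<theta>" "rng \<Lambda> \<eta> = src \<Lambda> \<mu>"
    and "deg \<Lambda> \<eta> = deg \<Lambda> \<kappa>" "deg \<Lambda> \<theta> = deg \<Lambda> \<mu>"
  shows "\<kappa> \<cdot> (h \<star> \<theta>) = \<mu> \<cdot> \<eta>" "h \<restriction> \<theta> = k"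
proof -
  note p = periodicD[OF assms(1)] and p' = periodicD[OF assms(2)]
  have r: "rng \<Lambda> \<theta> = src \<Lambda> \<mu>" using periodic_rng assms by metis
  have "periodic (\<kappa> \<cdot> (h \<star> \<theta>)) (h \<restriction> \<theta>) (\<mu> \<cdot> \<theta>)" using periodic_restrict assms p' r by blast
  moreover have "periodic (\<mu> \<cdot> \<eta>) k (\<mu> \<cdot> \<theta>)" using periodic_prefix assms p p' r by metis
  moreover have "deg \<Lambda> (\<kappa> \<cdot> (h \<star> \<theta>)) = deg \<Lambda> (\<mu> \<cdot> \<eta>)" using deg_cat p p' r assms by (simp add: add.commute)
  ultimately show "\<kappa> \<cdot> (h \<star> \<theta>) = \<mu> \<cdot> \<eta>" "h \<restriction> \<theta> = k" using periodic_unique' by blast+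
qed

end

section \<open>Infinite paths\<close>

context k_graph
begin

text \<open>The members of the family need only have degree at least b. This slack lets the lemma
  serve concatenations, images under the action, and limits along the diagonal degrees.\<close>

lemma inf_path_limit:
  assumes f: "\<And>b. f b \<in> paths \<Lambda>" "\<And>b. b \<le> deg \<Lambda> (f b)"
    and coherent: "\<And>b c. b \<le> c \<Longrightarrow> pre \<Lambda> b (f c) = pre \<Lambda> b (f b)"
  shows "restrict (\<lambda>(a, b). suf \<Lambda> a (pre \<Lambda> b (f b))) Omega \<in> inf_paths \<Lambda>"
proof -
  define P where "P b = pre \<Lambda> b (f b)" for b
  have P: "P b \<in> paths \<Lambda>" "deg \<Lambda> (P b) = b" for b
    using pre_suf[OF f(1) f(2)] by (auto simp: P_def)
  have PP: "pre \<Lambda> b (P c) = P b" if "b \<le> c" for b c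
    unfolding P_def using pre_pre[OF f(1) that f(2)] coherent[OF that] by simp
  have "src \<Lambda> (suf \<Lambda> p (P q)) = rng \<Lambda> (suf \<Lambda> q (P n)) \<and> suf \<Lambda> p (P q) \<cdot> suf \<Lambda> q (P n) = suf \<Lambda> p (P n)"
    if "p \<le> q" "q \<le> n" for p q n
  proof
    note ps = pre_suf[OF P(1), of q n, unfolded P(2), OF that(2), unfolded PP[OF that(2)]]
    note ps' = pre_suf[OF P(1), of p q, unfolded P(2), OF that(1)]
    show "src \<Lambda> (suf \<Lambda> p (P q)) = rng \<Lambda> (suf \<Lambda> q (P n))" using ps(3) ps'(8) by simp
    have "suf \<Lambda> p (P q \<cdot> suf \<Lambda> q (P n)) = suf \<Lambda> p (P q) \<cdot> suf \<Lambda> q (P n)"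
      by (rule pre_suf_cat_le(2)) (use ps P that in auto)
    then show "suf \<Lambda> p (P q) \<cdot> suf \<Lambda> q (P n) = suf \<Lambda> p (P n)" using ps(4) by simp
  qed
  moreover have "suf \<Lambda> p (P q) \<in> paths \<Lambda> \<and> deg \<Lambda> (suf \<Lambda> p (P q)) = q - p" if "p \<le> q" for p q
    using pre_suf(2,6)[OF P(1), of p q, unfolded P(2), OF that] by simp
  ultimately show ?thesis unfolding inf_paths_def P_def[symmetric]
    by (auto simp: Omega_def intro: order_trans)
qed

lemma inf_pathsD:
  assumes "x \<in> inf_paths \<Lambda>"
  shows "a \<le> b \<Longrightarrow> x (a, b) \<in> paths \<Lambda>" "a \<le> b \<Longrightarrow> deg \<Lambda> (x (a, b)) = b - a"
    "a \<le> b \<Longrightarrow> b \<le> c \<Longrightarrow> src \<Lambda> (x (a, b)) = rng \<Lambda> (x (b, c))"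
    "a \<le> b \<Longrightarrow> b \<le> c \<Longrightarrow> x (a, b) \<cdot> x (b, c) = x (a, c)"
    "x \<in> extensional Omega"
  using assms by (auto simp: inf_paths_def)

lemma inf_path_segment:
  assumes "x \<in> inf_paths \<Lambda>" "a \<le> b" "b \<le> c"
  shows "pre \<Lambda> (b - a) (x (a, c)) = x (a, b)" "suf \<Lambda> (b - a) (x (a, c)) = x (b, c)"
proof -
  note d = inf_pathsD[OF assms(1)]
  have eq: "x (a, c) = x (a, b) \<cdot> x (b, c)" using d(4) assms by simp
  show "pre \<Lambda> (b - a) (x (a, c)) = x (a, b)" "suf \<Lambda> (b - a) (x (a, c)) = x (b, c)"
    unfolding eq using pre_cat_deg suf_cat_deg d(1-3) assms by auto
qed

lemma inf_path_segment_0: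
  assumes "x \<in> inf_paths \<Lambda>" "b \<le> c"
  shows "pre \<Lambda> b (x (0, c)) = x (0, b)" "suf \<Lambda> b (x (0, c)) = x (b, c)"
  using inf_path_segment[OF assms(1) _ assms(2), of 0] by auto

lemma inf_path_rng:
  assumes "x \<in> inf_paths \<Lambda>"
  shows "rng \<Lambda> (x (0, b)) = x (0, 0)"
proof -
  have "x (0, 0) \<in> verts \<Lambda>" using inf_pathsD(1,2)[OF assms, of 0 0] by (simp add: verts_def paths_of_degree_def)
  then have "src \<Lambda> (x (0, 0)) = x (0, 0)" using rng_src_verts by simp
  then show ?thesis using inf_pathsD(3)[OF assms, of 0 0 b] by simp
qed

text \<open>Cofinally many initial segments suffice; for a concatenation with \<kappa>, the segments
  that are directly known are those of degree \<open>deg \<Lambda> \<kappa> + b\<close>.\<close>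

lemma inf_path_eqI:
  assumes "x \<in> inf_paths \<Lambda>" "y \<in> inf_paths \<Lambda>" "\<And>b. \<exists>c. b \<le> c \<and> x (0, c) = y (0, c)"
  shows "x = y"
proof (rule extensionalityI[of _ Omega])
  show "x \<in> extensional Omega" "y \<in> extensional Omega" using inf_pathsD assms by auto
  fix ab :: "(nat ^ 'k) \<times> (nat ^ 'k)" assume "ab \<in> Omega"
  then obtain a b where ab: "ab = (a, b)" "a \<le> b" by (auto simp: Omega_def)
  obtain c where c: "b \<le> c" "x (0, c) = y (0, c)" using assms(3) by blast
  have "x (0, b) = y (0, b)" using inf_path_segment_0(1) assms(1,2) c by metis
  then show "x ab = y ab" using inf_path_segment_0(2) assms(1,2) ab by metis
qed

lemma shift_apply: "a \<le> b \<Longrightarrow> shift n x (a, b) = x (a + n, b + n)"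
  by (simp add: shift_def Omega_def)

lemma shift_in_inf_paths:
  assumes "x \<in> inf_paths \<Lambda>"
  shows "shift n x \<in> inf_paths \<Lambda>"
proof -
  note x = inf_pathsD[OF assms]
  have le: "a + n \<le> b + n" if "a \<le> b" for a b :: "nat ^ 'k" using that by (simp add: less_eq_vec_def)
  have d: "(b + n) - (a + n) = b - a" for a b :: "nat ^ 'k" by (simp add: vec_eq_iff)
  have "shift n x (p, q) \<in> paths \<Lambda> \<and> deg \<Lambda> (shift n x (p, q)) = q - p" if "p \<le> q" for p q
    using x(1,2)[OF le[OF that]] that by (simp add: shift_apply d)
  moreover have "src \<Lambda> (shift n x (p, q)) = rng \<Lambda> (shift n x (q, r)) \<and>
      shift n x (p, q) \<cdot> shift n x (q, r) = shift n x (p, r)" if "p \<le> q" "q \<le> r" for p q r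
    using x(3,4)[OF le[OF that(1)] le[OF that(2)]] that order_trans[OF that] by (simp add: shift_apply)
  moreover have "shift n x \<in> extensional Omega" by (simp add: shift_def)
  ultimately show ?thesis by (simp add: inf_paths_def)
qed

lemma shift_shift: "shift p (shift q x) = shift (p + q) x"
  by (rule ext) (auto simp: shift_def Omega_def restrict_def less_eq_vec_def add.assoc)

lemma inf_cat:
  assumes "\<kappa> \<in> paths \<Lambda>" "y \<in> inf_paths \<Lambda>" "y (0, 0) = src \<Lambda> \<kappa>"
  shows "inf_cat \<Lambda> \<kappa> y \<in> inf_paths \<Lambda>"
    and "inf_cat \<Lambda> \<kappa> y (0, deg \<Lambda> \<kappa> + b) = \<kappa> \<cdot> y (0, b)"
    and "shift (deg \<Lambda> \<kappa>) (inf_cat \<Lambda> \<kappa> y) = y"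
proof -
  let ?d = "deg \<Lambda> \<kappa>"
  define f where "f b = \<kappa> \<cdot> y (0, b)" for b
  note y = inf_pathsD[OF assms(2)] inf_path_rng[OF assms(2)]
  have f: "f b \<in> paths \<Lambda>" "deg \<Lambda> (f b) = ?d + b" for b
    using y assms by (auto simp: f_def cat_closed deg_cat)
  have coherent: "pre \<Lambda> b (f c) = pre \<Lambda> b (f b)" if "b \<le> c" for b c
  proof -
    have "f b = pre \<Lambda> (?d + b) (f c)" unfolding f_def
      using pre_suf_cat_ge(1)[of \<kappa> "y (0, c)" b] inf_path_segment_0(1)[OF assms(2) that] y assms that by simp
    then show ?thesis using pre_pre[OF f(1), of b "?d + b" c] f(2) that by simp
  qed
  define x where "x = restrict (\<lambda>(a, b). suf \<Lambda> a (pre \<Lambda> b (f b))) Omega"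
  have x: "x \<in> inf_paths \<Lambda>" unfolding x_def by (rule inf_path_limit[OF f(1) _ coherent]) (simp_all add: f(2))
  have xd: "x (0, ?d + b) = f b" for b
  proof -
    have "x (0, ?d + b) = pre \<Lambda> (?d + b) (f (?d + b))"
      using suf_0 pre_suf(1)[OF f(1)] f(2) by (simp add: x_def Omega_def)
    also have "\<dots> = \<kappa> \<cdot> pre \<Lambda> b (y (0, ?d + b))" unfolding f_def
      by (rule pre_suf_cat_ge(1)) (use y assms in auto)
    also have "\<dots> = f b" unfolding f_def using inf_path_segment_0(1)[OF assms(2), of b "?d + b"] by simp
    finally show ?thesis .
  qed
  have "x (0, ?d) = \<kappa>"
    using xd[of 0] assms cat_src by (simp add: f_def)
  moreover have "shift ?d x = y"
  proof (rule inf_path_eqI[OF shift_in_inf_paths[OF x] assms(2)])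
    fix b
    have "shift ?d x (0, b) = suf \<Lambda> ?d (x (0, ?d + b))"
      using inf_path_segment_0(2)[OF x, of ?d "?d + b"] by (simp add: shift_apply add.commute)
    also have "\<dots> = y (0, b)" unfolding xd f_def using suf_cat_deg assms y by simp
    finally show "\<exists>c. b \<le> c \<and> shift ?d x (0, c) = y (0, c)" by blast
  qed
  moreover have "x' = x" if "x' \<in> inf_paths \<Lambda>" "x' (0, ?d) = \<kappa>" "shift ?d x' = y" for x'
  proof (rule inf_path_eqI[OF that(1) x])
    fix b
    have "x' (0, ?d + b) = x' (0, ?d) \<cdot> x' (?d, ?d + b)"
      using inf_pathsD(4)[OF that(1), of 0 ?d "?d + b"] by simp
    also have "x' (?d, ?d + b) = y (0, b)" using that(3)[symmetric] by (simp add: shift_apply add.commute)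
    finally have "x' (0, ?d + b) = x (0, ?d + b)" unfolding xd f_def that(2) .
    then show "\<exists>c. b \<le> c \<and> x' (0, c) = x (0, c)" using vec_nat_le_add by blast
  qed
  ultimately have "inf_cat \<Lambda> \<kappa> y = x" unfolding inf_cat_def using x by (intro the_equality) blast+
  then show "inf_cat \<Lambda> \<kappa> y \<in> inf_paths \<Lambda>" "inf_cat \<Lambda> \<kappa> y (0, deg \<Lambda> \<kappa> + b) = \<kappa> \<cdot> y (0, b)"
    "shift (deg \<Lambda> \<kappa>) (inf_cat \<Lambda> \<kappa> y) = y"
    using x xd \<open>shift ?d x = y\<close> by (auto simp: f_def)
qed

end

context self_similar_action
begin

text \<open>By \<open>pre_act\<close>, the values that define \<open>inf_act\<close> are the
  segments of the paths \<open>g \<star> x (0, b)\<close>, and these form a coherent family.\<close>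

lemma inf_act:
  assumes "g \<in> elems G" "x \<in> inf_paths \<Lambda>" "x (0, 0) = gdom G g"
  shows "inf_act G \<Lambda> g x \<in> inf_paths \<Lambda>"
    and "inf_act G \<Lambda> g x (0, b) = g \<star> x (0, b)"
    and "inf_act G \<Lambda> g x (0, 0) = gcod G g"
proof -
  note x = inf_pathsD[OF assms(2)] inf_path_rng[OF assms(2), unfolded assms(3)]
  have gx: "g \<star> x (0, b) \<in> paths \<Lambda>" "deg \<Lambda> (g \<star> x (0, b)) = b" for b
    using x assms by auto
  have pre: "pre \<Lambda> b (g \<star> x (0, c)) = g \<star> x (0, b)" if "b \<le> c" for b c
    using pre_act(1)[of g "x (0, c)" b] inf_path_segment_0(1)[OF assms(2) that] x assms that by simp
  have "inf_act G \<Lambda> g x = restrict (\<lambda>(a, b). suf \<Lambda> a (pre \<Lambda> b (g \<star> x (0, b)))) Omega"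
  proof (rule ext)
    fix ab :: "(nat ^ 'k) \<times> (nat ^ 'k)"
    obtain a b where ab: "ab = (a, b)" by (cases ab)
    show "inf_act G \<Lambda> g x ab = restrict (\<lambda>(a, b). suf \<Lambda> a (pre \<Lambda> b (g \<star> x (0, b)))) Omega ab"
    proof (cases "a \<le> b")
      case True
      then show ?thesis
        using pre_act(2)[of g "x (0, b)" a] inf_path_segment_0[OF assms(2) True] x assms pre[of b b]
        by (simp add: ab inf_act_def Omega_def)
    next
      case False
      then show ?thesis by (simp add: ab inf_act_def Omega_def)
    qed
  qed
  moreover have "restrict (\<lambda>(a, b). suf \<Lambda> a (pre \<Lambda> b (g \<star> x (0, b)))) Omega \<in> inf_paths \<Lambda>"
    by (rule inf_path_limit) (simp_all add: gx pre)
  ultimately show i: "inf_act G \<Lambda> g x \<in> inf_paths \<Lambda>" by simp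
  show i0: "inf_act G \<Lambda> g x (0, b) = g \<star> x (0, b)" for b
    using restr_vertex assms by (simp add: inf_act_def Omega_def)
  show "inf_act G \<Lambda> g x (0, 0) = gcod G g" using i0[of 0] act_vertex assms by simp
qed

end

section \<open>Infinite paths and the finite form of periodicity\<close>

context connected_action
begin

lemma inf_path_at_vertex:
  assumes "v \<in> verts \<Lambda>"
  shows "\<exists>x \<in> inf_paths \<Lambda>. x (0, 0) = v"
proof -
  define D :: "nat \<Rightarrow> nat ^ 'k" where "D j = (\<chi> i. j)" for j
  have D0: "D 0 = 0" by (simp add: D_def vec_eq_iff)
  have D: "D (Suc j) = D j + D 1" for j by (simp add: D_def vec_eq_iff)
  have "\<exists>c. \<forall>j. (c j \<in> paths \<Lambda> \<and> rng \<Lambda> (c j) = v \<and> deg \<Lambda> (c j) = D j) \<and>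
     pre \<Lambda> (D j) (c (Suc j)) = c j"
  proof (rule dependent_nat_choice)
    show "\<exists>x. x \<in> paths \<Lambda> \<and> rng \<Lambda> x = v \<and> deg \<Lambda> x = D 0"
      using assms deg_verts rng_src_verts D0 by auto
    fix \<kappa> j assume \<kappa>: "\<kappa> \<in> paths \<Lambda> \<and> rng \<Lambda> \<kappa> = v \<and> deg \<Lambda> \<kappa> = D j"
    obtain \<epsilon> where \<epsilon>: "\<epsilon> \<in> paths \<Lambda>" "rng \<Lambda> \<epsilon> = src \<Lambda> \<kappa>" "deg \<Lambda> \<epsilon> = D 1"
      using path_of_degree_exists src_in_verts \<kappa> by blast
    have "(\<kappa> \<cdot> \<epsilon> \<in> paths \<Lambda> \<and> rng \<Lambda> (\<kappa> \<cdot> \<epsilon>) = v \<and> deg \<Lambda> (\<kappa> \<cdot> \<epsilon>) = D (Suc j)) \<and> pre \<Lambda> (D j) (\<kappa> \<cdot> \<epsilon>) = \<kappa>"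
      unfolding D using cat_closed rng_cat deg_cat pre_cat_deg \<kappa> \<epsilon> by simp
    then show "\<exists>y. (y \<in> paths \<Lambda> \<and> rng \<Lambda> y = v \<and> deg \<Lambda> y = D (Suc j)) \<and> pre \<Lambda> (D j) y = \<kappa>" by blast
  qed
  then obtain c where c: "\<And>j. c j \<in> paths \<Lambda>" "\<And>j. rng \<Lambda> (c j) = v" "\<And>j. deg \<Lambda> (c j) = D j"
    "\<And>j. pre \<Lambda> (D j) (c (Suc j)) = c j" by blast
  have Dmono: "D i \<le> D j" if "i \<le> j" for i j using that by (simp add: D_def less_eq_vec_def)
  have pc: "pre \<Lambda> (D i) (c j) = c i" if "i \<le> j" for i j using that
  proof (induction rule: dec_induct)
    case base
    then show ?case using pre_deg[OF c(1)[of i]] c(3) by simp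
  next
    case (step j)
    have "pre \<Lambda> (D i) (c (Suc j)) = pre \<Lambda> (D i) (pre \<Lambda> (D j) (c (Suc j)))"
      using pre_pre[OF c(1), of "D i" "D j" "Suc j"] c(3) Dmono step(1) by simp
    then show ?case using c(4) step by simp
  qed
  \<comment> \<open>The coordinate sum is a convenient index: its diagonal degree dominates b, and
    it is monotone in b.\<close>
  define f where "f b = c (\<Sum>i\<in>UNIV. b $ i)" for b :: "nat ^ 'k"
  have le: "b \<le> D (\<Sum>i\<in>UNIV. b $ i)" for b
    unfolding less_eq_vec_def D_def by (auto intro: member_le_sum)
  define x where "x = restrict (\<lambda>(a, b). suf \<Lambda> a (pre \<Lambda> b (f b))) Omega"
  have "x \<in> inf_paths \<Lambda>" unfolding x_def
  proof (rule inf_path_limit)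
    fix b d :: "nat ^ 'k" assume bd: "b \<le> d"
    have s: "(\<Sum>i\<in>UNIV. b $ i) \<le> (\<Sum>i\<in>UNIV. d $ i)" using bd by (intro sum_mono) (simp add: less_eq_vec_def)
    have "pre \<Lambda> b (f d) = pre \<Lambda> b (pre \<Lambda> (D (\<Sum>i\<in>UNIV. b $ i)) (f d))"
      using pre_pre[OF c(1) le[of b]] c(3) Dmono[OF s] by (simp add: f_def)
    also have "\<dots> = pre \<Lambda> b (f b)" unfolding f_def using pc[OF s] by simp
    finally show "pre \<Lambda> b (f d) = pre \<Lambda> b (f b)" .
  qed (use c le in \<open>auto simp: f_def\<close>)
  moreover have "x (0, 0) = v" using c pre_0 suf_0 assms deg_verts by (simp add: x_def Omega_def f_def)
  ultimately show ?thesis by blast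
qed

lemma inf_path_extending:
  assumes "\<nu> \<in> paths \<Lambda>"
  obtains x where "x \<in> inf_paths \<Lambda>" "x (0, 0) = rng \<Lambda> \<nu>" "x (0, deg \<Lambda> \<nu>) = \<nu>"
proof -
  obtain y where y: "y \<in> inf_paths \<Lambda>" "y (0, 0) = src \<Lambda> \<nu>"
    using inf_path_at_vertex src_in_verts assms by blast
  note i = inf_cat[OF assms y]
  have "inf_cat \<Lambda> \<nu> y (0, deg \<Lambda> \<nu>) = \<nu>" using i(2)[of 0] y cat_src assms by simp
  moreover from this have "inf_cat \<Lambda> \<nu> y (0, 0) = rng \<Lambda> \<nu>" using inf_path_rng[OF i(1)] by metis
  ultimately show thesis using that i(1) by blast
qed

text \<open>Forwards, agreement along \<open>x (0, b)\<close> determines both infinite paths up to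
  degree b, for every b. Backwards, every finite \<nu> is an initial segment of some infinite path,
  from which the agreement is read off.\<close>

lemma periodic_iff_inf:
  assumes "\<kappa> \<in> paths \<Lambda>" "\<mu> \<in> paths \<Lambda>" "g \<in> elems G" "gcod G g = src \<Lambda> \<kappa>" "gdom G g = src \<Lambda> \<mu>"
  shows "periodic \<kappa> g \<mu> \<longleftrightarrow>
    (\<forall>x \<in> inf_paths_from \<Lambda> (gdom G g). inf_cat \<Lambda> \<kappa> (inf_act G \<Lambda> g x) = inf_cat \<Lambda> \<mu> x)"
proof
  assume per: "periodic \<kappa> g \<mu>"
  show "\<forall>x \<in> inf_paths_from \<Lambda> (gdom G g). inf_cat \<Lambda> \<kappa> (inf_act G \<Lambda> g x) = inf_cat \<Lambda> \<mu> x"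
  proof
    fix x assume "x \<in> inf_paths_from \<Lambda> (gdom G g)"
    then have x: "x \<in> inf_paths \<Lambda>" "x (0, 0) = gdom G g" by (auto simp: inf_paths_from_def)
    note a = inf_act[OF assms(3) x]
    note X = inf_cat[OF assms(1) a(1) a(3)[unfolded assms(4)]]
    note Y = inf_cat[OF assms(2) x(1) x(2)[unfolded assms(5)]]
    show "inf_cat \<Lambda> \<kappa> (inf_act G \<Lambda> g x) = inf_cat \<Lambda> \<mu> x"
    proof (rule inf_path_eqI[OF X(1) Y(1)])
      fix b
      have xb: "x (0, b) \<in> paths \<Lambda>" "rng \<Lambda> (x (0, b)) = src \<Lambda> \<mu>" "deg \<Lambda> (x (0, b)) = b"
        using inf_pathsD[OF x(1)] inf_path_rng[OF x(1)] x assms by auto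
      have "pre \<Lambda> b (\<kappa> \<cdot> (g \<star> x (0, b))) = pre \<Lambda> b (\<mu> \<cdot> x (0, b))"
        by (rule agreeD[OF periodicD(6)[OF per]]) (use xb assms deg_cat in auto)
      moreover have "inf_cat \<Lambda> \<kappa> (inf_act G \<Lambda> g x) (0, b) = pre \<Lambda> b (\<kappa> \<cdot> (g \<star> x (0, b)))"
        using inf_path_segment_0(1)[OF X(1), of b "deg \<Lambda> \<kappa> + b"] X(2)[of b] a(2)[of b] by simp
      moreover have "inf_cat \<Lambda> \<mu> x (0, b) = pre \<Lambda> b (\<mu> \<cdot> x (0, b))"
        using inf_path_segment_0(1)[OF Y(1), of b "deg \<Lambda> \<mu> + b"] Y(2)[of b] by simp
      ultimately show "\<exists>c. b \<le> c \<and> inf_cat \<Lambda> \<kappa> (inf_act G \<Lambda> g x) (0, c) = inf_cat \<Lambda> \<mu> x (0, c)" by auto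
    qed
  qed
next
  assume inf: "\<forall>x \<in> inf_paths_from \<Lambda> (gdom G g). inf_cat \<Lambda> \<kappa> (inf_act G \<Lambda> g x) = inf_cat \<Lambda> \<mu> x"
  have "agree \<Lambda> (\<kappa> \<cdot> (g \<star> \<nu>)) (\<mu> \<cdot> \<nu>)" if \<nu>: "\<nu> \<in> paths \<Lambda>" "rng \<Lambda> \<nu> = src \<Lambda> \<mu>" for \<nu>
  proof -
    obtain x where x: "x \<in> inf_paths \<Lambda>" "x (0, 0) = gdom G g" "x (0, deg \<Lambda> \<nu>) = \<nu>"
      using inf_path_extending \<nu> assms by metis
    note a = inf_act[OF assms(3) x(1,2)]
    note X = inf_cat[OF assms(1) a(1) a(3)[unfolded assms(4)]]
    note Y = inf_cat[OF assms(2) x(1) x(2)[unfolded assms(5)]]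
    have eq: "inf_cat \<Lambda> \<kappa> (inf_act G \<Lambda> g x) = inf_cat \<Lambda> \<mu> x" using inf x by (auto simp: inf_paths_from_def)
    have d: "deg \<Lambda> (\<kappa> \<cdot> (g \<star> \<nu>)) = deg \<Lambda> \<kappa> + deg \<Lambda> \<nu>" "deg \<Lambda> (\<mu> \<cdot> \<nu>) = deg \<Lambda> \<mu> + deg \<Lambda> \<nu>"
      using deg_cat \<nu> assms by auto
    show ?thesis unfolding agree_def
    proof (intro allI impI, elim conjE)
      fix m assume m: "m \<le> deg \<Lambda> (\<kappa> \<cdot> (g \<star> \<nu>))" "m \<le> deg \<Lambda> (\<mu> \<cdot> \<nu>)"
      show "pre \<Lambda> m (\<kappa> \<cdot> (g \<star> \<nu>)) = pre \<Lambda> m (\<mu> \<cdot> \<nu>)"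
        using X(2)[of "deg \<Lambda> \<nu>"] Y(2)[of "deg \<Lambda> \<nu>"] a(2)[of "deg \<Lambda> \<nu>"] x(3)
          inf_path_segment_0(1)[OF X(1) m(1)[unfolded d]] inf_path_segment_0(1)[OF Y(1) m(2)[unfolded d]] eq
        by simp
    qed
  qed
  then show "periodic \<kappa> g \<mu>" unfolding periodic_def using assms by simp
qed

text \<open>The definition of \<open>Per\<close> equates tails, whereas \<open>periodic\<close>
  compares whole paths. For a path \<nu> of degree p + q, dropping q from
  \<open>g \<star> \<nu>\<close> and p from \<nu> leaves segments of degrees p and q, and these form
  a periodic triple with \<open>g \<restriction> \<nu>\<close>. Conversely, shifting
  \<open>\<kappa>(g \<cdot> x) = \<mu>x\<close> by
  \<open>deg \<Lambda> \<kappa> + deg \<Lambda> \<mu>\<close> gives the equality of tails.\<close>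

lemma Per_iff:
  "n \<in> Per G \<Lambda> \<longleftrightarrow> (\<exists>\<kappa> g \<mu>. periodic \<kappa> g \<mu> \<and> vec_int (deg \<Lambda> \<kappa>) - vec_int (deg \<Lambda> \<mu>) = n)"
proof
  assume "n \<in> Per G \<Lambda>"
  then obtain p q g where n: "n = vec_int p - vec_int q" and g: "g \<in> elems G"
    and sh: "\<And>x. x \<in> inf_paths_from \<Lambda> (gdom G g) \<Longrightarrow> shift p x = shift q (inf_act G \<Lambda> g x)"
    by (auto simp: Per_def)
  obtain \<nu> where \<nu>: "\<nu> \<in> paths \<Lambda>" "rng \<Lambda> \<nu> = gdom G g" "deg \<Lambda> \<nu> = p + q"
    using path_of_degree_exists gdom_closed g by blast
  have le: "q \<le> deg \<Lambda> (g \<star> \<nu>)" "p \<le> deg \<Lambda> \<nu>" using \<nu> g by auto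
  note \<alpha> = pre_suf[OF act_simps(1)[OF g \<nu>(1,2)] le(1)]
  note \<beta> = pre_suf[OF \<nu>(1) le(2)]
  have "periodic (suf \<Lambda> q (g \<star> \<nu>)) (g \<restriction> \<nu>) (suf \<Lambda> p \<nu>)"
    unfolding periodic_def
  proof (intro conjI ballI impI)
    show "suf \<Lambda> q (g \<star> \<nu>) \<in> paths \<Lambda>" "suf \<Lambda> p \<nu> \<in> paths \<Lambda>" "g \<restriction> \<nu> \<in> elems G"
      "gcod G (g \<restriction> \<nu>) = src \<Lambda> (suf \<Lambda> q (g \<star> \<nu>))" "gdom G (g \<restriction> \<nu>) = src \<Lambda> (suf \<Lambda> p \<nu>)"
      using \<alpha> \<beta> g \<nu> by auto
    fix y assume y: "y \<in> paths \<Lambda>" "rng \<Lambda> y = src \<Lambda> (suf \<Lambda> p \<nu>)"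
    then have yr: "rng \<Lambda> y = src \<Lambda> \<nu>" using \<beta> by simp
    have \<nu>y: "\<nu> \<cdot> y \<in> paths \<Lambda>" "rng \<Lambda> (\<nu> \<cdot> y) = gdom G g" "deg \<Lambda> (\<nu> \<cdot> y) = p + q + deg \<Lambda> y"
      using \<nu> y yr cat_closed rng_cat deg_cat by auto
    obtain x where x: "x \<in> inf_paths \<Lambda>" "x (0, 0) = gdom G g" "x (0, p + q + deg \<Lambda> y) = \<nu> \<cdot> y"
      using inf_path_extending \<nu>y by metis
    let ?D = "p + q + deg \<Lambda> y" and ?z = "inf_act G \<Lambda> g x"
    have D: "p \<le> ?D" "q \<le> ?D" by (auto simp: less_eq_vec_def)
    note a = inf_act[OF g x(1,2)]
    have 1: "suf \<Lambda> p \<nu> \<cdot> y = x (p, ?D)"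
      using pre_suf_cat_le(2)[of \<nu> y p] inf_path_segment_0(2)[OF x(1) D(1)] x(3) \<nu> y yr by simp
    have "suf \<Lambda> q (g \<star> \<nu>) \<cdot> (g \<restriction> \<nu> \<star> y) = suf \<Lambda> q ((g \<star> \<nu>) \<cdot> (g \<restriction> \<nu> \<star> y))"
      using pre_suf_cat_le(2)[of "g \<star> \<nu>" "g \<restriction> \<nu> \<star> y" q] le g \<nu> y yr by simp
    also have "\<dots> = suf \<Lambda> q (?z (0, ?D))" using act_cat[of g \<nu> y] g \<nu> y yr a(2)[of ?D] x(3) by simp
    finally have 2: "suf \<Lambda> q (g \<star> \<nu>) \<cdot> (g \<restriction> \<nu> \<star> y) = ?z (q, ?D)" using inf_path_segment_0(2)[OF a(1) D(2)] by simp
    show "agree \<Lambda> (suf \<Lambda> q (g \<star> \<nu>) \<cdot> (g \<restriction> \<nu> \<star> y)) (suf \<Lambda> p \<nu> \<cdot> y)" unfolding 1 2 agree_def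
    proof (intro allI impI, elim conjE)
      fix m assume m: "m \<le> deg \<Lambda> (?z (q, ?D))" "m \<le> deg \<Lambda> (x (p, ?D))"
      then have m': "m + q \<le> ?D" "m + p \<le> ?D"
        using inf_pathsD(2)[OF a(1) D(2)] inf_pathsD(2)[OF x(1) D(1)] D
        by (auto simp: less_eq_vec_def le_diff_conv2)
      have "shift p x (0, m) = shift q ?z (0, m)" using sh x by (simp add: inf_paths_from_def)
      then have "x (p, m + p) = ?z (q, m + q)" by (simp add: shift_apply)
      moreover have "pre \<Lambda> m (x (p, ?D)) = x (p, m + p)"
        using inf_path_segment(1)[OF x(1) _ m'(2), of p] by simp
      moreover have "pre \<Lambda> m (?z (q, ?D)) = ?z (q, m + q)"
        using inf_path_segment(1)[OF a(1) _ m'(1), of q] by simp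
      ultimately show "pre \<Lambda> m (?z (q, ?D)) = pre \<Lambda> m (x (p, ?D))" by simp
    qed
  qed
  moreover have "vec_int (deg \<Lambda> (suf \<Lambda> q (g \<star> \<nu>))) - vec_int (deg \<Lambda> (suf \<Lambda> p \<nu>)) = n"
    unfolding n \<alpha> \<beta> using \<nu> g by simp
  ultimately show "\<exists>\<kappa> g \<mu>. periodic \<kappa> g \<mu> \<and> vec_int (deg \<Lambda> \<kappa>) - vec_int (deg \<Lambda> \<mu>) = n" by blast
next
  assume "\<exists>\<kappa> g \<mu>. periodic \<kappa> g \<mu> \<and> vec_int (deg \<Lambda> \<kappa>) - vec_int (deg \<Lambda> \<mu>) = n"
  then obtain \<kappa> g \<mu> where per: "periodic \<kappa> g \<mu>" and n: "n = vec_int (deg \<Lambda> \<kappa>) - vec_int (deg \<Lambda> \<mu>)" by blast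
  note p = periodicD[OF per]
  have "shift (deg \<Lambda> \<kappa>) x = shift (deg \<Lambda> \<mu>) (inf_act G \<Lambda> g x)" if "x \<in> inf_paths_from \<Lambda> (gdom G g)" for x
  proof -
    have x: "x \<in> inf_paths \<Lambda>" "x (0, 0) = gdom G g" using that by (auto simp: inf_paths_from_def)
    note a = inf_act[OF p(3) x]
    note X = inf_cat(3)[OF p(1) a(1) a(3)[unfolded p(4)]]
    note Y = inf_cat(3)[OF p(2) x(1) x(2)[unfolded p(5)]]
    have "inf_cat \<Lambda> \<kappa> (inf_act G \<Lambda> g x) = inf_cat \<Lambda> \<mu> x" using periodic_iff_inf p(1-5) per that by blast
    then show ?thesis using X Y shift_shift add.commute by metis
  qed
  then show "n \<in> Per G \<Lambda>" unfolding Per_def using p(3) n by blast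
qed

text \<open>Any periodic triple found by other means is the one that the definite description
  selects, by \<open>periodic_unique\<close>. All later values of \<open>theta\<close> and
  \<open>h_elem\<close> are computed through this lemma.\<close>

lemma theta_h_periodic:
  assumes "periodic \<kappa> h \<mu>"
  shows "theta G \<Lambda> p (deg \<Lambda> \<mu>) \<kappa> = \<mu>" "h_elem G \<Lambda> p (deg \<Lambda> \<mu>) \<kappa> = h"
proof -
  note p = periodicD[OF assms]
  have *: "(\<mu>' \<in> paths_of_degree \<Lambda> (deg \<Lambda> \<mu>) \<and> h' \<in> elems G \<and>
     gcod G h' = src \<Lambda> \<kappa> \<and> gdom G h' = src \<Lambda> \<mu>' \<and>
     (\<forall>x \<in> inf_paths_from \<Lambda> (gdom G h'). inf_cat \<Lambda> \<kappa> (inf_act G \<Lambda> h' x) = inf_cat \<Lambda> \<mu>' x)) \<longleftrightarrow>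
     deg \<Lambda> \<mu>' = deg \<Lambda> \<mu> \<and> periodic \<kappa> h' \<mu>'" for \<mu>' h'
    using periodic_iff_inf[of \<kappa> \<mu>' h'] periodicD(1-5)[of \<kappa> h' \<mu>'] p(1) by (auto simp: paths_of_degree_iff)
  have "theta_h G \<Lambda> p (deg \<Lambda> \<mu>) \<kappa> = (\<mu>, h)" unfolding theta_h_def *
  proof (rule the_equality)
    fix z assume "case z of (\<mu>', h') \<Rightarrow> deg \<Lambda> \<mu>' = deg \<Lambda> \<mu> \<and> periodic \<kappa> h' \<mu>'"
    then have "deg \<Lambda> \<mu> = deg \<Lambda> (fst z)" "periodic \<kappa> (snd z) (fst z)" by (auto simp: split_beta)
    with periodic_unique[OF assms this(2,1)] show "z = (\<mu>, h)" by (metis prod.collapse)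
  qed (use assms in simp)
  then show "theta G \<Lambda> p (deg \<Lambda> \<mu>) \<kappa> = \<mu>" "h_elem G \<Lambda> p (deg \<Lambda> \<mu>) \<kappa> = h"
    by (auto simp: theta_def h_elem_def)
qed

end

section \<open>Perron--Frobenius theory\<close>

abbreviation const_deg :: "nat \<Rightarrow> nat ^ 'k" where "const_deg l \<equiv> (\<chi> i. l)"

lemma const_deg_add: "const_deg (l + m) = const_deg l + const_deg m"
  by (simp add: vec_eq_iff)

text \<open>The restriction of \<open>rho_pow\<close> to degrees of paths. With natural exponents,
  additivity holds before the positivity of \<open>rho\<close> is known.\<close>

definition rho_deg :: "('m, 'k::finite) kgraph \<Rightarrow> nat ^ 'k \<Rightarrow> real" where
  "rho_deg \<Lambda> m = (\<Prod>i\<in>UNIV. rho \<Lambda> i ^ (m $ i))"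

lemma rho_deg_add: "rho_deg \<Lambda> (p + q) = rho_deg \<Lambda> p * rho_deg \<Lambda> q"
  by (simp add: rho_deg_def power_add prod.distrib)

lemma rho_deg_0: "rho_deg \<Lambda> 0 = 1"
  by (simp add: rho_deg_def)

lemma rho_deg_axis: "rho_deg \<Lambda> (axis i 1) = rho \<Lambda> i"
proof -
  have "rho_deg \<Lambda> (axis i 1) = (\<Prod>j\<in>UNIV. if j = i then rho \<Lambda> j else 1)"
    unfolding rho_deg_def by (rule prod.cong) (auto simp: axis_def)
  then show ?thesis by simp
qed

lemma rho_pow_uminus: "rho_pow \<Lambda> (- vec_int q) = inverse (rho_deg \<Lambda> q)"
  by (simp add: rho_pow_def rho_deg_def vec_int_def power_int_minus prod_inversef[symmetric] comp_def)

lemma sum_card_fibres: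
  fixes f :: "'b \<Rightarrow> real"
  assumes "finite A" "finite T" "g ` A \<subseteq> T"
  shows "(\<Sum>v\<in>T. real (card {a \<in> A. g a = v}) * f v) = (\<Sum>a\<in>A. f (g a))"
proof -
  have "(\<Sum>v\<in>T. real (card {a \<in> A. g a = v}) * f v) = (\<Sum>v\<in>T. \<Sum>a\<in>{a \<in> A. g a = v}. f (g a))"
    by (intro sum.cong) auto
  also have "\<dots> = (\<Sum>a\<in>A. f (g a))" using sum.group[OF assms, of "\<lambda>a. f (g a)"] by simp
  finally show ?thesis .
qed

context k_graph
begin

lemma from_deg_0: "v \<in> verts \<Lambda> \<Longrightarrow> from_deg \<Lambda> v 0 = {v}"
proof
  assume v: "v \<in> verts \<Lambda>"
  have "\<kappa> = v" if "\<kappa> \<in> paths \<Lambda>" "rng \<Lambda> \<kappa> = v" "deg \<Lambda> \<kappa> = 0" for \<kappa>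
  proof -
    have "\<kappa> \<in> verts \<Lambda>" using that by (simp add: verts_def paths_of_degree_iff)
    then show ?thesis using rng_src_verts(1) that(2) by simp
  qed
  then show "from_deg \<Lambda> v 0 \<subseteq> {v}" by (auto simp: from_deg_iff)
  show "{v} \<subseteq> from_deg \<Lambda> v 0" using deg_verts[OF v] rng_src_verts[OF v] by (simp add: from_deg_iff)
qed

lemma cat_bij_betw:
  "bij_betw (\<lambda>(\<eta>, \<nu>). \<eta> \<cdot> \<nu>) (SIGMA \<eta>:from_deg \<Lambda> v p. from_deg \<Lambda> (src \<Lambda> \<eta>) q) (from_deg \<Lambda> v (p + q))"
proof (rule bij_betw_byWitness[where f' = "\<lambda>\<zeta>. (pre \<Lambda> p \<zeta>, suf \<Lambda> p \<zeta>)"])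
  show "\<forall>a\<in>SIGMA \<eta>:from_deg \<Lambda> v p. from_deg \<Lambda> (src \<Lambda> \<eta>) q.
      (pre \<Lambda> p (case a of (\<eta>, \<nu>) \<Rightarrow> \<eta> \<cdot> \<nu>), suf \<Lambda> p (case a of (\<eta>, \<nu>) \<Rightarrow> \<eta> \<cdot> \<nu>)) = a"
    using pre_cat_deg suf_cat_deg by (auto simp: from_deg_iff)
  have *: "pre \<Lambda> p \<zeta> \<cdot> suf \<Lambda> p \<zeta> = \<zeta> \<and> pre \<Lambda> p \<zeta> \<in> from_deg \<Lambda> v p \<and> suf \<Lambda> p \<zeta> \<in> from_deg \<Lambda> (src \<Lambda> (pre \<Lambda> p \<zeta>)) q"
    if "\<zeta> \<in> from_deg \<Lambda> v (p + q)" for \<zeta>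
    using pre_suf[of \<zeta> p] that by (simp add: from_deg_iff)
  show "\<forall>a'\<in>from_deg \<Lambda> v (p + q). (case (pre \<Lambda> p a', suf \<Lambda> p a') of (\<eta>, \<nu>) \<Rightarrow> \<eta> \<cdot> \<nu>) = a'"
    "(\<lambda>\<zeta>. (pre \<Lambda> p \<zeta>, suf \<Lambda> p \<zeta>)) ` from_deg \<Lambda> v (p + q) \<subseteq> (SIGMA \<eta>:from_deg \<Lambda> v p. from_deg \<Lambda> (src \<Lambda> \<eta>) q)"
    using * by auto
  show "(\<lambda>(\<eta>, \<nu>). \<eta> \<cdot> \<nu>) ` (SIGMA \<eta>:from_deg \<Lambda> v p. from_deg \<Lambda> (src \<Lambda> \<eta>) q) \<subseteq> from_deg \<Lambda> v (p + q)"
    using cat_closed rng_cat deg_cat by (auto simp: from_deg_iff)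
qed

end

locale finite_k_graph = k_graph +
  assumes finite_graph: "finite_kgraph \<Lambda>"
begin

lemma finite_paths_of_degree: "finite (paths_of_degree \<Lambda> p)"
  using finite_graph by (simp add: finite_kgraph_def)

lemma finite_from_deg: "finite (from_deg \<Lambda> v p)"
  using finite_paths_of_degree by (simp add: from_deg_def)

lemma finite_verts: "finite (verts \<Lambda>)"
  using finite_paths_of_degree by (simp add: verts_def)

lemma sum_from_deg_add:
  "(\<Sum>\<zeta>\<in>from_deg \<Lambda> v (p + q). f \<zeta>) = (\<Sum>\<eta>\<in>from_deg \<Lambda> v p. \<Sum>\<nu>\<in>from_deg \<Lambda> (src \<Lambda> \<eta>) q. f (\<eta> \<cdot> \<nu>))"
proof -
  have "(\<Sum>\<zeta>\<in>from_deg \<Lambda> v (p + q). f \<zeta>) =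
      (\<Sum>a\<in>(SIGMA \<eta>:from_deg \<Lambda> v p. from_deg \<Lambda> (src \<Lambda> \<eta>) q). f (case a of (\<eta>, \<nu>) \<Rightarrow> \<eta> \<cdot> \<nu>))"
    by (rule sum.reindex_bij_betw[OF cat_bij_betw, symmetric])
  also have "\<dots> = (\<Sum>\<eta>\<in>from_deg \<Lambda> v p. \<Sum>\<nu>\<in>from_deg \<Lambda> (src \<Lambda> \<eta>) q. f (\<eta> \<cdot> \<nu>))"
    by (subst sum.Sigma) (auto simp: finite_from_deg split_beta)
  finally show ?thesis .
qed

lemma sum_paths_of_degree: "(\<Sum>\<kappa>\<in>paths_of_degree \<Lambda> p. f \<kappa>) = (\<Sum>v\<in>verts \<Lambda>. \<Sum>\<kappa>\<in>from_deg \<Lambda> v p. f \<kappa>)"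
proof -
  have "(\<Sum>v\<in>verts \<Lambda>. sum f {\<kappa> \<in> paths_of_degree \<Lambda> p. rng \<Lambda> \<kappa> = v}) = sum f (paths_of_degree \<Lambda> p)"
    by (rule sum.group) (auto simp: finite_paths_of_degree finite_verts paths_of_degree_iff intro: rng_in_verts)
  moreover have "{\<kappa> \<in> paths_of_degree \<Lambda> p. rng \<Lambda> \<kappa> = v} = from_deg \<Lambda> v p" for v
    by (auto simp: from_deg_iff paths_of_degree_iff)
  ultimately show ?thesis by simp
qed

end

locale pf_action = connected_action G \<Lambda> + finite_k_graph \<Lambda>
  for G :: "('g, 'm) acting_groupoid" and \<Lambda> :: "('m, 'k::finite) kgraph" +
  fixes x :: "'m \<Rightarrow> real"
  assumes finite_states: "finite_state G \<Lambda>"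
    and pf: "unimodular_PF_eigenvector \<Lambda> x"
begin

lemma x_pos: "v \<in> verts \<Lambda> \<Longrightarrow> x v > 0"
  and x_sum: "(\<Sum>v\<in>verts \<Lambda>. x v) = 1"
  using pf by (auto simp: unimodular_PF_eigenvector_def)

lemma x_le_1: "v \<in> verts \<Lambda> \<Longrightarrow> x v \<le> 1"
  using member_le_sum[of v "verts \<Lambda>" x] x_pos x_sum finite_verts by (auto intro: less_imp_le)

lemma verts_nonempty: "verts \<Lambda> \<noteq> {}"
  using x_sum by auto

lemma x_edge: 
  assumes "v \<in> verts \<Lambda>"
  shows "(\<Sum>e\<in>from_deg \<Lambda> v (axis i 1). x (src \<Lambda> e)) = rho \<Lambda> i * x v"
proof -
  have "rho \<Lambda> i * x v = (\<Sum>w\<in>verts \<Lambda>. real (vertex_matrix \<Lambda> i v w) * x w)"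
    using pf assms by (simp add: unimodular_PF_eigenvector_def)
  also have "\<dots> = (\<Sum>w\<in>verts \<Lambda>. real (card {e \<in> from_deg \<Lambda> v (axis i 1). src \<Lambda> e = w}) * x w)"
  proof -
    have "{\<kappa> \<in> paths_of_degree \<Lambda> (axis i 1). rng \<Lambda> \<kappa> = v \<and> src \<Lambda> \<kappa> = w} =
        {e \<in> from_deg \<Lambda> v (axis i 1). src \<Lambda> e = w}" for w
      by (auto simp: from_deg_iff paths_of_degree_iff)
    then show ?thesis by (simp add: vertex_matrix_def)
  qed
  also have "\<dots> = (\<Sum>e\<in>from_deg \<Lambda> v (axis i 1). x (src \<Lambda> e))"
    by (rule sum_card_fibres) (auto simp: finite_from_deg finite_verts from_deg_iff intro: src_in_verts)
  finally show ?thesis ..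
qed

lemma from_deg_nonempty: "v \<in> verts \<Lambda> \<Longrightarrow> from_deg \<Lambda> v p \<noteq> {}"
  using path_of_degree_exists[of v p] by (auto simp: from_deg_iff)

text \<open>Read off the eigenvector equation at one vertex: its left side is a nonempty sum of
  positive terms.\<close>

lemma rho_pos: "rho \<Lambda> i > 0"
proof -
  obtain v where v: "v \<in> verts \<Lambda>" using verts_nonempty by blast
  have "0 < (\<Sum>e\<in>from_deg \<Lambda> v (axis i 1). x (src \<Lambda> e))"
    by (rule sum_pos) (auto simp: finite_from_deg from_deg_nonempty v from_deg_iff intro: x_pos src_in_verts)
  then show ?thesis using x_edge[OF v] x_pos[OF v] by (simp add: zero_less_mult_iff)
qed

lemma rho_deg_pos: "rho_deg \<Lambda> m > 0"
  unfolding rho_deg_def by (intro prod_pos) (simp add: rho_pos)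

lemma x_from_deg:
  assumes "v \<in> verts \<Lambda>"
  shows "(\<Sum>\<zeta>\<in>from_deg \<Lambda> v m. x (src \<Lambda> \<zeta>)) = rho_deg \<Lambda> m * x v"
  using assms
proof (induction m arbitrary: v rule: vec_nat_induct)
  case zero
  then show ?case by (simp add: from_deg_0 rng_src_verts rho_deg_0)
next
  case (add p i)
  have "(\<Sum>\<zeta>\<in>from_deg \<Lambda> v (axis i 1 + p). x (src \<Lambda> \<zeta>)) =
     (\<Sum>e\<in>from_deg \<Lambda> v (axis i 1). \<Sum>\<nu>\<in>from_deg \<Lambda> (src \<Lambda> e) p. x (src \<Lambda> \<nu>))"
    unfolding sum_from_deg_add by (intro sum.cong) (auto simp: from_deg_iff src_cat)
  also have "\<dots> = (\<Sum>e\<in>from_deg \<Lambda> v (axis i 1). rho_deg \<Lambda> p * x (src \<Lambda> e))"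
    by (intro sum.cong refl add.IH) (auto simp: from_deg_iff src_in_verts)
  also have "\<dots> = rho_deg \<Lambda> p * (rho \<Lambda> i * x v)"
    by (simp only: sum_distrib_left[symmetric] x_edge[OF add.prems])
  finally show ?case
    by (simp only: rho_deg_add rho_deg_axis ac_simps)
qed

text \<open>Subtracting from a real joint eigenvector the largest multiple of \<open>x\<close> below it leaves a
  nonnegative eigenvector with a zero, which vanishes by strong connectedness.\<close>

lemma pf_unique_real:
  fixes z :: "'m \<Rightarrow> real"
  assumes z: "\<And>v m. v \<in> verts \<Lambda> \<Longrightarrow> (\<Sum>\<zeta>\<in>from_deg \<Lambda> v m. z (src \<Lambda> \<zeta>)) = rho_deg \<Lambda> m * z v"
  shows "\<exists>c. \<forall>v \<in> verts \<Lambda>. z v = c * x v"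
proof -
  define c where "c = Min ((\<lambda>v. z v / x v) ` verts \<Lambda>)"
  have fin: "finite ((\<lambda>v. z v / x v) ` verts \<Lambda>)" "(\<lambda>v. z v / x v) ` verts \<Lambda> \<noteq> {}"
    using finite_verts verts_nonempty by auto
  obtain w where w: "w \<in> verts \<Lambda>" "z w / x w = c" using Min_in[OF fin] by (auto simp: c_def)
  define y where "y v = z v - c * x v" for v
  have y0: "y w = 0" using w x_pos[OF w(1)] by (auto simp: y_def field_simps)
  have ynn: "y v \<ge> 0" if "v \<in> verts \<Lambda>" for v
  proof -
    have "c \<le> z v / x v" unfolding c_def using fin that by simp
    then show ?thesis using x_pos[OF that] by (simp add: y_def field_simps)
  qed
  have "y v = 0" if v: "v \<in> verts \<Lambda>" for v
  proof -
    obtain \<kappa> where \<kappa>: "\<kappa> \<in> paths \<Lambda>" "rng \<Lambda> \<kappa> = w" "src \<Lambda> \<kappa> = v" using connecting_path w v by blast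
    have "(\<Sum>\<zeta>\<in>from_deg \<Lambda> w (deg \<Lambda> \<kappa>). y (src \<Lambda> \<zeta>)) = rho_deg \<Lambda> (deg \<Lambda> \<kappa>) * y w"
      using z[OF w(1)] x_from_deg[OF w(1)]
      by (simp add: y_def sum_subtractf sum_distrib_left[symmetric] algebra_simps)
    then have "(\<Sum>\<zeta>\<in>from_deg \<Lambda> w (deg \<Lambda> \<kappa>). y (src \<Lambda> \<zeta>)) = 0" using y0 by simp
    moreover have "\<forall>\<zeta>\<in>from_deg \<Lambda> w (deg \<Lambda> \<kappa>). y (src \<Lambda> \<zeta>) \<ge> 0"
      using ynn src_in_verts by (auto simp: from_deg_iff)
    ultimately have "\<forall>\<zeta>\<in>from_deg \<Lambda> w (deg \<Lambda> \<kappa>). y (src \<Lambda> \<zeta>) = 0"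
      using sum_nonneg_eq_0_iff[OF finite_from_deg, of w "deg \<Lambda> \<kappa>" "\<lambda>\<zeta>. y (src \<Lambda> \<zeta>)"] by blast
    moreover have "\<kappa> \<in> from_deg \<Lambda> w (deg \<Lambda> \<kappa>)" using \<kappa> by (simp add: from_deg_iff)
    ultimately show ?thesis using \<kappa> by blast
  qed
  then show ?thesis by (auto simp: y_def)
qed

text \<open>The eigenvalues are real, so real and imaginary parts can be treated separately. The
  constant is identified by summing over the vertices, since x has unit 1-norm.\<close>

lemma pf_unique:
  fixes z :: "'m \<Rightarrow> complex"
  assumes z: "\<And>v m. v \<in> verts \<Lambda> \<Longrightarrow> (\<Sum>\<zeta>\<in>from_deg \<Lambda> v m. z (src \<Lambda> \<zeta>)) = of_real (rho_deg \<Lambda> m) * z v"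
  assumes "v \<in> verts \<Lambda>"
  shows "z v = (\<Sum>w\<in>verts \<Lambda>. z w) * of_real (x v)"
proof -
  have "\<exists>c. \<forall>v \<in> verts \<Lambda>. Re (z v) = c * x v"
  proof (rule pf_unique_real)
    fix v m assume "v \<in> verts \<Lambda>"
    from arg_cong[OF z[OF this, of m], of Re]
    show "(\<Sum>\<zeta>\<in>from_deg \<Lambda> v m. Re (z (src \<Lambda> \<zeta>))) = rho_deg \<Lambda> m * Re (z v)" by simp
  qed
  then obtain a where a: "\<And>v. v \<in> verts \<Lambda> \<Longrightarrow> Re (z v) = a * x v" by blast
  have "\<exists>c. \<forall>v \<in> verts \<Lambda>. Im (z v) = c * x v"
  proof (rule pf_unique_real)
    fix v m assume "v \<in> verts \<Lambda>"
    from arg_cong[OF z[OF this, of m], of Im]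
    show "(\<Sum>\<zeta>\<in>from_deg \<Lambda> v m. Im (z (src \<Lambda> \<zeta>))) = rho_deg \<Lambda> m * Im (z v)" by simp
  qed
  then obtain b where b: "\<And>v. v \<in> verts \<Lambda> \<Longrightarrow> Im (z v) = b * x v" by blast
  have zc: "z v = Complex a b * of_real (x v)" if "v \<in> verts \<Lambda>" for v
    using a[OF that] b[OF that] by (simp add: complex_eq_iff)
  then have "(\<Sum>w\<in>verts \<Lambda>. z w) = Complex a b * of_real (\<Sum>w\<in>verts \<Lambda>. x w)"
    by (simp add: sum_distrib_left)
  then show ?thesis using zc[OF assms(2)] x_sum by simp
qed


subsection \<open>Weights of hereditary sets of paths\<close>

text \<open>Since there are only finitely many states, every path in \<open>B\<close> can leave \<open>B\<close> by an extension of one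
  fixed degree; this removes a fixed proportion of the weight of \<open>B\<close>.\<close>

lemma weight_tendsto_0:
  fixes B :: "'m \<Rightarrow> bool" and st :: "'m \<Rightarrow> 's"
  assumes v: "v \<in> verts \<Lambda>"
    and fin: "finite (st ` {\<nu> \<in> paths_from \<Lambda> v. B \<nu>})"
    and hereditary: "\<And>\<nu> \<nu>'. \<lbrakk>\<nu> \<in> paths \<Lambda>; rng \<Lambda> \<nu> = v; \<nu>' \<in> paths \<Lambda>; rng \<Lambda> \<nu>' = src \<Lambda> \<nu>; B (\<nu> \<cdot> \<nu>')\<rbrakk> \<Longrightarrow> B \<nu>"
    and escape: "\<And>\<nu>. \<lbrakk>\<nu> \<in> paths \<Lambda>; rng \<Lambda> \<nu> = v; B \<nu>\<rbrakk> \<Longrightarrow> \<exists>\<nu>' \<in> paths \<Lambda>. rng \<Lambda> \<nu>' = src \<Lambda> \<nu> \<and> \<not> B (\<nu> \<cdot> \<nu>')"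
    and state: "\<And>\<nu> \<mu> \<nu>'. \<lbrakk>\<nu> \<in> paths \<Lambda>; rng \<Lambda> \<nu> = v; B \<nu>; \<mu> \<in> paths \<Lambda>; rng \<Lambda> \<mu> = v; B \<mu>; st \<nu> = st \<mu>;
        \<nu>' \<in> paths \<Lambda>; rng \<Lambda> \<nu>' = src \<Lambda> \<nu>\<rbrakk> \<Longrightarrow> rng \<Lambda> \<nu>' = src \<Lambda> \<mu> \<and> (B (\<mu> \<cdot> \<nu>') \<longrightarrow> B (\<nu> \<cdot> \<nu>'))"
  shows "(\<lambda>l. inverse (rho_deg \<Lambda> (const_deg l)) *
    (\<Sum>\<nu>\<in>{\<nu> \<in> from_deg \<Lambda> v (const_deg l). B \<nu>}. x (src \<Lambda> \<nu>))) \<longlonglongrightarrow> 0"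
proof -
  define S where "S = st ` {\<nu> \<in> paths_from \<Lambda> v. B \<nu>}"
  have "\<forall>s\<in>S. \<exists>e \<in> paths \<Lambda>. \<forall>\<mu>. \<mu> \<in> paths \<Lambda> \<and> rng \<Lambda> \<mu> = v \<and> B \<mu> \<and> st \<mu> = s \<longrightarrow> rng \<Lambda> e = src \<Lambda> \<mu> \<and> \<not> B (\<mu> \<cdot> e)"
  proof
    fix s assume "s \<in> S"
    then obtain \<nu> where \<nu>: "\<nu> \<in> paths \<Lambda>" "rng \<Lambda> \<nu> = v" "B \<nu>" "s = st \<nu>" by (auto simp: S_def paths_from_iff)
    obtain e where e: "e \<in> paths \<Lambda>" "rng \<Lambda> e = src \<Lambda> \<nu>" "\<not> B (\<nu> \<cdot> e)" using escape \<nu> by blast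
    then show "\<exists>e \<in> paths \<Lambda>. \<forall>\<mu>. \<mu> \<in> paths \<Lambda> \<and> rng \<Lambda> \<mu> = v \<and> B \<mu> \<and> st \<mu> = s \<longrightarrow> rng \<Lambda> e = src \<Lambda> \<mu> \<and> \<not> B (\<mu> \<cdot> e)"
      using state[OF \<nu>(1-3) _ _ _ _ e(1,2)] \<nu>(4) by metis
  qed
  then obtain e where e: "\<And>s. s \<in> S \<Longrightarrow> e s \<in> paths \<Lambda>"
    "\<And>\<mu>. \<lbrakk>\<mu> \<in> paths \<Lambda>; rng \<Lambda> \<mu> = v; B \<mu>\<rbrakk> \<Longrightarrow> rng \<Lambda> (e (st \<mu>)) = src \<Lambda> \<mu> \<and> \<not> B (\<mu> \<cdot> e (st \<mu>))"
    by (metis (mono_tags, lifting) S_def image_eqI mem_Collect_eq paths_from_iff)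
  \<comment> \<open>A crude bound: summing over all states and coordinates dominates each coordinate
    of each escape path, so one diagonal degree serves all of them.\<close>
  define m where "m = (\<Sum>s\<in>S. \<Sum>i\<in>UNIV. deg \<Lambda> (e s) $ i)"
  have le_m: "deg \<Lambda> (e s) \<le> const_deg m" if "s \<in> S" for s
  proof -
    have "deg \<Lambda> (e s) $ i \<le> m" for i
    proof -
      have "deg \<Lambda> (e s) $ i \<le> (\<Sum>i\<in>UNIV. deg \<Lambda> (e s) $ i)" by (rule member_le_sum) auto
      also have "\<dots> \<le> m" unfolding m_def
        using member_le_sum[of s S "\<lambda>s. \<Sum>i\<in>UNIV. deg \<Lambda> (e s) $ i"] that fin by (simp add: S_def)
      finally show ?thesis .
    qed
    then show ?thesis by (simp add: less_eq_vec_def)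
  qed
  have leave: "\<exists>\<nu>' \<in> from_deg \<Lambda> (src \<Lambda> \<nu>) (const_deg m). \<not> B (\<nu> \<cdot> \<nu>')"
    if \<nu>: "\<nu> \<in> paths \<Lambda>" "rng \<Lambda> \<nu> = v" "B \<nu>" for \<nu>
  proof -
    let ?e = "e (st \<nu>)"
    have s: "st \<nu> \<in> S" using \<nu> by (auto simp: S_def paths_from_iff)
    note ee = e(1)[OF s] e(2)[OF \<nu>]
    obtain \<tau> where \<tau>: "\<tau> \<in> paths \<Lambda>" "rng \<Lambda> \<tau> = src \<Lambda> ?e" "deg \<Lambda> \<tau> = const_deg m - deg \<Lambda> ?e"
      using path_of_degree_exists src_in_verts ee by blast
    have "?e \<cdot> \<tau> \<in> from_deg \<Lambda> (src \<Lambda> \<nu>) (const_deg m)"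
      using ee \<tau> cat_closed rng_cat deg_cat vec_nat_add_diff[OF le_m[OF s]] by (simp add: from_deg_iff)
    \<comment> \<open>Padding the escape path to the fixed degree is harmless, because the
      complement of B is closed under extension.\<close>
    moreover have "\<not> B (\<nu> \<cdot> ?e \<cdot> \<tau>)"
      using hereditary[of "\<nu> \<cdot> ?e" \<tau>] ee \<tau> \<nu> cat_assoc[of \<nu> ?e \<tau>] cat_closed rng_cat src_cat by auto
    ultimately show ?thesis by blast
  qed
  define \<xi> where "\<xi> = Min (x ` verts \<Lambda>)"
  have \<xi>: "\<xi> > 0" "\<And>w. w \<in> verts \<Lambda> \<Longrightarrow> \<xi> \<le> x w"
    unfolding \<xi>_def using finite_verts verts_nonempty x_pos by (auto simp: Min_gr_iff)
  define W where "W l = (\<Sum>\<nu>\<in>{\<nu> \<in> from_deg \<Lambda> v (const_deg l). B \<nu>}. x (src \<Lambda> \<nu>))" for l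
  define w where "w l = inverse (rho_deg \<Lambda> (const_deg l)) * W l" for l
  have W: "W l = (\<Sum>\<nu>\<in>from_deg \<Lambda> v (const_deg l). if B \<nu> then x (src \<Lambda> \<nu>) else 0)" for l
    unfolding W_def by (rule sum.inter_filter[OF finite_from_deg])
  have Wnn: "W l \<ge> 0" for l
    unfolding W_def by (rule sum_nonneg) (auto simp: from_deg_iff intro!: less_imp_le x_pos src_in_verts)
  \<comment> \<open>By heredity only the members of B of degree l contribute to degree l + j. This
    estimate is used twice: with \<open>a = ?R j\<close> for monotonicity and with
    \<open>a = ?R m - \<xi>\<close> for contraction.\<close>
  have step: "W (l + j) \<le> (\<Sum>\<eta>\<in>{\<eta> \<in> from_deg \<Lambda> v (const_deg l). B \<eta>}. a * x (src \<Lambda> \<eta>))"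
    if a: "\<And>\<eta>. \<lbrakk>\<eta> \<in> paths \<Lambda>; rng \<Lambda> \<eta> = v; B \<eta>\<rbrakk> \<Longrightarrow>
       (\<Sum>\<nu>\<in>from_deg \<Lambda> (src \<Lambda> \<eta>) (const_deg j). if B (\<eta> \<cdot> \<nu>) then x (src \<Lambda> \<nu>) else 0) \<le> a * x (src \<Lambda> \<eta>)" for l j a
  proof -
    have "W (l + j) = (\<Sum>\<eta>\<in>from_deg \<Lambda> v (const_deg l). \<Sum>\<nu>\<in>from_deg \<Lambda> (src \<Lambda> \<eta>) (const_deg j). if B (\<eta> \<cdot> \<nu>) then x (src \<Lambda> \<nu>) else 0)"
      unfolding W const_deg_add sum_from_deg_add by (intro sum.cong refl) (auto simp: from_deg_iff src_cat)
    also have "\<dots> \<le> (\<Sum>\<eta>\<in>from_deg \<Lambda> v (const_deg l). if B \<eta> then a * x (src \<Lambda> \<eta>) else 0)"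
    proof (rule sum_mono)
      fix \<eta> assume "\<eta> \<in> from_deg \<Lambda> v (const_deg l)"
      then have \<eta>: "\<eta> \<in> paths \<Lambda>" "rng \<Lambda> \<eta> = v" by (auto simp: from_deg_iff)
      show "(\<Sum>\<nu>\<in>from_deg \<Lambda> (src \<Lambda> \<eta>) (const_deg j). if B (\<eta> \<cdot> \<nu>) then x (src \<Lambda> \<nu>) else 0)
         \<le> (if B \<eta> then a * x (src \<Lambda> \<eta>) else 0)"
      proof (cases "B \<eta>")
        case True
        then show ?thesis using a \<eta> by simp
      next
        case False
        then have "\<not> B (\<eta> \<cdot> \<nu>)" if "\<nu> \<in> from_deg \<Lambda> (src \<Lambda> \<eta>) (const_deg j)" for \<nu>
          using hereditary[OF \<eta>, of \<nu>] that by (auto simp: from_deg_iff)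
        then have "(\<Sum>\<nu>\<in>from_deg \<Lambda> (src \<Lambda> \<eta>) (const_deg j). if B (\<eta> \<cdot> \<nu>) then x (src \<Lambda> \<nu>) else 0) = 0"
          by (intro sum.neutral) simp
        then show ?thesis using False by simp
      qed
    qed
    also have "\<dots> = (\<Sum>\<eta>\<in>{\<eta> \<in> from_deg \<Lambda> v (const_deg l). B \<eta>}. a * x (src \<Lambda> \<eta>))"
      by (rule sum.inter_filter[OF finite_from_deg, symmetric])
    finally show ?thesis .
  qed
  let ?R = "\<lambda>j. rho_deg \<Lambda> (const_deg j)"
  have nonneg: "0 \<le> (if P then x (src \<Lambda> \<nu>) else 0)" if "\<nu> \<in> from_deg \<Lambda> u p" for \<nu> u p P
    using that by (auto simp: from_deg_iff intro!: less_imp_le x_pos src_in_verts)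
  have mono: "w (l + j) \<le> w l" for l j
  proof -
    have "W (l + j) \<le> (\<Sum>\<eta>\<in>{\<eta> \<in> from_deg \<Lambda> v (const_deg l). B \<eta>}. ?R j * x (src \<Lambda> \<eta>))"
    proof (rule step)
      fix \<eta> assume \<eta>: "\<eta> \<in> paths \<Lambda>" "rng \<Lambda> \<eta> = v" "B \<eta>"
      have "(\<Sum>\<nu>\<in>from_deg \<Lambda> (src \<Lambda> \<eta>) (const_deg j). if B (\<eta> \<cdot> \<nu>) then x (src \<Lambda> \<nu>) else 0)
        \<le> (\<Sum>\<nu>\<in>from_deg \<Lambda> (src \<Lambda> \<eta>) (const_deg j). x (src \<Lambda> \<nu>))"
        by (rule sum_mono) (use nonneg[of _ _ _ True] in auto)
      then show "(\<Sum>\<nu>\<in>from_deg \<Lambda> (src \<Lambda> \<eta>) (const_deg j). if B (\<eta> \<cdot> \<nu>) then x (src \<Lambda> \<nu>) else 0)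
        \<le> ?R j * x (src \<Lambda> \<eta>)" using x_from_deg src_in_verts \<eta> by simp
    qed
    then have "W (l + j) \<le> ?R j * W l" by (simp add: W_def sum_distrib_left)
    then show ?thesis using rho_deg_pos[of "const_deg l"] rho_deg_pos[of "const_deg j"]
      by (simp add: w_def const_deg_add rho_deg_add field_simps)
  qed
  \<comment> \<open>The lost extension weighs at least \<xi>, hence at least
    \<open>\<xi> * x (src \<Lambda> \<eta>)\<close> as x is at most 1, out of a total extension
    weight of \<open>?R m * x (src \<Lambda> \<eta>)\<close>.\<close>
  define \<delta> where "\<delta> = \<xi> / ?R m"
  have \<delta>: "\<delta> > 0" using \<xi> rho_deg_pos by (simp add: \<delta>_def)
  have contr: "w (l + m) \<le> (1 - \<delta>) * w l" for l
  proof -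
    have "W (l + m) \<le> (\<Sum>\<eta>\<in>{\<eta> \<in> from_deg \<Lambda> v (const_deg l). B \<eta>}. (?R m - \<xi>) * x (src \<Lambda> \<eta>))"
    proof (rule step)
      fix \<eta> assume \<eta>: "\<eta> \<in> paths \<Lambda>" "rng \<Lambda> \<eta> = v" "B \<eta>"
      let ?D = "from_deg \<Lambda> (src \<Lambda> \<eta>) (const_deg m)"
      obtain \<nu>' where \<nu>': "\<nu>' \<in> ?D" "\<not> B (\<eta> \<cdot> \<nu>')" using leave \<eta> by blast
      have "\<xi> \<le> x (src \<Lambda> \<nu>')" using \<xi>(2) \<nu>' src_in_verts by (simp add: from_deg_iff)
      moreover have "\<xi> * x (src \<Lambda> \<eta>) \<le> \<xi>" using x_le_1 src_in_verts \<eta> \<xi>(1) by (simp add: mult_left_le)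
      moreover have "(\<Sum>\<nu>\<in>?D. if B (\<eta> \<cdot> \<nu>) then x (src \<Lambda> \<nu>) else 0)
        = (\<Sum>\<nu>\<in>?D - {\<nu>'}. if B (\<eta> \<cdot> \<nu>) then x (src \<Lambda> \<nu>) else 0)"
        using \<nu>' sum.remove[OF finite_from_deg \<nu>'(1), of "\<lambda>\<nu>. if B (\<eta> \<cdot> \<nu>) then x (src \<Lambda> \<nu>) else 0"] by simp
      moreover have "\<dots> \<le> (\<Sum>\<nu>\<in>?D - {\<nu>'}. x (src \<Lambda> \<nu>))"
        by (rule sum_mono) (use nonneg[of _ _ _ True] in auto)
      moreover have "\<dots> = ?R m * x (src \<Lambda> \<eta>) - x (src \<Lambda> \<nu>')"
        using sum.remove[OF finite_from_deg \<nu>'(1), of "\<lambda>\<nu>. x (src \<Lambda> \<nu>)"] x_from_deg src_in_verts \<eta> by simp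
      ultimately show "(\<Sum>\<nu>\<in>?D. if B (\<eta> \<cdot> \<nu>) then x (src \<Lambda> \<nu>) else 0) \<le> (?R m - \<xi>) * x (src \<Lambda> \<eta>)"
        by (simp add: left_diff_distrib)
    qed
    then have "W (l + m) \<le> (?R m - \<xi>) * W l" by (simp add: W_def sum_distrib_left)
    also have "?R m - \<xi> = ?R m * (1 - \<delta>)" using rho_deg_pos[of "const_deg m"] by (simp add: \<delta>_def field_simps)
    finally have le: "W (l + m) \<le> ?R m * (1 - \<delta>) * W l" .
    have "inverse (?R l * ?R m) * W (l + m) \<le> inverse (?R l * ?R m) * (?R m * (1 - \<delta>) * W l)"
      using rho_deg_pos by (intro mult_left_mono[OF le]) (simp add: less_imp_le)
    also have "\<dots> = (inverse (?R m) * ?R m) * ((1 - \<delta>) * w l)"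
      by (simp only: w_def inverse_mult_distrib ac_simps)
    also have "\<dots> = (1 - \<delta>) * w l" using rho_deg_pos[of "const_deg m"] by simp
    finally show ?thesis by (simp add: w_def const_deg_add rho_deg_add)
  qed
  have wnn: "w l \<ge> 0" for l using Wnn rho_deg_pos by (simp add: w_def less_imp_le)
  \<comment> \<open>The contraction concerns steps of length m only. Monotonicity supplies the limit
    L, and the contraction then forces \<open>\<delta> * L \<le> 0\<close>.\<close>
  have "decseq w" by (rule decseq_SucI) (use mono[of _ 1] in simp)
  then obtain L where L: "w \<longlonglongrightarrow> L" using decseq_convergent[of w 0] wnn by blast
  have "(\<lambda>l. w (l + m)) \<longlonglongrightarrow> L" using L by (rule LIMSEQ_ignore_initial_segment)
  moreover have "(\<lambda>l. (1 - \<delta>) * w l) \<longlonglongrightarrow> (1 - \<delta>) * L" by (intro tendsto_intros L)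
  ultimately have "L \<le> (1 - \<delta>) * L" by (rule LIMSEQ_le) (use contr in auto)
  then have "L \<le> 0" using \<delta> by (simp add: left_diff_distrib mult_le_0_iff)
  moreover have "L \<ge> 0" by (rule LIMSEQ_le_const[OF L]) (use wnn in auto)
  ultimately show ?thesis using L by (simp add: w_def[abs_def] W_def)
qed

end

section \<open>Functionals with the KMS scaling property\<close>

text \<open>If \<open>K = 0\<close> the limit need not exist, but its value does not matter.\<close>

lemma eq_mult_lim:
  fixes a K :: complex and c :: "nat \<Rightarrow> real"
  assumes lim: "(\<lambda>l. a - K * of_real (c l)) \<longlonglongrightarrow> 0"
  shows "a = K * of_real (lim c)"
proof (cases "K = 0")
  case True
  then have "(\<lambda>l::nat. a) \<longlonglongrightarrow> 0" using lim by simp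
  from LIMSEQ_unique[OF this tendsto_const] show ?thesis using True by simp
next
  case False
  have "(\<lambda>l. (a - (a - K * of_real (c l))) / K) \<longlonglongrightarrow> (a - 0) / K"
    by (intro tendsto_intros lim False)
  then have cl: "(\<lambda>l. of_real (c l) :: complex) \<longlonglongrightarrow> a / K" using False by simp
  from tendsto_Re[OF this] have "c \<longlonglongrightarrow> Re (a / K)" by simp
  then have lim_c: "lim c = Re (a / K)" and "(\<lambda>l. of_real (c l) :: complex) \<longlonglongrightarrow> of_real (Re (a / K))"
    by (auto intro: limI tendsto_of_real)
  from LIMSEQ_unique[OF cl this(2)] show ?thesis unfolding lim_c[symmetric] using False
    by (simp add: field_simps)
qed

context self_similar_action
begin

lemma act_bij_betw:
  assumes "g \<in> elems G"
  shows "bij_betw (act G g) (from_deg \<Lambda> (gdom G g) r) (from_deg \<Lambda> (gcod G g) r)"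
  by (rule bij_betw_byWitness[where f' = "act G (ginv G g)"])
    (use assms in \<open>auto simp: from_deg_iff act_ginv act_ginv'\<close>)

end

section \<open>The maps \<theta> and \<open>\<h>\<close>\<close>

context connected_action
begin

lemma periodic_Per: "periodic \<kappa> h \<mu> \<Longrightarrow> vec_int (deg \<Lambda> \<kappa>) - vec_int (deg \<Lambda> \<mu>) \<in> Per G \<Lambda>"
  using Per_iff by blast

abbreviation \<theta> where "\<theta> \<equiv> theta G \<Lambda>"
abbreviation \<h> where "\<h> \<equiv> h_elem G \<Lambda>"

text \<open>Membership in \<open>Per\<close> provides a single periodic triple; strong connectedness
  transports it to every path of degree p.\<close>

lemma theta_periodic:
  assumes "vec_int p - vec_int q \<in> Per G \<Lambda>" "\<kappa> \<in> paths \<Lambda>" "deg \<Lambda> \<kappa> = p"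
  shows "periodic \<kappa> (\<h> p q \<kappa>) (\<theta> p q \<kappa>)" "deg \<Lambda> (\<theta> p q \<kappa>) = q"
proof -
  obtain \<alpha> g \<beta> where *: "periodic \<alpha> g \<beta>" "vec_int (deg \<Lambda> \<alpha>) - vec_int (deg \<Lambda> \<beta>) = vec_int p - vec_int q"
    using assms(1) Per_iff by blast
  then have "deg \<Lambda> \<alpha> + q = p + deg \<Lambda> \<beta>" by (simp add: vec_int_diff_eq_iff)
  from periodic_exists[OF *(1) this assms(2,3)]
  obtain \<mu> h where \<mu>: "periodic \<kappa> h \<mu>" "deg \<Lambda> \<mu> = q" by blast
  show "periodic \<kappa> (\<h> p q \<kappa>) (\<theta> p q \<kappa>)" "deg \<Lambda> (\<theta> p q \<kappa>) = q"
    using theta_h_periodic[OF \<mu>(1), of p] \<mu> by auto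
qed

text \<open>Surjectivity is existence applied to the inverse triple, and injectivity is uniqueness
  of the left path.\<close>

lemma theta_bij_betw:
  assumes n: "vec_int p - vec_int q \<in> Per G \<Lambda>"
  shows "bij_betw (\<theta> p q) (from_deg \<Lambda> v p) (from_deg \<Lambda> v q)"
proof (rule bij_betw_imageI)
  show "inj_on (\<theta> p q) (from_deg \<Lambda> v p)"
  proof (rule inj_onI)
    fix \<kappa> \<kappa>' assume *: "\<kappa> \<in> from_deg \<Lambda> v p" "\<kappa>' \<in> from_deg \<Lambda> v p" "\<theta> p q \<kappa> = \<theta> p q \<kappa>'"
    have "periodic \<kappa> (\<h> p q \<kappa>) (\<theta> p q \<kappa>)" "periodic \<kappa>' (\<h> p q \<kappa>') (\<theta> p q \<kappa>)"
      using theta_periodic(1)[OF n, of \<kappa>] theta_periodic(1)[OF n, of \<kappa>'] *(1,2)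
      unfolding *(3) by (simp_all add: from_deg_iff)
    then show "\<kappa> = \<kappa>'" using periodic_unique'(1) *(1,2) by (simp add: from_deg_iff)
  qed
  show "\<theta> p q ` from_deg \<Lambda> v p = from_deg \<Lambda> v q"
  proof (intro equalityI subsetI)
    fix \<zeta> assume "\<zeta> \<in> \<theta> p q ` from_deg \<Lambda> v p"
    then obtain \<kappa> where \<kappa>: "\<kappa> \<in> from_deg \<Lambda> v p" "\<zeta> = \<theta> p q \<kappa>" by blast
    note t = theta_periodic[OF n, of \<kappa>]
    show "\<zeta> \<in> from_deg \<Lambda> v q" using t \<kappa> periodic_rng[OF t(1)] periodicD(2)[OF t(1)] by (simp add: from_deg_iff)
  next
    fix \<zeta> assume \<zeta>: "\<zeta> \<in> from_deg \<Lambda> v q"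
    obtain \<alpha> g \<beta> where *: "periodic \<alpha> g \<beta>" "vec_int (deg \<Lambda> \<alpha>) - vec_int (deg \<Lambda> \<beta>) = vec_int p - vec_int q"
      using n Per_iff by blast
    then have "deg \<Lambda> \<beta> + p = q + deg \<Lambda> \<alpha>" by (simp add: vec_int_diff_eq_iff add.commute)
    moreover have "\<zeta> \<in> paths \<Lambda>" "deg \<Lambda> \<zeta> = q" using \<zeta> by (auto simp: from_deg_iff)
    ultimately obtain \<kappa> h where \<kappa>: "periodic \<zeta> h \<kappa>" "deg \<Lambda> \<kappa> = p"
      using periodic_exists[OF periodic_inv[OF *(1)]] by blast
    have "\<theta> p q \<kappa> = \<zeta>" using theta_h_periodic(1)[OF periodic_inv[OF \<kappa>(1)], of p] \<zeta> by (simp add: from_deg_iff)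
    moreover have "\<kappa> \<in> from_deg \<Lambda> v p" using \<kappa> periodic_rng[OF \<kappa>(1)] periodicD(2)[OF \<kappa>(1)] \<zeta> by (simp add: from_deg_iff)
    ultimately show "\<zeta> \<in> \<theta> p q ` from_deg \<Lambda> v p" by blast
  qed
qed

end

text \<open>The interface between algebra and combinatorics: these three properties are all that is
  used of the state. Note that the degree r in \<open>expand\<close> is arbitrary, and that F need
  not be positive or bounded.\<close>

locale scaling_functional = pf_action G \<Lambda> x
  for G :: "('g, 'm) acting_groupoid" and \<Lambda> :: "('m, 'k::finite) kgraph" and x :: "'m \<Rightarrow> real" +
  fixes F :: "'m \<Rightarrow> 'g \<Rightarrow> 'm \<Rightarrow> complex"
  assumes expand: "\<lbrakk>\<kappa> \<in> paths \<Lambda>; \<mu> \<in> paths \<Lambda>; g \<in> elems G; src \<Lambda> \<kappa> = gcod G g; src \<Lambda> \<mu> = gdom G g\<rbrakk> \<Longrightarrow>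
      F \<kappa> g \<mu> = (\<Sum>\<nu>\<in>from_deg \<Lambda> (gdom G g) r. F (\<kappa> \<cdot> (g \<star> \<nu>)) (g \<restriction> \<nu>) (\<mu> \<cdot> \<nu>))"
    and scale: "\<lbrakk>\<kappa> \<in> paths \<Lambda>; \<alpha> \<in> paths \<Lambda>; \<beta> \<in> paths \<Lambda>; g \<in> elems G; src \<Lambda> \<kappa> = rng \<Lambda> \<alpha>; src \<Lambda> \<kappa> = rng \<Lambda> \<beta>;
        src \<Lambda> \<alpha> = gcod G g; src \<Lambda> \<beta> = gdom G g\<rbrakk> \<Longrightarrow>
      F (\<kappa> \<cdot> \<alpha>) g (\<kappa> \<cdot> \<beta>) = of_real (inverse (rho_deg \<Lambda> (deg \<Lambda> \<kappa>))) * F \<alpha> g \<beta>"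
    and orth: "\<lbrakk>\<kappa> \<in> paths \<Lambda>; \<mu> \<in> paths \<Lambda>; g \<in> elems G; src \<Lambda> \<kappa> = gcod G g; src \<Lambda> \<mu> = gdom G g;
        \<And>\<eta> \<zeta>. \<lbrakk>\<eta> \<in> paths \<Lambda>; \<zeta> \<in> paths \<Lambda>; src \<Lambda> \<kappa> = rng \<Lambda> \<eta>; src \<Lambda> \<mu> = rng \<Lambda> \<zeta>\<rbrakk> \<Longrightarrow> \<kappa> \<cdot> \<eta> \<noteq> \<mu> \<cdot> \<zeta>\<rbrakk> \<Longrightarrow>
      F \<kappa> g \<mu> = 0"
begin

section \<open>Values on periodic triples\<close>

definition Psi :: "nat ^ 'k \<Rightarrow> nat ^ 'k \<Rightarrow> 'm \<Rightarrow> complex" where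
  "Psi p q \<kappa> = F \<kappa> (\<h> p q \<kappa>) (\<theta> p q \<kappa>)"

definition mass :: "nat ^ 'k \<Rightarrow> nat ^ 'k \<Rightarrow> 'm \<Rightarrow> complex" where
  "mass p q v = (\<Sum>\<kappa>\<in>from_deg \<Lambda> v p. Psi p q \<kappa>)"

text \<open>Expanding \<open>Psi p q \<kappa>\<close> in degree r yields restrictions of a periodic
  triple, hence again values of \<open>Psi\<close>, in degrees p + r and q + r. Since
  \<open>h \<star> \<nu>\<close> runs through all paths of degree r at the source of \<kappa> when
  \<nu> runs through those at the source of \<open>\<theta> p q \<kappa>\<close>, every extension of
  \<kappa> occurs once.\<close>

lemma mass_shift:
  assumes n: "vec_int p - vec_int q \<in> Per G \<Lambda>"
  shows "mass (p + r) (q + r) v = mass p q v"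
proof -
  have "(\<Sum>\<nu>'\<in>from_deg \<Lambda> (src \<Lambda> \<kappa>) r. Psi (p + r) (q + r) (\<kappa> \<cdot> \<nu>')) = Psi p q \<kappa>"
    if "\<kappa> \<in> from_deg \<Lambda> v p" for \<kappa>
  proof -
    have \<kappa>: "\<kappa> \<in> paths \<Lambda>" "deg \<Lambda> \<kappa> = p" using that by (auto simp: from_deg_iff)
    note t = theta_periodic[OF n \<kappa>]
    note d = periodicD[OF t(1)]
    have "Psi (p + r) (q + r) (\<kappa> \<cdot> (\<h> p q \<kappa> \<star> \<nu>)) =
        F (\<kappa> \<cdot> (\<h> p q \<kappa> \<star> \<nu>)) (\<h> p q \<kappa> \<restriction> \<nu>) (\<theta> p q \<kappa> \<cdot> \<nu>)"
      if "\<nu> \<in> from_deg \<Lambda> (gdom G (\<h> p q \<kappa>)) r" for \<nu>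
    proof -
      have \<nu>: "\<nu> \<in> paths \<Lambda>" "rng \<Lambda> \<nu> = src \<Lambda> (\<theta> p q \<kappa>)" "deg \<Lambda> \<nu> = r" using that d by (auto simp: from_deg_iff)
      have "deg \<Lambda> (\<theta> p q \<kappa> \<cdot> \<nu>) = q + r" using deg_cat d \<nu> t by simp
      then show ?thesis using theta_h_periodic[OF periodic_restrict[OF t(1) \<nu>(1,2)], of "p + r"] by (simp add: Psi_def)
    qed
    then have "(\<Sum>\<nu>\<in>from_deg \<Lambda> (gdom G (\<h> p q \<kappa>)) r. Psi (p + r) (q + r) (\<kappa> \<cdot> (\<h> p q \<kappa> \<star> \<nu>))) = Psi p q \<kappa>"
      using expand[OF d(1-3) d(4,5)[symmetric], of r] by (simp add: Psi_def)
    then show ?thesis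
      using sum.reindex_bij_betw[OF act_bij_betw[OF d(3), of r], of "\<lambda>\<nu>'. Psi (p + r) (q + r) (\<kappa> \<cdot> \<nu>')"] d(4) by simp
  qed
  then show ?thesis unfolding mass_def sum_from_deg_add by (intro sum.cong refl)
qed

lemma functional_periodic:
  assumes per: "periodic \<kappa> h \<mu>"
  shows "F \<kappa> h \<mu> = of_real (inverse (rho_deg \<Lambda> (deg \<Lambda> \<mu>))) * mass (deg \<Lambda> \<kappa>) (deg \<Lambda> \<mu>) (src \<Lambda> \<mu>)"
proof -
  let ?p = "deg \<Lambda> \<kappa>" and ?q = "deg \<Lambda> \<mu>"
  note n = periodic_Per[OF per] and d = periodicD[OF per]
  have *: "F (\<kappa> \<cdot> (h \<star> \<theta> ?p ?q \<eta>)) (h \<restriction> \<theta> ?p ?q \<eta>) (\<mu> \<cdot> \<theta> ?p ?q \<eta>) = of_real (inverse (rho_deg \<Lambda> ?q)) * Psi ?p ?q \<eta>"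
    if "\<eta> \<in> from_deg \<Lambda> (src \<Lambda> \<mu>) ?p" for \<eta>
  proof -
    have \<eta>: "\<eta> \<in> paths \<Lambda>" "rng \<Lambda> \<eta> = src \<Lambda> \<mu>" "deg \<Lambda> \<eta> = ?p" using that by (auto simp: from_deg_iff)
    note t = theta_periodic[OF n \<eta>(1,3)]
    note d' = periodicD[OF t(1)]
    show ?thesis unfolding periodic_cocycle[OF per t(1) \<eta>(2,3) t(2)] Psi_def
      by (rule scale) (use d d' \<eta> periodic_rng[OF t(1)] in auto)
  qed
  have "F \<kappa> h \<mu> = (\<Sum>\<zeta>\<in>from_deg \<Lambda> (src \<Lambda> \<mu>) ?q. F (\<kappa> \<cdot> (h \<star> \<zeta>)) (h \<restriction> \<zeta>) (\<mu> \<cdot> \<zeta>))"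
    using expand[OF d(1-3) d(4,5)[symmetric], of ?q] d(5) by simp
  also have "\<dots> = (\<Sum>\<eta>\<in>from_deg \<Lambda> (src \<Lambda> \<mu>) ?p. F (\<kappa> \<cdot> (h \<star> \<theta> ?p ?q \<eta>)) (h \<restriction> \<theta> ?p ?q \<eta>) (\<mu> \<cdot> \<theta> ?p ?q \<eta>))"
    by (rule sum.reindex_bij_betw[OF theta_bij_betw[OF n], symmetric])
  also have "\<dots> = of_real (inverse (rho_deg \<Lambda> ?q)) * mass ?p ?q (src \<Lambda> \<mu>)"
    unfolding mass_def sum_distrib_left by (intro sum.cong refl) (rule *)
  finally show ?thesis .
qed

text \<open>The formula for periodic triples is applied to the very triples whose values make up the
  mass, followed by the change of variables \<zeta> = \<open>\<theta> p q \<kappa>\<close>.\<close>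

lemma mass_average:
  assumes n: "vec_int p - vec_int q \<in> Per G \<Lambda>"
  shows "mass p q v = of_real (inverse (rho_deg \<Lambda> q)) * (\<Sum>\<zeta>\<in>from_deg \<Lambda> v q. mass p q (src \<Lambda> \<zeta>))"
proof -
  have "Psi p q \<kappa> = of_real (inverse (rho_deg \<Lambda> q)) * mass p q (src \<Lambda> (\<theta> p q \<kappa>))"
    if "\<kappa> \<in> from_deg \<Lambda> v p" for \<kappa>
    using functional_periodic[OF theta_periodic(1)[OF n, of \<kappa>]] theta_periodic(2)[OF n, of \<kappa>] that
    by (simp add: Psi_def from_deg_iff)
  then have "mass p q v = of_real (inverse (rho_deg \<Lambda> q)) * (\<Sum>\<kappa>\<in>from_deg \<Lambda> v p. mass p q (src \<Lambda> (\<theta> p q \<kappa>)))"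
    unfolding mass_def[of p q v] sum_distrib_left by (intro sum.cong refl)
  then show ?thesis
    using sum.reindex_bij_betw[OF theta_bij_betw[OF n, of v], of "\<lambda>\<zeta>. mass p q (src \<Lambda> \<zeta>)"] by simp
qed

text \<open>Averaging with the pair (p, q) gives the eigenvalue equation for paths of degree q only.
  The pair (p + m, q + m) has the same mass, so the equation also holds in degree m + q; factoring
  these paths and dividing by the equation for q leaves the one for an arbitrary degree m.\<close>

lemma mass_eigenvector:
  assumes n: "vec_int p - vec_int q \<in> Per G \<Lambda>"
  shows "(\<Sum>f\<in>from_deg \<Lambda> v m. mass p q (src \<Lambda> f)) = of_real (rho_deg \<Lambda> m) * mass p q v"
proof -
  have n': "vec_int (p + m) - vec_int (q + m) \<in> Per G \<Lambda>" using n by (simp add: vec_int_add)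
  have q: "(\<Sum>\<zeta>\<in>from_deg \<Lambda> w q. mass p q (src \<Lambda> \<zeta>)) = of_real (rho_deg \<Lambda> q) * mass p q w" for w
    using mass_average[OF n, of w] rho_deg_pos[of q] by (simp add: field_simps)
  have "mass p q v = of_real (inverse (rho_deg \<Lambda> (q + m))) * (\<Sum>\<zeta>\<in>from_deg \<Lambda> v (m + q). mass p q (src \<Lambda> \<zeta>))"
    using mass_average[OF n', of v] unfolding mass_shift[OF n] by (simp only: add.commute[of m q])
  also have "(\<Sum>\<zeta>\<in>from_deg \<Lambda> v (m + q). mass p q (src \<Lambda> \<zeta>)) =
      (\<Sum>f\<in>from_deg \<Lambda> v m. \<Sum>\<zeta>\<in>from_deg \<Lambda> (src \<Lambda> f) q. mass p q (src \<Lambda> \<zeta>))"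
    unfolding sum_from_deg_add by (intro sum.cong refl) (auto simp: from_deg_iff src_cat)
  also have "\<dots> = of_real (rho_deg \<Lambda> q) * (\<Sum>f\<in>from_deg \<Lambda> v m. mass p q (src \<Lambda> f))"
    by (simp add: q sum_distrib_left)
  finally show ?thesis using rho_deg_pos[of q] rho_deg_pos[of m] by (simp add: rho_deg_add field_simps)
qed

text \<open>For the functional coming from the state this is \<phi>(V), by
  \<open>state_V_elem\<close>.\<close>

definition total :: "nat ^ 'k \<Rightarrow> nat ^ 'k \<Rightarrow> complex" where
  "total p q = (\<Sum>\<kappa>\<in>paths_of_degree \<Lambda> p. Psi p q \<kappa>)"

lemma mass_eq:
  assumes "vec_int p - vec_int q \<in> Per G \<Lambda>" "v \<in> verts \<Lambda>"
  shows "mass p q v = of_real (x v) * total p q"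
  using pf_unique[of "mass p q" v] mass_eigenvector assms
  by (simp add: total_def sum_paths_of_degree mass_def[symmetric])

lemma functional_periodic_eq:
  assumes per: "periodic \<kappa> h \<mu>"
  shows "F \<kappa> h \<mu> = of_real (inverse (rho_deg \<Lambda> (deg \<Lambda> \<mu>)) * x (src \<Lambda> \<mu>)) * total (deg \<Lambda> \<kappa>) (deg \<Lambda> \<mu>)"
  using functional_periodic[OF per] mass_eq[OF periodic_Per[OF per], of "src \<Lambda> \<mu>"]
    src_in_verts periodicD(2)[OF per] by simp

lemma total_shift:
  assumes "vec_int p - vec_int q \<in> Per G \<Lambda>"
  shows "total (p + r) (q + r) = total p q"
  unfolding total_def sum_paths_of_degree mass_def[symmetric] mass_shift[OF assms] ..

text \<open>By \<open>orth\<close>, a nonzero value forces a common extension of \<kappa> and \<mu>,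
  and among the paths of degree \<open>deg \<Lambda> \<mu>\<close> only \<open>\<theta>\<close> has
  one with \<kappa>.\<close>

lemma common_extension_theta:
  assumes n: "vec_int (deg \<Lambda> \<kappa>) - vec_int (deg \<Lambda> \<mu>) \<in> Per G \<Lambda>"
    and "\<kappa> \<in> paths \<Lambda>" "\<mu> \<in> paths \<Lambda>" "g \<in> elems G" "src \<Lambda> \<kappa> = gcod G g" "src \<Lambda> \<mu> = gdom G g"
    and "F \<kappa> g \<mu> \<noteq> 0"
  shows "\<mu> = \<theta> (deg \<Lambda> \<kappa>) (deg \<Lambda> \<mu>) \<kappa>"
proof -
  obtain \<eta> \<zeta> where *: "\<eta> \<in> paths \<Lambda>" "\<zeta> \<in> paths \<Lambda>" "src \<Lambda> \<kappa> = rng \<Lambda> \<eta>" "src \<Lambda> \<mu> = rng \<Lambda> \<zeta>" "\<kappa> \<cdot> \<eta> = \<mu> \<cdot> \<zeta>"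
    using orth[OF assms(2-6)] assms(7) by blast
  note t = theta_periodic[OF n assms(2) refl]
  show ?thesis using periodic_common_extension[OF t(1) assms(3) t(2)[symmetric] *(1,3,2,4,5)] .
qed

section \<open>Values on a fixed triple that need not be periodic\<close>

context
  fixes \<kappa> g \<mu>
  assumes \<kappa>: "\<kappa> \<in> paths \<Lambda>" and \<mu>: "\<mu> \<in> paths \<Lambda>" and g: "g \<in> elems G"
    and gcod: "src \<Lambda> \<kappa> = gcod G g" and gdom: "src \<Lambda> \<mu> = gdom G g"
begin

abbreviation (input) "left \<nu> \<equiv> \<kappa> \<cdot> (g \<star> \<nu>)"
abbreviation (input) "right \<nu> \<equiv> \<mu> \<cdot> \<nu>"
abbreviation (input) "meet_deg \<equiv> vec_meet (deg \<Lambda> \<kappa>) (deg \<Lambda> \<mu>)"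

lemma left_right:
  assumes "\<nu> \<in> paths \<Lambda>" "rng \<Lambda> \<nu> = gdom G g"
  shows "left \<nu> \<in> paths \<Lambda>" "deg \<Lambda> (left \<nu>) = deg \<Lambda> \<kappa> + deg \<Lambda> \<nu>" "src \<Lambda> (left \<nu>) = gcod G (g \<restriction> \<nu>)"
    "right \<nu> \<in> paths \<Lambda>" "deg \<Lambda> (right \<nu>) = deg \<Lambda> \<mu> + deg \<Lambda> \<nu>" "src \<Lambda> (right \<nu>) = gdom G (g \<restriction> \<nu>)"
  using cat_closed deg_cat src_cat assms \<kappa> \<mu> g gcod gdom by auto

lemma left_right_cat:
  assumes "\<nu> \<in> paths \<Lambda>" "rng \<Lambda> \<nu> = gdom G g" "\<nu>' \<in> paths \<Lambda>" "src \<Lambda> \<nu> = rng \<Lambda> \<nu>'"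
  shows "left (\<nu> \<cdot> \<nu>') = left \<nu> \<cdot> (g \<restriction> \<nu> \<star> \<nu>')" "right (\<nu> \<cdot> \<nu>') = right \<nu> \<cdot> \<nu>'"
  using act_cat[OF g assms] cat_assoc[of \<kappa> "g \<star> \<nu>" "g \<restriction> \<nu> \<star> \<nu>'"] cat_assoc[of \<mu> \<nu> \<nu>']
    assms \<kappa> \<mu> g gcod gdom by auto

text \<open>What remains after a common initial segment of maximal degree is cancelled. Only finitely many
  values occur, and by the scaling property they control the functional.\<close>

definition reduct :: "'m \<Rightarrow> 'm \<times> 'g \<times> 'm" where
  "reduct \<nu> = (suf \<Lambda> (meet_deg + deg \<Lambda> \<nu>) (left \<nu>), g \<restriction> \<nu>, suf \<Lambda> (meet_deg + deg \<Lambda> \<nu>) (right \<nu>))"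

definition reduct_space :: "('m \<times> 'g \<times> 'm) set" where
  "reduct_space = paths_of_degree \<Lambda> (deg \<Lambda> \<kappa> - meet_deg) \<times> restriction G \<Lambda> g ` paths_from \<Lambda> (gdom G g) \<times>
     paths_of_degree \<Lambda> (deg \<Lambda> \<mu> - meet_deg)"

lemma finite_reduct_space: "finite reduct_space"
  unfolding reduct_space_def
  using finite_paths_of_degree finite_restrictions[OF finite_graph finite_states g] by simp

lemma meet_left_right:
  assumes "\<nu> \<in> paths \<Lambda>" "rng \<Lambda> \<nu> = gdom G g"
  shows "vec_meet (deg \<Lambda> (left \<nu>)) (deg \<Lambda> (right \<nu>)) = meet_deg + deg \<Lambda> \<nu>"
  unfolding left_right[OF assms] using vec_meet_add[of "deg \<Lambda> \<nu>" "deg \<Lambda> \<kappa>" "deg \<Lambda> \<mu>"] by (simp add: add.commute)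

lemma reduct:
  assumes \<nu>: "\<nu> \<in> paths \<Lambda>" "rng \<Lambda> \<nu> = gdom G g" and agree: "agree \<Lambda> (left \<nu>) (right \<nu>)"
  obtains \<tau> \<alpha> \<beta> where "reduct \<nu> = (\<alpha>, g \<restriction> \<nu>, \<beta>)" "reduct \<nu> \<in> reduct_space" "\<tau> \<in> paths \<Lambda>" "\<alpha> \<in> paths \<Lambda>" "\<beta> \<in> paths \<Lambda>"
    "left \<nu> = \<tau> \<cdot> \<alpha>" "right \<nu> = \<tau> \<cdot> \<beta>" "src \<Lambda> \<tau> = rng \<Lambda> \<alpha>" "src \<Lambda> \<tau> = rng \<Lambda> \<beta>" "deg \<Lambda> \<tau> = meet_deg + deg \<Lambda> \<nu>"
    "src \<Lambda> \<alpha> = gcod G (g \<restriction> \<nu>)" "src \<Lambda> \<beta> = gdom G (g \<restriction> \<nu>)"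
proof -
  note lr = left_right[OF \<nu>]
  let ?M = "meet_deg + deg \<Lambda> \<nu>"
  have M: "?M \<le> deg \<Lambda> (left \<nu>)" "?M \<le> deg \<Lambda> (right \<nu>)"
    using meet_left_right[OF \<nu>] vec_meet_le by metis+
  note a = pre_suf[OF lr(1) M(1)] and b = pre_suf[OF lr(4) M(2)]
  note c = agree_common_prefix[OF lr(1,4) agree, unfolded meet_left_right[OF \<nu>]]
  have d: "(p + m) - (q + m) = p - q" for p q m :: "nat ^ 'k" by (simp add: vec_eq_iff)
  have "reduct \<nu> \<in> reduct_space" unfolding reduct_def reduct_space_def
    using a(2,6) b(2,6) \<nu> by (auto simp: paths_of_degree_iff paths_from_iff lr d)
  then show thesis
    by (intro that[OF reduct_def _ a(1) a(2) b(2) c(1,2) c(3,4) a(5)]) (use a(8) b(8) lr in auto)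
qed

text \<open>Two paths with a common extension agree, so without agreement the hypothesis of
  \<open>orth\<close> is satisfied.\<close>

lemma not_agree_zero:
  assumes \<nu>: "\<nu> \<in> paths \<Lambda>" "rng \<Lambda> \<nu> = gdom G g" and "\<not> agree \<Lambda> (left \<nu>) (right \<nu>)"
  shows "F (left \<nu>) (g \<restriction> \<nu>) (right \<nu>) = 0"
proof (rule orth)
  fix \<eta> \<zeta> assume *: "\<eta> \<in> paths \<Lambda>" "\<zeta> \<in> paths \<Lambda>" "src \<Lambda> (left \<nu>) = rng \<Lambda> \<eta>" "src \<Lambda> (right \<nu>) = rng \<Lambda> \<zeta>"
  show "left \<nu> \<cdot> \<eta> \<noteq> right \<nu> \<cdot> \<zeta>"
  proof
    assume "left \<nu> \<cdot> \<eta> = right \<nu> \<cdot> \<zeta>"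
    then have "agree \<Lambda> (left \<nu> \<cdot> \<eta>) (right \<nu> \<cdot> \<zeta>)" using agree_refl by metis
    from agree_mono[OF _ *(1,3) _ *(2,4) this] show False using left_right[OF \<nu>] assms(3) by simp
  qed
qed (use left_right[OF \<nu>] \<nu> g in auto)

text \<open>After cancelling the common initial segment, whose degree is the meet plus
  \<open>deg \<Lambda> \<nu>\<close>, only finitely many values of F remain. Scaling supplies the
  decay; the part due to the meet goes into the constant.\<close>

lemma functional_bound:
  obtains C where "C \<ge> 0" "\<And>\<nu>. \<nu> \<in> paths \<Lambda> \<Longrightarrow> rng \<Lambda> \<nu> = gdom G g \<Longrightarrow>
    cmod (F (left \<nu>) (g \<restriction> \<nu>) (right \<nu>)) \<le> C * inverse (rho_deg \<Lambda> (deg \<Lambda> \<nu>))"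
proof
  \<comment> \<open>A sum over the finite space bounds each of its values.\<close>
  define S where "S = (\<Sum>(\<alpha>, k, \<beta>)\<in>reduct_space. cmod (F \<alpha> k \<beta>))"
  have S: "S \<ge> 0" unfolding S_def by (intro sum_nonneg) auto
  show "inverse (rho_deg \<Lambda> meet_deg) * S \<ge> 0" using S rho_deg_pos[of meet_deg] by simp
  fix \<nu> assume \<nu>: "\<nu> \<in> paths \<Lambda>" "rng \<Lambda> \<nu> = gdom G g"
  show "cmod (F (left \<nu>) (g \<restriction> \<nu>) (right \<nu>)) \<le> inverse (rho_deg \<Lambda> meet_deg) * S * inverse (rho_deg \<Lambda> (deg \<Lambda> \<nu>))"
  proof (cases "agree \<Lambda> (left \<nu>) (right \<nu>)")
    case True
    from reduct[OF \<nu> True] obtain \<tau> \<alpha> \<beta> where r: "reduct \<nu> = (\<alpha>, g \<restriction> \<nu>, \<beta>)" "reduct \<nu> \<in> reduct_space"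
      "\<tau> \<in> paths \<Lambda>" "\<alpha> \<in> paths \<Lambda>" "\<beta> \<in> paths \<Lambda>"
      "left \<nu> = \<tau> \<cdot> \<alpha>" "right \<nu> = \<tau> \<cdot> \<beta>" "src \<Lambda> \<tau> = rng \<Lambda> \<alpha>" "src \<Lambda> \<tau> = rng \<Lambda> \<beta>" "deg \<Lambda> \<tau> = meet_deg + deg \<Lambda> \<nu>"
      "src \<Lambda> \<alpha> = gcod G (g \<restriction> \<nu>)" "src \<Lambda> \<beta> = gdom G (g \<restriction> \<nu>)" by metis
    have "F (left \<nu>) (g \<restriction> \<nu>) (right \<nu>) = of_real (inverse (rho_deg \<Lambda> (deg \<Lambda> \<tau>))) * F \<alpha> (g \<restriction> \<nu>) \<beta>"
      unfolding r(6,7) by (rule scale) (use r \<nu> g in auto)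
    moreover have "cmod (F \<alpha> (g \<restriction> \<nu>) \<beta>) \<le> S"
      unfolding S_def using member_le_sum[of "reduct \<nu>" reduct_space "\<lambda>(\<alpha>, k, \<beta>). cmod (F \<alpha> k \<beta>)"] r(1,2) finite_reduct_space
      by auto
    moreover have "\<bar>inverse (rho_deg \<Lambda> (deg \<Lambda> \<tau>))\<bar> = inverse (rho_deg \<Lambda> meet_deg) * inverse (rho_deg \<Lambda> (deg \<Lambda> \<nu>))"
      unfolding r(10) rho_deg_add using rho_deg_pos[of meet_deg] rho_deg_pos[of "deg \<Lambda> \<nu>"] by simp
    ultimately have "cmod (F (left \<nu>) (g \<restriction> \<nu>) (right \<nu>)) \<le> (inverse (rho_deg \<Lambda> meet_deg) * inverse (rho_deg \<Lambda> (deg \<Lambda> \<nu>))) * S"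
      using rho_deg_pos[of meet_deg] rho_deg_pos[of "deg \<Lambda> \<nu>"]
      by (simp add: norm_mult norm_inverse mult_left_mono del: inverse_mult_distrib)
    then show ?thesis by (simp add: ac_simps)
  next
    case False
    then show ?thesis using not_agree_zero[OF \<nu>] S rho_deg_pos[of meet_deg] rho_deg_pos[of "deg \<Lambda> \<nu>"] by simp
  qed
qed

text \<open>A set of paths of vanishing weight may be dropped from the expansion. Each term is at
  most a constant times \<open>\<rho>(\<Lambda>)\<close> to the power \<open>-d(\<nu>)\<close>; as x
  is bounded below by \<xi>, dividing by \<xi> turns this into a bound by the weight of
  \<nu>.\<close>

lemma functional_approx:
  assumes weight: "(\<lambda>l. inverse (rho_deg \<Lambda> (const_deg l)) *
      (\<Sum>\<nu>\<in>{\<nu> \<in> from_deg \<Lambda> (gdom G g) (const_deg l). B \<nu>}. x (src \<Lambda> \<nu>))) \<longlonglongrightarrow> 0"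
  shows "(\<lambda>l. F \<kappa> g \<mu> - (\<Sum>\<nu>\<in>{\<nu> \<in> from_deg \<Lambda> (gdom G g) (const_deg l). \<not> B \<nu>}.
      F (left \<nu>) (g \<restriction> \<nu>) (right \<nu>))) \<longlonglongrightarrow> 0"
proof -
  obtain C where C: "C \<ge> 0" "\<And>\<nu>. \<nu> \<in> paths \<Lambda> \<Longrightarrow> rng \<Lambda> \<nu> = gdom G g \<Longrightarrow>
    cmod (F (left \<nu>) (g \<restriction> \<nu>) (right \<nu>)) \<le> C * inverse (rho_deg \<Lambda> (deg \<Lambda> \<nu>))"
    using functional_bound by blast
  define \<xi> where "\<xi> = Min (x ` verts \<Lambda>)"
  have \<xi>: "\<xi> > 0" "\<And>w. w \<in> verts \<Lambda> \<Longrightarrow> \<xi> \<le> x w"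
    unfolding \<xi>_def using finite_verts verts_nonempty x_pos by (auto simp: Min_gr_iff)
  let ?D = "\<lambda>l. from_deg \<Lambda> (gdom G g) (const_deg l)"
  let ?T = "\<lambda>\<nu>. F (left \<nu>) (g \<restriction> \<nu>) (right \<nu>)"
  define w where "w l = inverse (rho_deg \<Lambda> (const_deg l)) * (\<Sum>\<nu>\<in>{\<nu> \<in> ?D l. B \<nu>}. x (src \<Lambda> \<nu>))" for l
  have bound: "norm (F \<kappa> g \<mu> - (\<Sum>\<nu>\<in>{\<nu> \<in> ?D l. \<not> B \<nu>}. ?T \<nu>)) \<le> (C / \<xi>) * w l" for l
  proof -
    have "F \<kappa> g \<mu> = (\<Sum>\<nu>\<in>?D l. ?T \<nu>)" using expand[OF \<kappa> \<mu> g gcod gdom] .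
    also have "\<dots> = (\<Sum>\<nu>\<in>{\<nu> \<in> ?D l. B \<nu>}. ?T \<nu>) + (\<Sum>\<nu>\<in>{\<nu> \<in> ?D l. \<not> B \<nu>}. ?T \<nu>)"
      by (subst sum.union_disjoint[symmetric]) (auto simp: finite_from_deg intro!: sum.cong)
    finally have "norm (F \<kappa> g \<mu> - (\<Sum>\<nu>\<in>{\<nu> \<in> ?D l. \<not> B \<nu>}. ?T \<nu>)) = norm (\<Sum>\<nu>\<in>{\<nu> \<in> ?D l. B \<nu>}. ?T \<nu>)" by simp
    also have "\<dots> \<le> (\<Sum>\<nu>\<in>{\<nu> \<in> ?D l. B \<nu>}. (C / \<xi> * inverse (rho_deg \<Lambda> (const_deg l))) * x (src \<Lambda> \<nu>))"
    proof (rule sum_norm_le)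
      fix \<nu> assume "\<nu> \<in> {\<nu> \<in> ?D l. B \<nu>}"
      then have \<nu>: "\<nu> \<in> paths \<Lambda>" "rng \<Lambda> \<nu> = gdom G g" "deg \<Lambda> \<nu> = const_deg l" by (auto simp: from_deg_iff)
      have "C * inverse (rho_deg \<Lambda> (const_deg l)) * \<xi> \<le> C * inverse (rho_deg \<Lambda> (const_deg l)) * x (src \<Lambda> \<nu>)"
        using \<xi>(2) src_in_verts \<nu> C(1) rho_deg_pos[of "const_deg l"] by (intro mult_left_mono) auto
      then have "C * inverse (rho_deg \<Lambda> (const_deg l)) \<le> C * inverse (rho_deg \<Lambda> (const_deg l)) * x (src \<Lambda> \<nu>) / \<xi>"
        by (simp only: pos_le_divide_eq[OF \<xi>(1)])
      then have "C * inverse (rho_deg \<Lambda> (const_deg l)) \<le> (C / \<xi> * inverse (rho_deg \<Lambda> (const_deg l))) * x (src \<Lambda> \<nu>)"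
        by simp
      then show "norm (?T \<nu>) \<le> (C / \<xi> * inverse (rho_deg \<Lambda> (const_deg l))) * x (src \<Lambda> \<nu>)"
        using C(2)[OF \<nu>(1,2)] \<nu>(3) by simp
    qed
    also have "\<dots> = (C / \<xi>) * w l" by (simp add: w_def sum_distrib_left mult.assoc)
    finally show ?thesis .
  qed
  have "(\<lambda>l. (C / \<xi>) * w l) \<longlonglongrightarrow> (C / \<xi>) * 0" unfolding w_def by (intro tendsto_intros weight)
  then have "(\<lambda>l. (C / \<xi>) * w l) \<longlonglongrightarrow> 0" by (simp only: mult_zero_right)
  then show ?thesis by (rule Lim_null_comparison[OF always_eventually[OF allI[OF bound]]])
qed

text \<open>Terms without agreement vanish, so it suffices that the agreeing \<nu> have vanishing
  weight. Each of them can be extended to a disagreement, since otherwise it would give a periodic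
  triple of the forbidden degree difference.\<close>

lemma functional_not_periodic:
  assumes n: "vec_int (deg \<Lambda> \<kappa>) - vec_int (deg \<Lambda> \<mu>) \<notin> Per G \<Lambda>"
  shows "F \<kappa> g \<mu> = 0"
proof -
  define B where "B \<nu> \<longleftrightarrow> agree \<Lambda> (left \<nu>) (right \<nu>)" for \<nu>
  have gv: "gdom G g \<in> verts \<Lambda>" using gdom_closed g by simp
  have "(\<lambda>l. inverse (rho_deg \<Lambda> (const_deg l)) *
      (\<Sum>\<nu>\<in>{\<nu> \<in> from_deg \<Lambda> (gdom G g) (const_deg l). B \<nu>}. x (src \<Lambda> \<nu>))) \<longlonglongrightarrow> 0"
  proof (rule weight_tendsto_0[OF gv, where st = reduct])
    have "reduct ` {\<nu> \<in> paths_from \<Lambda> (gdom G g). B \<nu>} \<subseteq> reduct_space"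
    proof (intro subsetI, elim imageE CollectE conjE)
      fix s \<nu> assume *: "s = reduct \<nu>" "\<nu> \<in> paths_from \<Lambda> (gdom G g)" "B \<nu>"
      then have \<nu>: "\<nu> \<in> paths \<Lambda>" "rng \<Lambda> \<nu> = gdom G g" by (auto simp: paths_from_iff)
      show "s \<in> reduct_space" using reduct[OF \<nu>] * by (metis B_def)
    qed
    then show "finite (reduct ` {\<nu> \<in> paths_from \<Lambda> (gdom G g). B \<nu>})" using finite_reduct_space finite_subset by blast
  next
    fix \<nu> \<nu>' assume \<nu>: "\<nu> \<in> paths \<Lambda>" "rng \<Lambda> \<nu> = gdom G g" "\<nu>' \<in> paths \<Lambda>" "rng \<Lambda> \<nu>' = src \<Lambda> \<nu>" "B (\<nu> \<cdot> \<nu>')"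
    show "B \<nu>" unfolding B_def
      by (rule agree_mono[of _ "g \<restriction> \<nu> \<star> \<nu>'" _ \<nu>'])
        (use \<nu> g left_right[OF \<nu>(1,2)] left_right_cat[OF \<nu>(1-3) \<nu>(4)[symmetric]] in \<open>auto simp: B_def\<close>)
  next
    fix \<nu> assume \<nu>: "\<nu> \<in> paths \<Lambda>" "rng \<Lambda> \<nu> = gdom G g" "B \<nu>"
    note lr = left_right[OF \<nu>(1,2)]
    show "\<exists>\<nu>' \<in> paths \<Lambda>. rng \<Lambda> \<nu>' = src \<Lambda> \<nu> \<and> \<not> B (\<nu> \<cdot> \<nu>')"
    proof (rule ccontr)
      assume "\<not> ?thesis"
      then have "agree \<Lambda> (left \<nu> \<cdot> (g \<restriction> \<nu> \<star> \<nu>')) (right \<nu> \<cdot> \<nu>')" if "\<nu>' \<in> paths \<Lambda>" "rng \<Lambda> \<nu>' = src \<Lambda> \<nu>" for \<nu>'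
        using left_right_cat[OF \<nu>(1,2) that(1) that(2)[symmetric]] that by (auto simp: B_def)
      \<comment> \<open>Extending both paths by the same degree leaves the degree difference
        unchanged, so periodicity here contradicts \<open>n\<close>.\<close>
      then have "periodic (left \<nu>) (g \<restriction> \<nu>) (right \<nu>)"
        unfolding periodic_def using lr \<nu> g by auto
      from periodic_Per[OF this] show False using n lr by (simp add: vec_int_add)
    qed
  next
    fix \<nu> \<nu>1 \<nu>' assume *: "\<nu> \<in> paths \<Lambda>" "rng \<Lambda> \<nu> = gdom G g" "B \<nu>" "\<nu>1 \<in> paths \<Lambda>" "rng \<Lambda> \<nu>1 = gdom G g" "B \<nu>1"
      "reduct \<nu> = reduct \<nu>1" "\<nu>' \<in> paths \<Lambda>" "rng \<Lambda> \<nu>' = src \<Lambda> \<nu>"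
    from *(3,6) have ag: "agree \<Lambda> (left \<nu>) (right \<nu>)" "agree \<Lambda> (left \<nu>1) (right \<nu>1)" by (auto simp: B_def)
    obtain \<tau> \<alpha> \<beta> where r: "reduct \<nu> = (\<alpha>, g \<restriction> \<nu>, \<beta>)" "\<tau> \<in> paths \<Lambda>" "\<alpha> \<in> paths \<Lambda>" "\<beta> \<in> paths \<Lambda>"
      "left \<nu> = \<tau> \<cdot> \<alpha>" "right \<nu> = \<tau> \<cdot> \<beta>" "src \<Lambda> \<tau> = rng \<Lambda> \<alpha>" "src \<Lambda> \<tau> = rng \<Lambda> \<beta>"
      "src \<Lambda> \<alpha> = gcod G (g \<restriction> \<nu>)" "src \<Lambda> \<beta> = gdom G (g \<restriction> \<nu>)" using reduct[OF *(1,2) ag(1)] by metis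
    obtain \<tau>1 \<alpha>1 \<beta>1 where r1: "reduct \<nu>1 = (\<alpha>1, g \<restriction> \<nu>1, \<beta>1)" "\<tau>1 \<in> paths \<Lambda>" "\<alpha>1 \<in> paths \<Lambda>" "\<beta>1 \<in> paths \<Lambda>"
      "left \<nu>1 = \<tau>1 \<cdot> \<alpha>1" "right \<nu>1 = \<tau>1 \<cdot> \<beta>1" "src \<Lambda> \<tau>1 = rng \<Lambda> \<alpha>1" "src \<Lambda> \<tau>1 = rng \<Lambda> \<beta>1"
      "src \<Lambda> \<alpha>1 = gcod G (g \<restriction> \<nu>1)" "src \<Lambda> \<beta>1 = gdom G (g \<restriction> \<nu>1)" using reduct[OF *(4,5) ag(2)] by metis
    have eq: "\<alpha>1 = \<alpha>" "\<beta>1 = \<beta>" "g \<restriction> \<nu>1 = g \<restriction> \<nu>" using r(1) r1(1) *(7) by auto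
    have k: "g \<restriction> \<nu> \<in> elems G" "gdom G (g \<restriction> \<nu>) = src \<Lambda> \<nu>" "gdom G (g \<restriction> \<nu>) = src \<Lambda> \<nu>1"
      using restr_simps[OF g *(1,2)] restr_simps[OF g *(4,5)] eq by auto
    \<comment> \<open>Whether agreement survives an extension depends on the reduct alone, because
      the common initial segment cancels; this justifies \<open>reduct\<close> as the state.\<close>
    have iff: "agree \<Lambda> ((\<tau> \<cdot> \<alpha>) \<cdot> (g \<restriction> \<nu> \<star> \<nu>')) ((\<tau> \<cdot> \<beta>) \<cdot> \<nu>') \<longleftrightarrow> agree \<Lambda> (\<alpha> \<cdot> (g \<restriction> \<nu> \<star> \<nu>')) (\<beta> \<cdot> \<nu>')"
      if "\<tau> \<in> paths \<Lambda>" "src \<Lambda> \<tau> = rng \<Lambda> \<alpha>" "src \<Lambda> \<tau> = rng \<Lambda> \<beta>" for \<tau>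
      using agree_cat_iff[of \<tau> "\<alpha> \<cdot> (g \<restriction> \<nu> \<star> \<nu>')" "\<beta> \<cdot> \<nu>'"] cat_assoc[of \<tau> \<alpha> "g \<restriction> \<nu> \<star> \<nu>'"] cat_assoc[of \<tau> \<beta> \<nu>']
        that r(3,4,9,10) k *(8,9) cat_closed rng_cat by simp
    have s: "rng \<Lambda> \<nu>' = src \<Lambda> \<nu>1" using k *(9) by simp
    have "B (\<nu> \<cdot> \<nu>') \<longleftrightarrow> B (\<nu>1 \<cdot> \<nu>')"
      unfolding B_def left_right_cat[OF *(1,2,8) *(9)[symmetric]] left_right_cat[OF *(4,5,8) s[symmetric]]
        r(5,6) r1(5,6) eq using iff[OF r(2,7,8)] iff[OF r1(2) r1(7,8)[unfolded eq]] by simp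
    then show "rng \<Lambda> \<nu>' = src \<Lambda> \<nu>1 \<and> (B (\<nu>1 \<cdot> \<nu>') \<longrightarrow> B (\<nu> \<cdot> \<nu>'))" using s by simp
  qed
  from functional_approx[OF this]
  have "(\<lambda>l. F \<kappa> g \<mu> - (\<Sum>\<nu>\<in>{\<nu> \<in> from_deg \<Lambda> (gdom G g) (const_deg l). \<not> B \<nu>}.
      F (left \<nu>) (g \<restriction> \<nu>) (right \<nu>))) \<longlonglongrightarrow> 0" .
  moreover have "(\<Sum>\<nu>\<in>{\<nu> \<in> from_deg \<Lambda> (gdom G g) (const_deg l). \<not> B \<nu>}. F (left \<nu>) (g \<restriction> \<nu>) (right \<nu>)) = 0" for l
    by (intro sum.neutral) (use not_agree_zero in \<open>auto simp: B_def from_deg_iff\<close>)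
  ultimately have "(\<lambda>l::nat. F \<kappa> g \<mu>) \<longlonglongrightarrow> 0" by simp
  then show ?thesis using LIMSEQ_unique tendsto_const by blast
qed

text \<open>If g and h agree on \<nu> with equal restrictions, the term is periodic and contributes
  to the coefficient. If they send \<nu> to different paths, the term vanishes. The remaining paths
  lose their weight in the limit: distinct restrictions are separated on some extension, by
  faithfulness.\<close>

lemma functional_not_h:
  assumes per: "periodic \<kappa> h \<mu>" and neq: "g \<noteq> h"
  shows "F \<kappa> g \<mu> = of_real (inverse (rho_deg \<Lambda> (deg \<Lambda> \<mu>)) * c_coeff G \<Lambda> x (deg \<Lambda> \<kappa>) (deg \<Lambda> \<mu>) \<kappa> g) *
    total (deg \<Lambda> \<kappa>) (deg \<Lambda> \<mu>)"
proof -
  note d = periodicD[OF per]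
  \<comment> \<open>The undecided paths. Whether an extension of such a path is still undecided
    depends only on the pair of restrictions, which therefore serves as the state.\<close>
  define B where "B \<nu> \<longleftrightarrow> g \<star> \<nu> = h \<star> \<nu> \<and> g \<restriction> \<nu> \<noteq> h \<restriction> \<nu>" for \<nu>
  have hg: "gdom G h = gdom G g" "gcod G h = gcod G g" using d gcod gdom by auto
  have gv: "gdom G g \<in> verts \<Lambda>" using gdom_closed g by simp
  have gcat: "g \<star> (\<nu> \<cdot> \<nu>') = (g \<star> \<nu>) \<cdot> (g \<restriction> \<nu> \<star> \<nu>')" "g \<restriction> (\<nu> \<cdot> \<nu>') = g \<restriction> \<nu> \<restriction> \<nu>'"
    and hcat: "h \<star> (\<nu> \<cdot> \<nu>') = (h \<star> \<nu>) \<cdot> (h \<restriction> \<nu> \<star> \<nu>')" "h \<restriction> (\<nu> \<cdot> \<nu>') = h \<restriction> \<nu> \<restriction> \<nu>'"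
    and cancel: "g \<star> (\<nu> \<cdot> \<nu>') = h \<star> (\<nu> \<cdot> \<nu>') \<longleftrightarrow> g \<star> \<nu> = h \<star> \<nu> \<and> g \<restriction> \<nu> \<star> \<nu>' = h \<restriction> \<nu> \<star> \<nu>'"
    if \<nu>: "\<nu> \<in> paths \<Lambda>" "rng \<Lambda> \<nu> = gdom G g" "\<nu>' \<in> paths \<Lambda>" "rng \<Lambda> \<nu>' = src \<Lambda> \<nu>" for \<nu> \<nu>'
  proof -
    show gc: "g \<star> (\<nu> \<cdot> \<nu>') = (g \<star> \<nu>) \<cdot> (g \<restriction> \<nu> \<star> \<nu>')" "g \<restriction> (\<nu> \<cdot> \<nu>') = g \<restriction> \<nu> \<restriction> \<nu>'"
      and hc: "h \<star> (\<nu> \<cdot> \<nu>') = (h \<star> \<nu>) \<cdot> (h \<restriction> \<nu> \<star> \<nu>')" "h \<restriction> (\<nu> \<cdot> \<nu>') = h \<restriction> \<nu> \<restriction> \<nu>'"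
      using act_cat restr_cat \<nu> g d(3) hg by auto
    show "g \<star> (\<nu> \<cdot> \<nu>') = h \<star> (\<nu> \<cdot> \<nu>') \<longleftrightarrow> g \<star> \<nu> = h \<star> \<nu> \<and> g \<restriction> \<nu> \<star> \<nu>' = h \<restriction> \<nu> \<star> \<nu>'"
    proof
      assume "g \<star> (\<nu> \<cdot> \<nu>') = h \<star> (\<nu> \<cdot> \<nu>')"
      then have eq: "(g \<star> \<nu>) \<cdot> (g \<restriction> \<nu> \<star> \<nu>') = (h \<star> \<nu>) \<cdot> (h \<restriction> \<nu> \<star> \<nu>')" unfolding gc hc .
      show "g \<star> \<nu> = h \<star> \<nu> \<and> g \<restriction> \<nu> \<star> \<nu>' = h \<restriction> \<nu> \<star> \<nu>'"
        by (rule conjI; rule cat_cancel[OF _ _ _ _ _ _ eq]) (use \<nu> g d(3) hg in auto)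
    qed (simp add: gc hc)
  qed
  have "(\<lambda>l. inverse (rho_deg \<Lambda> (const_deg l)) *
      (\<Sum>\<nu>\<in>{\<nu> \<in> from_deg \<Lambda> (gdom G g) (const_deg l). B \<nu>}. x (src \<Lambda> \<nu>))) \<longlonglongrightarrow> 0"
  proof (rule weight_tendsto_0[OF gv, where st = "\<lambda>\<nu>. (g \<restriction> \<nu>, h \<restriction> \<nu>)"])
    have "(\<lambda>\<nu>. (g \<restriction> \<nu>, h \<restriction> \<nu>)) ` {\<nu> \<in> paths_from \<Lambda> (gdom G g). B \<nu>} \<subseteq>
        restriction G \<Lambda> g ` paths_from \<Lambda> (gdom G g) \<times> restriction G \<Lambda> h ` paths_from \<Lambda> (gdom G h)"
      using hg by auto
    then show "finite ((\<lambda>\<nu>. (g \<restriction> \<nu>, h \<restriction> \<nu>)) ` {\<nu> \<in> paths_from \<Lambda> (gdom G g). B \<nu>})"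
      by (rule finite_subset)
        (intro finite_cartesian_product finite_restrictions finite_graph finite_states g d(3))
  next
    fix \<nu> \<nu>' assume \<nu>: "\<nu> \<in> paths \<Lambda>" "rng \<Lambda> \<nu> = gdom G g" "\<nu>' \<in> paths \<Lambda>" "rng \<Lambda> \<nu>' = src \<Lambda> \<nu>" and b: "B (\<nu> \<cdot> \<nu>')"
    show "B \<nu>" using b cancel[OF \<nu>] gcat(2)[OF \<nu>] hcat(2)[OF \<nu>] unfolding B_def by metis
  next
    fix \<nu> assume \<nu>: "\<nu> \<in> paths \<Lambda>" "rng \<Lambda> \<nu> = gdom G g" and b: "B \<nu>"
    then have "g \<star> \<nu> = h \<star> \<nu>" "g \<restriction> \<nu> \<noteq> h \<restriction> \<nu>" by (auto simp: B_def)
    then obtain \<nu>' where \<nu>': "\<nu>' \<in> paths \<Lambda>" "rng \<Lambda> \<nu>' = src \<Lambda> \<nu>" "g \<restriction> \<nu> \<star> \<nu>' \<noteq> h \<restriction> \<nu> \<star> \<nu>'"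
      using faithful_paths[of "g \<restriction> \<nu>" "h \<restriction> \<nu>"] \<nu> g d(3) hg by auto
    then show "\<exists>\<nu>' \<in> paths \<Lambda>. rng \<Lambda> \<nu>' = src \<Lambda> \<nu> \<and> \<not> B (\<nu> \<cdot> \<nu>')"
      using cancel[OF \<nu> \<nu>'(1,2)] by (auto simp: B_def)
  next
    fix \<nu> \<nu>1 \<nu>' assume *: "\<nu> \<in> paths \<Lambda>" "rng \<Lambda> \<nu> = gdom G g" "B \<nu>" "\<nu>1 \<in> paths \<Lambda>" "rng \<Lambda> \<nu>1 = gdom G g" "B \<nu>1"
      "(g \<restriction> \<nu>, h \<restriction> \<nu>) = (g \<restriction> \<nu>1, h \<restriction> \<nu>1)" "\<nu>' \<in> paths \<Lambda>" "rng \<Lambda> \<nu>' = src \<Lambda> \<nu>"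
    then have s: "rng \<Lambda> \<nu>' = src \<Lambda> \<nu>1"
      using restr_simps(2)[OF g *(1,2)] restr_simps(2)[OF g *(4,5)] by simp
    have "B (\<nu> \<cdot> \<nu>') \<longleftrightarrow> B (\<nu>1 \<cdot> \<nu>')"
      unfolding B_def cancel[OF *(1,2,8,9)] cancel[OF *(4,5,8) s] gcat(2)[OF *(1,2,8,9)] gcat(2)[OF *(4,5,8) s]
        hcat(2)[OF *(1,2,8,9)] hcat(2)[OF *(4,5,8) s]
      using *(3,6,7) by (auto simp: B_def)
    then show "rng \<Lambda> \<nu>' = src \<Lambda> \<nu>1 \<and> (B (\<nu>1 \<cdot> \<nu>') \<longrightarrow> B (\<nu> \<cdot> \<nu>'))" using s by simp
  qed
  note approx = functional_approx[OF this]
  let ?p = "deg \<Lambda> \<kappa>" and ?q = "deg \<Lambda> \<mu>"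
  let ?D = "\<lambda>l. from_deg \<Lambda> (gdom G g) (const_deg l)"
  have n: "vec_int ?p - vec_int ?q \<in> Per G \<Lambda>" using periodic_Per[OF per] .
  define c where "c l = inverse (rho_deg \<Lambda> (const_deg l)) *
      (\<Sum>\<nu>\<in>{\<nu> \<in> ?D l. g \<star> \<nu> = h \<star> \<nu> \<and> g \<restriction> \<nu> = h \<restriction> \<nu>}. x (src \<Lambda> \<nu>))" for l
  have sum: "(\<Sum>\<nu>\<in>{\<nu> \<in> ?D l. \<not> B \<nu>}. F (left \<nu>) (g \<restriction> \<nu>) (right \<nu>)) =
      of_real (inverse (rho_deg \<Lambda> ?q)) * total ?p ?q * of_real (c l)" for l
  proof -
    have val: "F (left \<nu>) (g \<restriction> \<nu>) (right \<nu>) = of_real (inverse (rho_deg \<Lambda> ?q)) * total ?p ?q *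
        of_real (inverse (rho_deg \<Lambda> (const_deg l)) * x (src \<Lambda> \<nu>))"
      if \<nu>: "\<nu> \<in> ?D l" "g \<star> \<nu> = h \<star> \<nu>" "g \<restriction> \<nu> = h \<restriction> \<nu>" for \<nu>
    proof -
      have \<nu>': "\<nu> \<in> paths \<Lambda>" "rng \<Lambda> \<nu> = gdom G g" "deg \<Lambda> \<nu> = const_deg l" using \<nu>(1) by (auto simp: from_deg_iff)
      have "periodic (left \<nu>) (g \<restriction> \<nu>) (right \<nu>)"
        unfolding \<nu>(2,3) using periodic_restrict[OF per \<nu>'(1)] \<nu>' gdom by simp
      from functional_periodic_eq[OF this] show ?thesis
        using left_right[OF \<nu>'(1,2)] \<nu>' g total_shift[OF n, of "const_deg l"] by (simp add: rho_deg_add)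
    qed
    \<comment> \<open>A nonzero term would make \<open>right \<nu>\<close> the image of
      \<open>left \<nu>\<close> under \<open>\<theta>\<close>. The triple of h restricted along
      \<nu> is periodic with the same right path, so uniqueness would identify the left paths and
      cancelling \<kappa> would give \<open>g \<star> \<nu> = h \<star> \<nu>\<close>.\<close>
    have zero: "F (left \<nu>) (g \<restriction> \<nu>) (right \<nu>) = 0" if \<nu>: "\<nu> \<in> ?D l" "g \<star> \<nu> \<noteq> h \<star> \<nu>" for \<nu>
    proof (rule ccontr)
      assume F: "F (left \<nu>) (g \<restriction> \<nu>) (right \<nu>) \<noteq> 0"
      have \<nu>': "\<nu> \<in> paths \<Lambda>" "rng \<Lambda> \<nu> = gdom G g" using \<nu>(1) by (auto simp: from_deg_iff)
      note lr = left_right[OF \<nu>']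
      have n': "vec_int (deg \<Lambda> (left \<nu>)) - vec_int (deg \<Lambda> (right \<nu>)) \<in> Per G \<Lambda>"
        using n lr by (simp add: vec_int_add)
      have "right \<nu> = \<theta> (deg \<Lambda> (left \<nu>)) (deg \<Lambda> (right \<nu>)) (left \<nu>)"
        by (rule common_extension_theta[OF n' lr(1,4) _ _ _ F]) (use lr \<nu>' g in auto)
      with theta_periodic(1)[OF n' lr(1) refl] have "periodic (left \<nu>) (\<h> (deg \<Lambda> (left \<nu>)) (deg \<Lambda> (right \<nu>)) (left \<nu>)) (right \<nu>)"
        by simp
      moreover have "periodic (\<kappa> \<cdot> (h \<star> \<nu>)) (h \<restriction> \<nu>) (right \<nu>)"
        using periodic_restrict[OF per \<nu>'(1)] \<nu>' gdom by simp
      moreover have "deg \<Lambda> (\<kappa> \<cdot> (h \<star> \<nu>)) = deg \<Lambda> (left \<nu>)"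
        using lr deg_cat[of \<kappa> "h \<star> \<nu>"] d \<nu>' hg gcod by simp
      ultimately have eq: "left \<nu> = \<kappa> \<cdot> (h \<star> \<nu>)" using periodic_unique'(1) by metis
      have "g \<star> \<nu> = h \<star> \<nu>"
        by (rule cat_cancel(2)[OF _ _ _ _ _ _ eq]) (use \<nu>' \<kappa> g d hg gcod in auto)
      then show False using \<nu>(2) by simp
    qed
    have "(\<Sum>\<nu>\<in>{\<nu> \<in> ?D l. \<not> B \<nu>}. F (left \<nu>) (g \<restriction> \<nu>) (right \<nu>)) =
        (\<Sum>\<nu>\<in>{\<nu> \<in> ?D l. g \<star> \<nu> = h \<star> \<nu> \<and> g \<restriction> \<nu> = h \<restriction> \<nu>}. F (left \<nu>) (g \<restriction> \<nu>) (right \<nu>))"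
    proof (rule sum.mono_neutral_right)
      show "\<forall>\<nu>\<in>{\<nu> \<in> ?D l. \<not> B \<nu>} - {\<nu> \<in> ?D l. g \<star> \<nu> = h \<star> \<nu> \<and> g \<restriction> \<nu> = h \<restriction> \<nu>}.
          F (left \<nu>) (g \<restriction> \<nu>) (right \<nu>) = 0"
        by (intro ballI zero) (auto simp: B_def)
    qed (auto simp: finite_from_deg B_def)
    also have "\<dots> = (\<Sum>\<nu>\<in>{\<nu> \<in> ?D l. g \<star> \<nu> = h \<star> \<nu> \<and> g \<restriction> \<nu> = h \<restriction> \<nu>}.
        of_real (inverse (rho_deg \<Lambda> ?q)) * total ?p ?q * of_real (inverse (rho_deg \<Lambda> (const_deg l)) * x (src \<Lambda> \<nu>)))"
      by (intro sum.cong refl val) auto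
    also have "\<dots> = of_real (inverse (rho_deg \<Lambda> ?q)) * total ?p ?q * of_real (c l)"
      by (simp add: c_def sum_distrib_left)
    finally show ?thesis .
  qed
  \<comment> \<open>Grouping the paths in \<open>c l\<close> by their sources produces the
    cardinalities in the definition of \<open>c_coeff\<close>.\<close>
  have coeff: "c_coeff G \<Lambda> x ?p ?q \<kappa> g = lim c"
  proof -
    have "c l = rho_pow \<Lambda> (\<chi> i. - int l) *
       (\<Sum>v \<in> verts \<Lambda>. real (card {\<nu> \<in> paths_of_degree \<Lambda> (\<chi> i. l).
           rng \<Lambda> \<nu> = gdom G g \<and> src \<Lambda> \<nu> = v \<and>
           act G g \<nu> = act G h \<nu> \<and> restriction G \<Lambda> g \<nu> = restriction G \<Lambda> h \<nu>}) * x v)" for l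
    proof -
      have 1: "(\<chi> i. - int l) = - vec_int (const_deg l)" by (simp add: vec_int_def vec_eq_iff)
      have 2: "{\<nu> \<in> paths_of_degree \<Lambda> (\<chi> i. l). rng \<Lambda> \<nu> = gdom G g \<and> src \<Lambda> \<nu> = v \<and>
           act G g \<nu> = act G h \<nu> \<and> restriction G \<Lambda> g \<nu> = restriction G \<Lambda> h \<nu>} =
           {\<nu> \<in> {\<nu> \<in> ?D l. g \<star> \<nu> = h \<star> \<nu> \<and> g \<restriction> \<nu> = h \<restriction> \<nu>}. src \<Lambda> \<nu> = v}" for v
        by (auto simp: from_deg_iff paths_of_degree_iff)
      have fin: "finite {\<nu> \<in> ?D l. g \<star> \<nu> = h \<star> \<nu> \<and> g \<restriction> \<nu> = h \<restriction> \<nu>}"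
        by (simp add: finite_from_deg)
      have im: "src \<Lambda> ` {\<nu> \<in> ?D l. g \<star> \<nu> = h \<star> \<nu> \<and> g \<restriction> \<nu> = h \<restriction> \<nu>} \<subseteq> verts \<Lambda>"
        by (auto simp: from_deg_iff intro: src_in_verts)
      show ?thesis unfolding 1 2 c_def rho_pow_uminus sum_card_fibres[OF fin finite_verts im] ..
    qed
    then show ?thesis
      unfolding c_coeff_def Let_def theta_h_periodic(2)[OF per] by (intro arg_cong[of _ _ lim] ext) (rule sym)
  qed
  let ?K = "of_real (inverse (rho_deg \<Lambda> ?q)) * total ?p ?q"
  have lim: "(\<lambda>l. F \<kappa> g \<mu> - ?K * of_real (c l)) \<longlonglongrightarrow> 0" using approx unfolding sum .
  show ?thesis unfolding coeff eq_mult_lim[OF lim] by simp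
qed

lemma functional_formula:
  defines "p \<equiv> deg \<Lambda> \<kappa>" and "q \<equiv> deg \<Lambda> \<mu>"
  defines "n \<equiv> vec_int p - vec_int q"
  shows "F \<kappa> g \<mu> =
    (if n \<in> Per G \<Lambda> \<and> \<mu> = theta G \<Lambda> p q \<kappa> \<and> g = h_elem G \<Lambda> p q \<kappa>
       then of_real (rho_pow \<Lambda> (- vec_int q) * x (src \<Lambda> \<mu>)) * total p q
     else if n \<in> Per G \<Lambda> \<and> \<mu> = theta G \<Lambda> p q \<kappa> \<and> g \<noteq> h_elem G \<Lambda> p q \<kappa>
       then of_real (rho_pow \<Lambda> (- vec_int q) * c_coeff G \<Lambda> x p q \<kappa> g) * total p q
     else 0)"
proof (cases "n \<in> Per G \<Lambda>")
  case True
  have t: "periodic \<kappa> (\<h> p q \<kappa>) (\<theta> p q \<kappa>)"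
    by (rule theta_periodic(1)[OF True[unfolded n_def] \<kappa>]) (simp only: p_def)
  show ?thesis
  proof (cases "\<mu> = theta G \<Lambda> p q \<kappa>")
    case \<mu>: True
    have per: "periodic \<kappa> (h_elem G \<Lambda> p q \<kappa>) \<mu>" using t unfolding \<mu>[symmetric] .
    show ?thesis
    proof (cases "g = h_elem G \<Lambda> p q \<kappa>")
      case eq: True
      have "F \<kappa> g \<mu> = of_real (inverse (rho_deg \<Lambda> q) * x (src \<Lambda> \<mu>)) * total p q"
        using functional_periodic_eq[OF per] unfolding p_def q_def eq .
      then show ?thesis unfolding rho_pow_uminus if_P[OF conjI[OF True conjI[OF \<mu> eq]]] .
    next
      case neq: False
      have "F \<kappa> g \<mu> = of_real (inverse (rho_deg \<Lambda> q) * c_coeff G \<Lambda> x p q \<kappa> g) * total p q"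
        using functional_not_h[OF per neq] unfolding p_def q_def .
      then show ?thesis using neq True unfolding rho_pow_uminus if_P[OF conjI[OF True conjI[OF \<mu> neq]]] by argo
    qed
  next
    case False
    then have "F \<kappa> g \<mu> = 0"
      using common_extension_theta[OF True[unfolded n_def p_def q_def] \<kappa> \<mu> g gcod gdom] unfolding p_def q_def by blast
    then show ?thesis using False by simp
  qed
next
  case False
  then have "F \<kappa> g \<mu> = 0" using functional_not_periodic unfolding n_def p_def q_def by blast
  then show ?thesis using False by simp
qed

end

end

section \<open>The Cuntz--Pimsner algebra\<close>

context cstar_algebra
begin

lemma smult_diff_left:
  assumes "a \<in> carrier A"
  shows "(z - w) \<odot> a = z \<odot> a \<ominus> w \<odot> a"
proof -
  have "z \<odot> a = (z - w) \<odot> a \<oplus> w \<odot> a" using smult_add_left[OF assms, of "z - w" w] by simp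
  then show ?thesis using smult_closed[OF assms] by (simp add: minus_eq a_assoc r_neg)
qed

lemma entire_smult:
  assumes "a \<in> carrier A" and f: "\<And>z. (f has_field_derivative f' z) (at z)"
  shows "entire A (\<lambda>z. f z \<odot> a)"
  unfolding entire_def
proof (intro conjI allI)
  fix z
  show "f z \<odot> a \<in> carrier A" using smult_closed assms by simp
  have eq: "nrm A (inverse (w - z) \<odot> (f w \<odot> a \<ominus> f z \<odot> a) \<ominus> f' z \<odot> a) =
      cmod ((f w - f z) / (w - z) - f' z) * nrm A a" for w
    by (simp add: smult_diff_left[OF assms(1), symmetric] smult_assoc[OF assms(1), symmetric]
        nrm_smult[OF assms(1)] divide_inverse mult.commute)
  have "((\<lambda>w. (f w - f z) / (w - z)) \<longlongrightarrow> f' z) (at z)"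
    using f[of z] by (simp add: has_field_derivative_iff)
  then have "((\<lambda>w. cmod ((f w - f z) / (w - z) - f' z) * nrm A a) \<longlongrightarrow> cmod (f' z - f' z) * nrm A a) (at z)"
    by (intro tendsto_intros)
  then show "\<exists>D\<in>carrier A. ((\<lambda>w. nrm A (inverse (w - z) \<odot> (f w \<odot> a \<ominus> f z \<odot> a) \<ominus> D)) \<longlongrightarrow> 0) (at z)"
    unfolding eq by (intro bexI[of _ "f' z \<odot> a"]) (simp_all add: eq smult_closed assms(1))
qed

lemma state_finsum:
  assumes "state A \<phi>" "finite I" "f \<in> I \<rightarrow> carrier A"
  shows "\<phi> (\<Oplus>i\<in>I. f i) = (\<Sum>i\<in>I. \<phi> (f i))"
  using assms(2,3)
proof (induction I rule: finite_induct)
  case empty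
  have "\<phi> (\<zero> \<oplus> \<zero>) = \<phi> \<zero> + \<phi> \<zero>" using assms(1) unfolding state_def by blast
  then show ?case by simp
next
  case (insert i I)
  have f: "f i \<in> carrier A" "f \<in> I \<rightarrow> carrier A" using insert.prems by auto
  then have "\<phi> (f i \<oplus> (\<Oplus>i\<in>I. f i)) = \<phi> (f i) + \<phi> (\<Oplus>i\<in>I. f i)"
    using assms(1) finsum_closed unfolding state_def by blast
  then show ?case using insert f by (simp add: finsum_insert)
qed

lemma finsum_UN_disjoint:
  assumes "finite I" "\<And>i. i \<in> I \<Longrightarrow> finite (J i)" "pairwise (\<lambda>i j. disjnt (J i) (J j)) I"
    "\<And>i j. i \<in> I \<Longrightarrow> j \<in> J i \<Longrightarrow> f j \<in> carrier A"
  shows "(\<Oplus>j\<in>(\<Union>i\<in>I. J i). f j) = (\<Oplus>i\<in>I. \<Oplus>j\<in>J i. f j)"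
  using add.finprod_UN_disjoint[OF assms] .

end

text \<open>The continuation of \<open>rho_imag_pow\<close> from real to complex time.\<close>

definition rho_cpow :: "('m, 'k::finite) kgraph \<Rightarrow> int ^ 'k \<Rightarrow> complex \<Rightarrow> complex" where
  "rho_cpow \<Lambda> n z = (\<Prod>i\<in>UNIV. complex_of_real (rho \<Lambda> i) powr (\<i> * z * of_int (n $ i)))"

text \<open>As each \<open>rho \<Lambda> i\<close> is nonzero, the product is a single exponential
  \<open>exp (z * K)\<close>. At \<i> the exponent \<open>\<i> * \<i> * n\<close> equals -n; this is
  the origin of the scaling factor.\<close>

lemma rho_cpow:
  fixes \<Lambda> :: "('m, 'k::finite) kgraph" and n :: "int ^ 'k"
  assumes "\<And>i. rho \<Lambda> i > 0"
  defines "f \<equiv> rho_cpow \<Lambda> n"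
  shows "(f has_field_derivative f z * (\<Sum>i\<in>UNIV. \<i> * of_int (n $ i) * Ln (of_real (rho \<Lambda> i)))) (at z)"
    and "f (of_real s) = rho_imag_pow \<Lambda> s n" and "f \<i> = of_real (rho_pow \<Lambda> (- n))"
proof -
  let ?K = "\<Sum>i\<in>UNIV. \<i> * of_int (n $ i) * Ln (of_real (rho \<Lambda> i))"
  have nz: "rho \<Lambda> i \<noteq> 0" for i using assms(1)[of i] by simp
  have f: "f z = exp (z * ?K)" for z
    by (simp add: f_def rho_cpow_def powr_def nz exp_sum sum_distrib_left mult_ac)
  have "((\<lambda>z. exp (z * ?K)) has_field_derivative exp (z * ?K) * ?K) (at z)"
    by (auto intro!: derivative_eq_intros)
  then show "(f has_field_derivative f z * ?K) (at z)" unfolding f .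
  show "f (of_real s) = rho_imag_pow \<Lambda> s n" by (simp add: f_def rho_cpow_def rho_imag_pow_def)
  have "complex_of_real (rho \<Lambda> i) powr (\<i> * \<i> * of_int (n $ i)) = of_real (rho \<Lambda> i powi ((- n) $ i))" for i
  proof -
    have "complex_of_real (rho \<Lambda> i) powr (\<i> * \<i> * of_int (n $ i)) =
        of_real (rho \<Lambda> i) powr of_real (real_of_int ((- n) $ i))" by simp
    also have "\<dots> = of_real (rho \<Lambda> i powr real_of_int ((- n) $ i))"
      using assms(1)[of i] by (intro powr_of_real) simp
    also have "rho \<Lambda> i powr real_of_int ((- n) $ i) = rho \<Lambda> i powi ((- n) $ i)"
      using assms(1)[of i] by (intro powr_real_of_int') auto
    finally show ?thesis .
  qed
  then show "f \<i> = of_real (rho_pow \<Lambda> (- n))" by (simp add: f_def rho_cpow_def rho_pow_def)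
qed

section \<open>The KMS state on spanning elements\<close>

locale KMS_action = pf_action G \<Lambda> x + cstar_algebra A
  for G :: "('g, 'm) acting_groupoid" and \<Lambda> :: "('m, 'k::finite) kgraph" and x :: "'m \<Rightarrow> real"
    and A :: "'a cstar" (structure) +
  fixes u :: "'g \<Rightarrow> 'a" and t :: "'m \<Rightarrow> 'a" and \<sigma> :: "real \<Rightarrow> 'a \<Rightarrow> 'a" and \<phi> :: "'a \<Rightarrow> complex"
  assumes relations: "CP_relations G \<Lambda> A u t"
    and dyn: "preferred_dynamics G \<Lambda> A u t \<sigma>"
    and KMS: "KMS_state A \<sigma> 1 \<phi>"
begin

lemma urep: "unitary_representation G \<Lambda> A u" and CK: "CK_family \<Lambda> A t" and TCK: "TCK_family \<Lambda> A t"
  using relations by (auto simp: CP_relations_def CK_family_def)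

lemma t_closed [simp]: "\<kappa> \<in> paths \<Lambda> \<Longrightarrow> t \<kappa> \<in> carrier A"
  using TCK by (simp add: TCK_family_def partial_isometry_def)

lemma u_closed [simp]: "g \<in> elems G \<Longrightarrow> u g \<in> carrier A"
  using urep by (simp add: unitary_representation_def partial_isometry_def)

lemma t_star_closed [simp]: "\<kappa> \<in> paths \<Lambda> \<Longrightarrow> adj A (t \<kappa>) \<in> carrier A"
  by (simp add: adj_closed)

lemma t_mult: "\<kappa> \<in> paths \<Lambda> \<Longrightarrow> \<mu> \<in> paths \<Lambda> \<Longrightarrow> src \<Lambda> \<kappa> = rng \<Lambda> \<mu> \<Longrightarrow> t \<kappa> \<otimes> t \<mu> = t (\<kappa> \<cdot> \<mu>)"
  using TCK unfolding TCK_family_def by blast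

lemma t_star_mult:
  "\<kappa> \<in> paths \<Lambda> \<Longrightarrow> \<mu> \<in> paths \<Lambda> \<Longrightarrow> src \<Lambda> \<kappa> = rng \<Lambda> \<mu> \<Longrightarrow> adj A (t \<mu>) \<otimes> adj A (t \<kappa>) = adj A (t (\<kappa> \<cdot> \<mu>))"
  using t_mult[of \<kappa> \<mu>] adj_mult[of "t \<kappa>" "t \<mu>"] by simp

lemma t_vertex_star: "v \<in> verts \<Lambda> \<Longrightarrow> adj A (t v) = t v"
  using TCK unfolding TCK_family_def mutually_orthogonal_projections_def by blast

lemma u_gunit: "v \<in> verts \<Lambda> \<Longrightarrow> u (gunit G v) = t v"
  using relations unfolding CP_relations_def by blast

lemma u_mult: "g \<in> elems G \<Longrightarrow> h \<in> elems G \<Longrightarrow> gdom G g = gcod G h \<Longrightarrow> u g \<otimes> u h = u (gmult G g h)"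
  using urep unfolding unitary_representation_def by auto

lemma u_t_gdom: "g \<in> elems G \<Longrightarrow> u g \<otimes> t (gdom G g) = u g"
  using u_mult[of g "gunit G (gdom G g)"] gdom_closed[of g] u_gunit gunit_closed gcod_gunit gmult_gunit_right by simp

lemma t_gcod_u: "g \<in> elems G \<Longrightarrow> t (gcod G g) \<otimes> u g = u g"
  using u_mult[of "gunit G (gcod G g)" g] gcod_closed[of g] u_gunit gunit_closed gdom_gunit gmult_gunit_left by simp

lemma t_src: "\<kappa> \<in> paths \<Lambda> \<Longrightarrow> t \<kappa> \<otimes> t (src \<Lambda> \<kappa>) = t \<kappa>"
  using t_mult[of \<kappa> "src \<Lambda> \<kappa>"] src_in_verts[of \<kappa>] deg_verts rng_src_verts cat_src by simp

lemma t_star_rng: "\<kappa> \<in> paths \<Lambda> \<Longrightarrow> adj A (t \<kappa>) \<otimes> t (rng \<Lambda> \<kappa>) = adj A (t \<kappa>)"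
  using t_star_mult[of "rng \<Lambda> \<kappa>" \<kappa>] rng_in_verts[of \<kappa>] deg_verts rng_src_verts cat_rng t_vertex_star by simp

lemma t_star_t:
  assumes "\<kappa> \<in> paths \<Lambda>" "\<mu> \<in> paths \<Lambda>"
  shows "adj A (t \<kappa>) \<otimes> t \<mu> = (\<Oplus>\<eta>\<zeta> \<in> min_extensions \<Lambda> \<kappa> \<mu>. t (fst \<eta>\<zeta>) \<otimes> adj A (t (snd \<eta>\<zeta>)))"
  using TCK assms unfolding TCK_family_def by blast

text \<open>The join of a degree with itself is that degree, so a minimal extension of \<kappa> with
  itself adds degree 0 on each side.\<close>

lemma t_star_t_same:
  assumes "\<kappa> \<in> paths \<Lambda>"
  shows "adj A (t \<kappa>) \<otimes> t \<kappa> = t (src \<Lambda> \<kappa>)"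
proof -
  have v: "src \<Lambda> \<kappa> \<in> verts \<Lambda>" "src \<Lambda> \<kappa> \<in> paths \<Lambda>" "rng \<Lambda> (src \<Lambda> \<kappa>) = src \<Lambda> \<kappa>"
    using src_in_verts[OF assms] deg_verts rng_src_verts by auto
  have j: "vec_join p p = p" for p :: "nat ^ 'k" by (simp add: vec_join_def vec_eq_iff)
  have "\<eta> = src \<Lambda> \<kappa>" if \<eta>: "\<eta> \<in> paths \<Lambda>" "rng \<Lambda> \<eta> = src \<Lambda> \<kappa>" "deg \<Lambda> (\<kappa> \<cdot> \<eta>) = deg \<Lambda> \<kappa>" for \<eta>
  proof -
    have "deg \<Lambda> \<eta> = 0" using \<eta> deg_cat[of \<kappa> \<eta>] assms by simp
    then have "\<eta> \<in> verts \<Lambda>" using \<eta> by (simp add: verts_def paths_of_degree_iff)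
    then show ?thesis using rng_src_verts \<eta>(2) by simp
  qed
  moreover have "deg \<Lambda> (\<kappa> \<cdot> \<zeta>) = deg \<Lambda> \<kappa>" if "\<kappa> \<cdot> \<eta> = \<kappa> \<cdot> \<zeta>" "deg \<Lambda> (\<kappa> \<cdot> \<eta>) = deg \<Lambda> \<kappa>" for \<eta> \<zeta> using that by simp
  ultimately have "min_extensions \<Lambda> \<kappa> \<kappa> = {(src \<Lambda> \<kappa>, src \<Lambda> \<kappa>)}"
    unfolding min_extensions_def j paths_from_iff using v cat_src[OF assms] by fastforce
  then have "adj A (t \<kappa>) \<otimes> t \<kappa> = t (src \<Lambda> \<kappa>) \<otimes> adj A (t (src \<Lambda> \<kappa>))"
    using t_star_t[OF assms assms] v by simp
  also have "\<dots> = t (src \<Lambda> \<kappa>)" using t_vertex_star v t_src[OF v(2)] rng_src_verts by simp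
  finally show ?thesis .
qed

lemma t_star_t_zero:
  assumes "\<kappa> \<in> paths \<Lambda>" "\<mu> \<in> paths \<Lambda>"
    "\<And>\<eta> \<zeta>. \<lbrakk>\<eta> \<in> paths \<Lambda>; \<zeta> \<in> paths \<Lambda>; src \<Lambda> \<kappa> = rng \<Lambda> \<eta>; src \<Lambda> \<mu> = rng \<Lambda> \<zeta>\<rbrakk> \<Longrightarrow> \<kappa> \<cdot> \<eta> \<noteq> \<mu> \<cdot> \<zeta>"
  shows "adj A (t \<mu>) \<otimes> t \<kappa> = \<zero>"
proof -
  have "min_extensions \<Lambda> \<mu> \<kappa> = {}"
    unfolding min_extensions_def paths_from_iff using assms(3) by fastforce
  then show ?thesis using t_star_t[OF assms(2,1)] by simp
qed

lemma t_vertex_sum: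
  "v \<in> verts \<Lambda> \<Longrightarrow> t v = (\<Oplus>\<nu>\<in>from_deg \<Lambda> v r. t \<nu> \<otimes> adj A (t \<nu>))"
  using CK unfolding CK_family_def from_deg_def by blast

lemma u_t:
  "g \<in> elems G \<Longrightarrow> \<nu> \<in> paths \<Lambda> \<Longrightarrow> rng \<Lambda> \<nu> = gdom G g \<Longrightarrow> u g \<otimes> t \<nu> = t (g \<star> \<nu>) \<otimes> u (g \<restriction> \<nu>)"
  using relations unfolding CP_relations_def by auto

definition spanning :: "'m \<Rightarrow> 'g \<Rightarrow> 'm \<Rightarrow> 'a" where
  "spanning \<kappa> g \<mu> = t \<kappa> \<otimes> u g \<otimes> adj A (t \<mu>)"

lemma spanning_closed [simp]:
  "\<kappa> \<in> paths \<Lambda> \<Longrightarrow> g \<in> elems G \<Longrightarrow> \<mu> \<in> paths \<Lambda> \<Longrightarrow> spanning \<kappa> g \<mu> \<in> carrier A"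
  by (simp add: spanning_def)

text \<open>The Cuntz--Krieger sum at \<open>gdom G g\<close> is inserted to the right of
  \<open>u g\<close>; each \<open>t \<nu>\<close> is then moved to the left through
  \<open>u g\<close>, while its adjoint joins that of \<open>t \<mu>\<close>.\<close>

lemma spanning_expand:
  assumes "\<kappa> \<in> paths \<Lambda>" "\<mu> \<in> paths \<Lambda>" "g \<in> elems G" "src \<Lambda> \<kappa> = gcod G g" "src \<Lambda> \<mu> = gdom G g"
  shows "spanning \<kappa> g \<mu> = (\<Oplus>\<nu>\<in>from_deg \<Lambda> (gdom G g) r. spanning (\<kappa> \<cdot> (g \<star> \<nu>)) (g \<restriction> \<nu>) (\<mu> \<cdot> \<nu>))"
proof -
  let ?D = "from_deg \<Lambda> (gdom G g) r"
  have D: "\<nu> \<in> paths \<Lambda>" "rng \<Lambda> \<nu> = gdom G g" if "\<nu> \<in> ?D" for \<nu> using that by (auto simp: from_deg_iff)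
  have cl: "(\<lambda>\<nu>. t \<nu> \<otimes> adj A (t \<nu>)) \<in> ?D \<rightarrow> carrier A" using D by auto
  have "t \<kappa> \<otimes> u g = (t \<kappa> \<otimes> u g) \<otimes> t (gdom G g)" using u_t_gdom assms gdom_closed deg_verts by (simp add: m_assoc)
  also have "\<dots> = (\<Oplus>\<nu>\<in>?D. (t \<kappa> \<otimes> u g) \<otimes> (t \<nu> \<otimes> adj A (t \<nu>)))"
    unfolding t_vertex_sum[OF gdom_closed[OF assms(3)], of r] using assms cl finite_from_deg by (intro finsum_rdistr) auto
  finally have eq: "t \<kappa> \<otimes> u g = (\<Oplus>\<nu>\<in>?D. (t \<kappa> \<otimes> u g) \<otimes> (t \<nu> \<otimes> adj A (t \<nu>)))" .
  have "spanning \<kappa> g \<mu> = (\<Oplus>\<nu>\<in>?D. (t \<kappa> \<otimes> u g) \<otimes> (t \<nu> \<otimes> adj A (t \<nu>))) \<otimes> adj A (t \<mu>)"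
    unfolding spanning_def using eq by simp
  also have "\<dots> = (\<Oplus>\<nu>\<in>?D. (t \<kappa> \<otimes> u g) \<otimes> (t \<nu> \<otimes> adj A (t \<nu>)) \<otimes> adj A (t \<mu>))"
    using assms D finite_from_deg by (intro finsum_ldistr) auto
  also have "\<dots> = (\<Oplus>\<nu>\<in>?D. spanning (\<kappa> \<cdot> (g \<star> \<nu>)) (g \<restriction> \<nu>) (\<mu> \<cdot> \<nu>))"
  proof (rule finsum_cong')
    show "(\<lambda>\<nu>. spanning (\<kappa> \<cdot> (g \<star> \<nu>)) (g \<restriction> \<nu>) (\<mu> \<cdot> \<nu>)) \<in> ?D \<rightarrow> carrier A"
      using D assms cat_closed by auto
    fix \<nu> assume "\<nu> \<in> ?D"
    note \<nu> = D[OF this]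
    have "(t \<kappa> \<otimes> u g) \<otimes> (t \<nu> \<otimes> adj A (t \<nu>)) \<otimes> adj A (t \<mu>) =
        t \<kappa> \<otimes> ((u g \<otimes> t \<nu>) \<otimes> (adj A (t \<nu>) \<otimes> adj A (t \<mu>)))"
      using assms \<nu> by (simp add: m_assoc)
    also have "\<dots> = (t \<kappa> \<otimes> t (g \<star> \<nu>)) \<otimes> u (g \<restriction> \<nu>) \<otimes> (adj A (t \<nu>) \<otimes> adj A (t \<mu>))"
      unfolding u_t[OF assms(3) \<nu>] using assms \<nu> by (simp add: m_assoc)
    also have "\<dots> = spanning (\<kappa> \<cdot> (g \<star> \<nu>)) (g \<restriction> \<nu>) (\<mu> \<cdot> \<nu>)"
      unfolding spanning_def using t_mult[of \<kappa> "g \<star> \<nu>"] t_star_mult[of \<mu> \<nu>] assms \<nu> by simp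
    finally show "(t \<kappa> \<otimes> u g) \<otimes> (t \<nu> \<otimes> adj A (t \<nu>)) \<otimes> adj A (t \<mu>) =
      spanning (\<kappa> \<cdot> (g \<star> \<nu>)) (g \<restriction> \<nu>) (\<mu> \<cdot> \<nu>)" .
  qed simp
  finally show ?thesis .
qed

lemma spanning_analytic:
  assumes "\<kappa> \<in> paths \<Lambda>" "\<mu> \<in> paths \<Lambda>" "g \<in> elems G"
  shows "\<exists>F. analytic_extension A \<sigma> (spanning \<kappa> g \<mu>) F \<and>
    F \<i> = of_real (rho_pow \<Lambda> (- (vec_int (deg \<Lambda> \<kappa>) - vec_int (deg \<Lambda> \<mu>)))) \<odot> spanning \<kappa> g \<mu>"
proof -
  note d = rho_cpow[where \<Lambda> = \<Lambda> and n = "vec_int (deg \<Lambda> \<kappa>) - vec_int (deg \<Lambda> \<mu>)", OF rho_pos]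
  have "entire A (\<lambda>z. rho_cpow \<Lambda> (vec_int (deg \<Lambda> \<kappa>) - vec_int (deg \<Lambda> \<mu>)) z \<odot> spanning \<kappa> g \<mu>)"
    by (rule entire_smult[OF spanning_closed[OF assms(1,3,2)] d(1)])
  then show ?thesis
    using dyn assms d(2,3) unfolding analytic_extension_def preferred_dynamics_def spanning_def by fastforce
qed

lemma KMS_spanning:
  assumes "\<kappa> \<in> paths \<Lambda>" "\<mu> \<in> paths \<Lambda>" "g \<in> elems G" "\<kappa>' \<in> paths \<Lambda>" "\<mu>' \<in> paths \<Lambda>" "g' \<in> elems G"
  shows "\<phi> (spanning \<kappa> g \<mu> \<otimes> spanning \<kappa>' g' \<mu>') =
    of_real (rho_pow \<Lambda> (- (vec_int (deg \<Lambda> \<kappa>) - vec_int (deg \<Lambda> \<mu>)))) * \<phi> (spanning \<kappa>' g' \<mu>' \<otimes> spanning \<kappa> g \<mu>)"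
proof -
  let ?a = "spanning \<kappa> g \<mu>" and ?b = "spanning \<kappa>' g' \<mu>'"
  let ?r = "of_real (rho_pow \<Lambda> (- (vec_int (deg \<Lambda> \<kappa>) - vec_int (deg \<Lambda> \<mu>)))) :: complex"
  obtain F where F: "analytic_extension A \<sigma> ?a F" "F \<i> = ?r \<odot> ?a" using spanning_analytic[OF assms(1-3)] by blast
  obtain F' where F': "analytic_extension A \<sigma> ?b F'" using spanning_analytic[OF assms(4-6)] by blast
  have cl: "?a \<in> carrier A" "?b \<in> carrier A" using assms by auto
  have "\<phi> (?a \<otimes> ?b) = \<phi> (?b \<otimes> F (\<i> * of_real 1))"
    using KMS F(1) F' cl unfolding KMS_state_def analytic_element_def by blast
  also have "\<dots> = \<phi> (?r \<odot> (?b \<otimes> ?a))" using F(2) smult_mult_right[OF cl(2,1)] by simp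
  also have "\<dots> = ?r * \<phi> (?b \<otimes> ?a)" using KMS cl unfolding KMS_state_def state_def by blast
  finally show ?thesis .
qed

text \<open>This exhibits \<open>t \<kappa>\<close> as a spanning element of degree difference
  \<open>deg \<Lambda> \<kappa>\<close>, so that the KMS relation can move it on its own.\<close>

lemma t_spanning: "\<kappa> \<in> paths \<Lambda> \<Longrightarrow> t \<kappa> = spanning \<kappa> (gunit G (src \<Lambda> \<kappa>)) (src \<Lambda> \<kappa>)"
  unfolding spanning_def
  using src_in_verts[of \<kappa>] u_gunit t_src t_vertex_star deg_verts by simp

lemma KMS_t:
  assumes "\<kappa> \<in> paths \<Lambda>" "\<kappa>' \<in> paths \<Lambda>" "\<mu>' \<in> paths \<Lambda>" "g' \<in> elems G"
  shows "\<phi> (t \<kappa> \<otimes> spanning \<kappa>' g' \<mu>') = of_real (inverse (rho_deg \<Lambda> (deg \<Lambda> \<kappa>))) * \<phi> (spanning \<kappa>' g' \<mu>' \<otimes> t \<kappa>)"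
proof -
  have v: "src \<Lambda> \<kappa> \<in> verts \<Lambda>" using src_in_verts assms by simp
  have d: "vec_int (deg \<Lambda> (src \<Lambda> \<kappa>)) = 0" using deg_verts[OF v] by (simp add: vec_int_def vec_eq_iff)
  show ?thesis
    using KMS_spanning[OF assms(1) deg_verts(2)[OF v] gunit_closed[OF v] assms(2-4)]
    by (simp add: t_spanning[OF assms(1), symmetric] d rho_pow_uminus)
qed

text \<open>The KMS relation moves the leading \<open>t \<kappa>\<close> to the right end, where it
  meets the adjoint of \<open>t \<kappa>\<close> and is absorbed as a vertex projection.\<close>

lemma spanning_scale:
  assumes "\<kappa> \<in> paths \<Lambda>" "\<alpha> \<in> paths \<Lambda>" "\<beta> \<in> paths \<Lambda>" "g \<in> elems G" "src \<Lambda> \<kappa> = rng \<Lambda> \<alpha>" "src \<Lambda> \<kappa> = rng \<Lambda> \<beta>"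
  shows "\<phi> (spanning (\<kappa> \<cdot> \<alpha>) g (\<kappa> \<cdot> \<beta>)) = of_real (inverse (rho_deg \<Lambda> (deg \<Lambda> \<kappa>))) * \<phi> (spanning \<alpha> g \<beta>)"
proof -
  have cat: "\<kappa> \<cdot> \<beta> \<in> paths \<Lambda>" using cat_closed assms by simp
  have "spanning (\<kappa> \<cdot> \<alpha>) g (\<kappa> \<cdot> \<beta>) = t \<kappa> \<otimes> spanning \<alpha> g (\<kappa> \<cdot> \<beta>)"
    unfolding spanning_def t_mult[OF assms(1,2,5), symmetric] using assms cat by (simp add: m_assoc)
  moreover have "spanning \<alpha> g (\<kappa> \<cdot> \<beta>) \<otimes> t \<kappa> = (t \<alpha> \<otimes> u g) \<otimes> (adj A (t \<beta>) \<otimes> (adj A (t \<kappa>) \<otimes> t \<kappa>))"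
    unfolding spanning_def t_star_mult[OF assms(1,3,6), symmetric] using assms by (simp add: m_assoc)
  moreover have "\<dots> = spanning \<alpha> g \<beta>"
    unfolding t_star_t_same[OF assms(1)] assms(6) t_star_rng[OF assms(3)] spanning_def ..
  ultimately show ?thesis using KMS_t[OF assms(1,2) cat assms(4)] by simp
qed

text \<open>The same cyclic move brings \<open>t \<kappa>\<close> next to the adjoint of
  \<open>t \<mu>\<close>, and this product vanishes because there are no minimal extensions.\<close>

lemma spanning_orthogonal:
  assumes "\<kappa> \<in> paths \<Lambda>" "\<mu> \<in> paths \<Lambda>" "g \<in> elems G"
    "\<And>\<eta> \<zeta>. \<lbrakk>\<eta> \<in> paths \<Lambda>; \<zeta> \<in> paths \<Lambda>; src \<Lambda> \<kappa> = rng \<Lambda> \<eta>; src \<Lambda> \<mu> = rng \<Lambda> \<zeta>\<rbrakk> \<Longrightarrow> \<kappa> \<cdot> \<eta> \<noteq> \<mu> \<cdot> \<zeta>"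
  shows "\<phi> (spanning \<kappa> g \<mu>) = 0"
proof -
  have v: "gcod G g \<in> verts \<Lambda>" using gcod_closed assms by simp
  \<comment> \<open>The KMS relation is available for spanning elements only; the vertex
    \<open>gcod G g\<close> as left path makes the remainder one.\<close>
  have b: "spanning (gcod G g) g \<mu> = u g \<otimes> adj A (t \<mu>)" unfolding spanning_def using t_gcod_u assms by simp
  have "spanning \<kappa> g \<mu> = t \<kappa> \<otimes> spanning (gcod G g) g \<mu>" unfolding b spanning_def[of \<kappa>] using assms by (simp add: m_assoc)
  moreover have "spanning (gcod G g) g \<mu> \<otimes> t \<kappa> = u g \<otimes> (adj A (t \<mu>) \<otimes> t \<kappa>)"
    unfolding b using assms(1-3) by (simp add: m_assoc)
  moreover have "adj A (t \<mu>) \<otimes> t \<kappa> = \<zero>" by (rule t_star_t_zero[OF assms(1,2)]) (rule assms(4))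
  moreover have "\<phi> \<zero> = 0" using state_finsum[of \<phi> "{}"] KMS by (simp add: KMS_state_def)
  ultimately show ?thesis using KMS_t[OF assms(1) deg_verts(2)[OF v] assms(2,3)] assms(3) by simp
qed

sublocale scaling_functional G \<Lambda> x "\<lambda>\<kappa> g \<mu>. \<phi> (spanning \<kappa> g \<mu>)"
proof
  fix \<kappa> \<mu> g r
  assume *: "\<kappa> \<in> paths \<Lambda>" "\<mu> \<in> paths \<Lambda>" "g \<in> elems G" "src \<Lambda> \<kappa> = gcod G g" "src \<Lambda> \<mu> = gdom G g"
  have cl: "(\<lambda>\<nu>. spanning (\<kappa> \<cdot> (g \<star> \<nu>)) (g \<restriction> \<nu>) (\<mu> \<cdot> \<nu>)) \<in> from_deg \<Lambda> (gdom G g) r \<rightarrow> carrier A"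
    using * cat_closed by (auto simp: from_deg_iff)
  show "\<phi> (spanning \<kappa> g \<mu>) = (\<Sum>\<nu>\<in>from_deg \<Lambda> (gdom G g) r. \<phi> (spanning (\<kappa> \<cdot> (g \<star> \<nu>)) (g \<restriction> \<nu>) (\<mu> \<cdot> \<nu>)))"
    unfolding spanning_expand[OF *, of r] using KMS
    by (intro state_finsum finite_from_deg cl) (simp add: KMS_state_def)
qed (use spanning_scale spanning_orthogonal in blast)+

section \<open>The elements V and the final assembly\<close>

definition V_sum :: "nat ^ 'k \<Rightarrow> nat ^ 'k \<Rightarrow> 'a" where
  "V_sum p q = (\<Oplus>\<kappa>\<in>paths_of_degree \<Lambda> p. spanning \<kappa> (\<h> p q \<kappa>) (\<theta> p q \<kappa>))"

text \<open>The argument of \<open>mass_shift\<close>, carried out in the algebra instead of for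
  values of the state. It is what makes the definite description in \<open>V_elem\<close>
  denote.\<close>

lemma V_sum_shift:
  assumes n: "vec_int p - vec_int q \<in> Per G \<Lambda>"
  shows "V_sum (p + r) (q + r) = V_sum p q"
proof -
  let ?n = "vec_int (p + r) - vec_int (q + r)"
  have n': "?n \<in> Per G \<Lambda>" using n by (simp add: vec_int_add)
  \<comment> \<open>The paths of degree p + r are grouped by their initial segments of degree p, so
    that each group can be recognised as the expansion of one summand of
    \<open>V_sum p q\<close>.\<close>
  define J where "J \<kappa> = (\<lambda>\<nu>. \<kappa> \<cdot> \<nu>) ` from_deg \<Lambda> (src \<Lambda> \<kappa>) r" for \<kappa>
  define f where "f \<kappa> = spanning \<kappa> (\<h> (p + r) (q + r) \<kappa>) (\<theta> (p + r) (q + r) \<kappa>)" for \<kappa>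
  have f: "f \<kappa> \<in> carrier A" if "\<kappa> \<in> paths \<Lambda>" "deg \<Lambda> \<kappa> = p + r" for \<kappa>
    unfolding f_def using periodicD[OF theta_periodic(1)[OF n' that]] by simp
  have J: "\<zeta> \<in> paths \<Lambda>" "deg \<Lambda> \<zeta> = p + r" "pre \<Lambda> p \<zeta> = \<kappa>" if "\<kappa> \<in> paths_of_degree \<Lambda> p" "\<zeta> \<in> J \<kappa>" for \<kappa> \<zeta>
    using that cat_closed deg_cat pre_cat_deg by (auto simp: J_def from_deg_iff paths_of_degree_iff)
  have U: "paths_of_degree \<Lambda> (p + r) = (\<Union>\<kappa>\<in>paths_of_degree \<Lambda> p. J \<kappa>)"
  proof (intro equalityI subsetI)
    fix \<zeta> assume "\<zeta> \<in> paths_of_degree \<Lambda> (p + r)"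
    then have \<zeta>: "\<zeta> \<in> paths \<Lambda>" "p \<le> deg \<Lambda> \<zeta>" "deg \<Lambda> \<zeta> = p + r" by (auto simp: paths_of_degree_iff)
    note ps = pre_suf[OF \<zeta>(1,2)]
    have "\<zeta> \<in> J (pre \<Lambda> p \<zeta>)" unfolding J_def
      by (rule image_eqI[of _ _ "suf \<Lambda> p \<zeta>"]) (use ps \<zeta> in \<open>auto simp: from_deg_iff\<close>)
    then show "\<zeta> \<in> (\<Union>\<kappa>\<in>paths_of_degree \<Lambda> p. J \<kappa>)" using ps by (auto simp: paths_of_degree_iff)
  next
    fix \<zeta> assume "\<zeta> \<in> (\<Union>\<kappa>\<in>paths_of_degree \<Lambda> p. J \<kappa>)"
    then obtain \<kappa> where \<kappa>: "\<kappa> \<in> paths_of_degree \<Lambda> p" "\<zeta> \<in> J \<kappa>" by blast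
    show "\<zeta> \<in> paths_of_degree \<Lambda> (p + r)" using J(1,2)[OF \<kappa>] by (simp add: paths_of_degree_iff)
  qed
  have fJ: "f \<zeta> \<in> carrier A" if "\<kappa> \<in> paths_of_degree \<Lambda> p" "\<zeta> \<in> J \<kappa>" for \<kappa> \<zeta>
    using f J(1,2)[OF that] by blast
  have "V_sum (p + r) (q + r) = (\<Oplus>\<kappa>\<in>paths_of_degree \<Lambda> p. \<Oplus>\<zeta>\<in>J \<kappa>. f \<zeta>)"
    unfolding V_sum_def f_def[symmetric] U
  proof (rule finsum_UN_disjoint)
    show "pairwise (\<lambda>i j. disjnt (J i) (J j)) (paths_of_degree \<Lambda> p)"
      unfolding pairwise_def disjnt_iff by (metis J(3))
    show "f \<zeta> \<in> carrier A" if "\<kappa> \<in> paths_of_degree \<Lambda> p" "\<zeta> \<in> J \<kappa>" for \<kappa> \<zeta>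
      using fJ that .
  qed (simp_all add: J_def finite_from_deg finite_paths_of_degree)
  also have "\<dots> = V_sum p q" unfolding V_sum_def
  proof (rule finsum_cong')
    show "(\<lambda>\<kappa>. spanning \<kappa> (\<h> p q \<kappa>) (\<theta> p q \<kappa>)) \<in> paths_of_degree \<Lambda> p \<rightarrow> carrier A"
      using periodicD(1-3)[OF theta_periodic(1)[OF n]] by (auto simp: paths_of_degree_iff)
    fix \<kappa> assume \<kappa>p: "\<kappa> \<in> paths_of_degree \<Lambda> p"
    then have \<kappa>: "\<kappa> \<in> paths \<Lambda>" "deg \<Lambda> \<kappa> = p" by (auto simp: paths_of_degree_iff)
    note t = theta_periodic[OF n \<kappa>]
    note d = periodicD[OF t(1)]
    let ?h = "\<h> p q \<kappa>" and ?\<mu> = "\<theta> p q \<kappa>"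
    let ?D = "from_deg \<Lambda> (gdom G ?h) r"
    have D: "\<nu> \<in> paths \<Lambda>" "rng \<Lambda> \<nu> = gdom G ?h" "deg \<Lambda> \<nu> = r" if "\<nu> \<in> ?D" for \<nu>
      using that by (auto simp: from_deg_iff)
    \<comment> \<open>The extensions of \<kappa> are reparametrised by \<open>?h\<close>, because
      the expansion is indexed by paths at the domain of \<open>?h\<close>, not at the source of
      \<kappa>.\<close>
    have img: "J \<kappa> = (\<lambda>\<nu>. \<kappa> \<cdot> (?h \<star> \<nu>)) ` ?D"
      unfolding J_def bij_betw_imp_surj_on[OF act_bij_betw[OF d(3)], of r, unfolded d(4), symmetric] image_image ..
    have inj: "inj_on (\<lambda>\<nu>. \<kappa> \<cdot> (?h \<star> \<nu>)) ?D"
    proof (rule inj_onI)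
      fix \<nu> \<nu>' assume *: "\<nu> \<in> ?D" "\<nu>' \<in> ?D" "\<kappa> \<cdot> (?h \<star> \<nu>) = \<kappa> \<cdot> (?h \<star> \<nu>')"
      have "?h \<star> \<nu> = ?h \<star> \<nu>'"
        by (rule cat_cancel(2)[OF _ _ _ _ _ _ *(3)]) (use \<kappa> d(3-5) D *(1,2) in simp_all)
      then show "\<nu> = \<nu>'" using act_inject[OF d(3)] D *(1,2) by blast
    qed
    have "(\<Oplus>\<zeta>\<in>J \<kappa>. f \<zeta>) = (\<Oplus>\<nu>\<in>?D. f (\<kappa> \<cdot> (?h \<star> \<nu>)))"
      unfolding img by (rule finsum_reindex[OF _ inj]) (use fJ[OF \<kappa>p] in \<open>auto simp: img\<close>)
    also have "\<dots> = (\<Oplus>\<nu>\<in>?D. spanning (\<kappa> \<cdot> (?h \<star> \<nu>)) (?h \<restriction> \<nu>) (?\<mu> \<cdot> \<nu>))"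
    proof (rule finsum_cong')
      show "(\<lambda>\<nu>. spanning (\<kappa> \<cdot> (?h \<star> \<nu>)) (?h \<restriction> \<nu>) (?\<mu> \<cdot> \<nu>)) \<in> ?D \<rightarrow> carrier A"
        using D \<kappa> d(2-5) cat_closed by auto
      fix \<nu> assume "\<nu> \<in> ?D"
      note \<nu> = D[OF this]
      have "deg \<Lambda> (?\<mu> \<cdot> \<nu>) = q + r" using deg_cat d \<nu> t by simp
      then show "f (\<kappa> \<cdot> (?h \<star> \<nu>)) = spanning (\<kappa> \<cdot> (?h \<star> \<nu>)) (?h \<restriction> \<nu>) (?\<mu> \<cdot> \<nu>)"
        using theta_h_periodic[OF periodic_restrict[OF t(1) \<nu>(1) \<nu>(2)[unfolded d(5)]], of "p + r"] by (simp add: f_def)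
    qed simp
    also have "\<dots> = spanning \<kappa> ?h ?\<mu>" using spanning_expand[OF d(1-3) d(4,5)[symmetric], of r] ..
    finally show "(\<Oplus>\<zeta>\<in>J \<kappa>. f \<zeta>) = spanning \<kappa> ?h ?\<mu>" .
  qed simp
  finally show ?thesis .
qed

text \<open>Two representations p - q = p' - q' have a common shift: adding p' to the first pair and
  p to the second gives the same pair, since q + p' = q' + p.\<close>

lemma V_elem_eq:
  assumes n: "vec_int p - vec_int q \<in> Per G \<Lambda>"
  shows "V_elem G \<Lambda> A u t (vec_int p - vec_int q) = V_sum p q"
proof -
  have "V_sum p q = V_sum p' q'" if eq: "vec_int p' - vec_int q' = vec_int p - vec_int q" for p' q'
  proof -
    have "q + p' = q' + p" using eq by (simp add: vec_int_diff_eq_iff add.commute)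
    then have "V_sum (p + p') (q + p') = V_sum (p' + p) (q' + p)" by (simp add: add.commute)
    then show ?thesis using V_sum_shift[OF n] V_sum_shift[of p' q'] n eq by simp
  qed
  then show ?thesis unfolding V_elem_def spanning_def[symmetric] V_sum_def[symmetric]
    by (intro the_equality) blast+
qed

lemma state_V_elem:
  assumes n: "vec_int p - vec_int q \<in> Per G \<Lambda>"
  shows "\<phi> (V_elem G \<Lambda> A u t (vec_int p - vec_int q)) = total p q"
  unfolding V_elem_eq[OF n] V_sum_def total_def Psi_def
proof (rule state_finsum)
  show "state A \<phi>" using KMS by (simp add: KMS_state_def)
  show "(\<lambda>\<kappa>. spanning \<kappa> (\<h> p q \<kappa>) (\<theta> p q \<kappa>)) \<in> paths_of_degree \<Lambda> p \<rightarrow> carrier A"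
    using periodicD(1-3)[OF theta_periodic(1)[OF n]] by (auto simp: paths_of_degree_iff)
qed (rule finite_paths_of_degree)

end

theorem theorem12p1:
  fixes \<Lambda> :: "('m, 'k::finite) kgraph"
    and G :: "('g, 'm) acting_groupoid"
    and x :: "'m \<Rightarrow> real"
    and A :: "'a cstar"
    and u :: "'g \<Rightarrow> 'a"
    and t :: "'m \<Rightarrow> 'a"
    and \<sigma> :: "real \<Rightarrow> 'a \<Rightarrow> 'a"
    and \<phi> :: "'a \<Rightarrow> complex"
    and \<kappa> \<mu> :: 'm
    and g :: 'g
  assumes "k_graph \<Lambda>"
    and "strongly_connected \<Lambda>"
    and "finite_kgraph \<Lambda>"
    and "self_similar_action G \<Lambda>"
    and "finite_state G \<Lambda>"
    and "unimodular_PF_eigenvector \<Lambda> x"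
    and "Cuntz_Pimsner_algebra G \<Lambda> A u t"
    and "preferred_dynamics G \<Lambda> A u t \<sigma>"
    and "KMS_state A \<sigma> 1 \<phi>"
    and "\<kappa> \<in> paths \<Lambda>" and "\<mu> \<in> paths \<Lambda>" and "g \<in> elems G"
    and "src \<Lambda> \<kappa> = gcod G g" and "src \<Lambda> \<mu> = gdom G g"
  shows "\<phi> (t \<kappa> \<otimes>\<^bsub>A\<^esub> u g \<otimes>\<^bsub>A\<^esub> adj A (t \<mu>)) =
    (let p = deg \<Lambda> \<kappa>; q = deg \<Lambda> \<mu>; n = vec_int p - vec_int q in
     if n \<in> Per G \<Lambda> \<and> \<mu> = theta G \<Lambda> p q \<kappa> \<and> g = h_elem G \<Lambda> p q \<kappa>
       then of_real (rho_pow \<Lambda> (- vec_int q) * x (src \<Lambda> \<mu>)) * \<phi> (V_elem G \<Lambda> A u t n)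
     else if n \<in> Per G \<Lambda> \<and> \<mu> = theta G \<Lambda> p q \<kappa> \<and> g \<noteq> h_elem G \<Lambda> p q \<kappa>
       then of_real (rho_pow \<Lambda> (- vec_int q) * c_coeff G \<Lambda> x p q \<kappa> g) * \<phi> (V_elem G \<Lambda> A u t n)
     else 0)"
proof -
  interpret self_similar_action G \<Lambda> by fact
  have A: "cstar_algebra A" "CP_relations G \<Lambda> A u t" using assms(7) by (auto simp: Cuntz_Pimsner_algebra_def)
  interpret cstar_algebra A by fact
  interpret KMS_action G \<Lambda> x A u t \<sigma> \<phi>
    by unfold_locales (use assms A in auto)
  show ?thesis
    using functional_formula[OF assms(10-14)] state_V_elem[of "deg \<Lambda> \<kappa>" "deg \<Lambda> \<mu>"]
    unfolding Let_def spanning_def by presburger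
qed

end
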